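(* Let $\Psi$ be an Orlicz function. If, for some $A>1$, $\Psi(Ax)/\Psi(x)$ is non-decreasing for $x$ large enough, then $J_\Psi\colon H^\Psi\to\mathfrak{B}^\Psi$ is weakly compact if and only if it is compact.
   Context: An Orlicz function is a non-decreasing convex function $\Psi \colon [0,+\infty) \to [0,+\infty)$ with $\Psi(0)=0$ and $\lim_{x\to+\infty}\Psi(x)=+\infty$. For a finite measure space $(S,\mathcal{S},\mu)$, $L^\Psi(\mu)$ is the space of (classes of) measurable $f\colon S\to\mathbb{C}$ for which $\int_S \Psi(|f|/C)\,d\mu<\infty$ for some $C>0$, with norm $\|f\|_\Psi=\inf\{C>0 : \int_S\Psi(|f|/C)\,d\mu\le 1\}$. Let $\mathbb{D}$ be the open unit disk of $\mathbb{C}$ with normalized area measure $\mathcal{A}$, and $\mathbb{T}=\partial\mathbb{D}$ the unit circle with normalized Lebesgue measure $m$. The Hardy-Orlicz space is $H^\Psi=\{f\in H^1 : f^*\in L^\Psi(m)\}$, where $f^*$ is the boundary values function of $f$ on $\mathbb{T}$, with norm $\|f\|_{H^\Psi}=\|f^*\|_{L^\Psi(m)}$. The Bergman-Orlicz space $\mathfrak{B}^\Psi$ is the subspace of analytic functions on $\mathbb{D}$ belonging to $L^\Psi(\mathbb{D},\mathcal{A})$, with the norm of $L^\Psi(\mathcal{A})$. One has $H^\Psi\subseteq\mathfrak{B}^\Psi$ with $\|f\|_{\mathfrak{B}^\Psi}\le\|f\|_{H^\Psi}$, and $J_\Psi\colon H^\Psi\to\mathfrak{B}^\Psi$, $J_\Psi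 f=f$, denotes the canonical (bounded) injection. *)

theory Defs
  imports "HOL-Complex_Analysis.Complex_Analysis" "HOL-Probability.Probability"
begin

section \<open>Normed spaces of complex-valued functions\<close>

text \<open>A normed space is given by a carrier set \<open>V\<close> of complex-valued functions, closed under the
  pointwise operations, and a norm \<open>N\<close> that is only meaningful on \<open>V\<close>.\<close>

text \<open>The locale \<^locale>\<open>Metric_space\<close> asks for nonnegativity and symmetry on the whole type, hence
  the value 0 off the carrier.\<close>

definition norm_dist ::
  "('a \<Rightarrow> complex) set \<Rightarrow> (('a \<Rightarrow> complex) \<Rightarrow> real) \<Rightarrow> ('a \<Rightarrow> complex) \<Rightarrow> ('a \<Rightarrow> complex) \<Rightarrow> real"
  where "norm_dist V N f g = (if f \<in> V \<and> g \<in> V then N (\<lambda>x. f x - g x) else 0)"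

definition norm_topology ::
  "('a \<Rightarrow> complex) set \<Rightarrow> (('a \<Rightarrow> complex) \<Rightarrow> real) \<Rightarrow> ('a \<Rightarrow> complex) topology"
  where "norm_topology V N = Metric_space.mtopology V (norm_dist V N)"

definition dual_space ::
  "('a \<Rightarrow> complex) set \<Rightarrow> (('a \<Rightarrow> complex) \<Rightarrow> real) \<Rightarrow> (('a \<Rightarrow> complex) \<Rightarrow> complex) set"
  where "dual_space V N = {\<phi>.
    (\<forall>f\<in>V. \<forall>g\<in>V. \<phi> (\<lambda>x. f x + g x) = \<phi> f + \<phi> g) \<and>
    (\<forall>c. \<forall>f\<in>V. \<phi> (\<lambda>x. c * f x) = c * \<phi> f) \<and>
    (\<exists>K. \<forall>f\<in>V. cmod (\<phi> f) \<le> K * N f)}"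

definition weak_topology ::
  "('a \<Rightarrow> complex) set \<Rightarrow> (('a \<Rightarrow> complex) \<Rightarrow> real) \<Rightarrow> ('a \<Rightarrow> complex) topology"
  where "weak_topology V N =
    topology_generated_by {{f \<in> V. \<phi> f \<in> U} |\<phi> U. \<phi> \<in> dual_space V N \<and> open U}"

definition closed_unit_ball ::
  "('a \<Rightarrow> complex) set \<Rightarrow> (('a \<Rightarrow> complex) \<Rightarrow> real) \<Rightarrow> ('a \<Rightarrow> complex) set"
  where "closed_unit_ball V N = {f \<in> V. N f \<le> 1}"

text \<open>The inclusion is not redundant: \<open>X closure_of S\<close> ignores points of \<open>S\<close> outside
  \<open>topspace X\<close>.\<close>

definition relatively_compact_in :: "'a topology \<Rightarrow> 'a set \<Rightarrow> bool"
  where "relatively_compact_in X S \<longleftrightarrow> S \<subseteq> topspace X \<and> compactin X (X closure_of S)"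

definition compact_operator ::
  "('a \<Rightarrow> complex) set \<Rightarrow> (('a \<Rightarrow> complex) \<Rightarrow> real) \<Rightarrow>
   ('b \<Rightarrow> complex) set \<Rightarrow> (('b \<Rightarrow> complex) \<Rightarrow> real) \<Rightarrow>
   (('a \<Rightarrow> complex) \<Rightarrow> ('b \<Rightarrow> complex)) \<Rightarrow> bool"
  where "compact_operator V N W M T \<longleftrightarrow>
    relatively_compact_in (norm_topology W M) (T ` closed_unit_ball V N)"

definition weakly_compact_operator ::
  "('a \<Rightarrow> complex) set \<Rightarrow> (('a \<Rightarrow> complex) \<Rightarrow> real) \<Rightarrow>
   ('b \<Rightarrow> complex) set \<Rightarrow> (('b \<Rightarrow> complex) \<Rightarrow> real) \<Rightarrow>
   (('a \<Rightarrow> complex) \<Rightarrow> ('b \<Rightarrow> complex)) \<Rightarrow> bool"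
  where "weakly_compact_operator V N W M T \<longleftrightarrow>
    relatively_compact_in (weak_topology W M) (T ` closed_unit_ball V N)"


section \<open>Orlicz spaces\<close>

text \<open>Only the values of \<open>\<Psi>\<close> on \<open>[0, \<infinity>)\<close> matter.\<close>

definition Orlicz_function :: "(real \<Rightarrow> real) \<Rightarrow> bool"
  where "Orlicz_function \<Psi> \<longleftrightarrow>
    (\<forall>x\<ge>0. 0 \<le> \<Psi> x) \<and> mono_on {0..} \<Psi> \<and> convex_on {0..} \<Psi> \<and> \<Psi> 0 = 0 \<and>
    filterlim \<Psi> at_top at_top"

text \<open>The elements here are functions, not classes. This makes no difference below: analytic
  functions are determined by their classes, and the Hardy-Orlicz condition on a boundary function
  depends only on its class.\<close>

definition Orlicz_space :: "(real \<Rightarrow> real) \<Rightarrow> 'a measure \<Rightarrow> ('a \<Rightarrow> complex) set"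
  where "Orlicz_space \<Psi> M = {f \<in> borel_measurable M.
    \<exists>C>0. (\<integral>\<^sup>+ x. ennreal (\<Psi> (cmod (f x) / C)) \<partial>M) < \<infinity>}"

definition Luxemburg_norm :: "(real \<Rightarrow> real) \<Rightarrow> 'a measure \<Rightarrow> ('a \<Rightarrow> complex) \<Rightarrow> real"
  where "Luxemburg_norm \<Psi> M f =
    Inf {C. C > 0 \<and> (\<integral>\<^sup>+ x. ennreal (\<Psi> (cmod (f x) / C)) \<partial>M) \<le> 1}"


section \<open>Hardy-Orlicz and Bergman-Orlicz spaces\<close>

definition disc_measure :: "complex measure"
  where "disc_measure = scale_measure (ennreal (1 / pi)) (restrict_space lborel (ball 0 1))"

definition circle_measure :: "complex measure"
  where "circle_measure =
    distr (uniform_measure lborel {0..2 * pi}) (restrict_space borel (sphere 0 1)) cis"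

text \<open>Functions on the disc are extended by 0, so that HOL equality is equality on the disc.\<close>

definition analytic_on_disc :: "(complex \<Rightarrow> complex) set"
  where "analytic_on_disc = {f. f analytic_on ball 0 1 \<and> (\<forall>z. z \<notin> ball 0 1 \<longrightarrow> f z = 0)}"

definition Hardy_space_1 :: "(complex \<Rightarrow> complex) set"
  where "Hardy_space_1 = {f \<in> analytic_on_disc.
    (SUP r\<in>{0..<1}. \<integral>\<^sup>+ \<zeta>. ennreal (cmod (f (complex_of_real r * \<zeta>))) \<partial>circle_measure) < \<infinity>}"

text \<open>Radial limits; for \<open>f\<close> in \<open>H\<^sup>1\<close> they exist almost everywhere (Fatou). Where there is
  no limit the value is set to 0.\<close>

definition boundary_values :: "(complex \<Rightarrow> complex) \<Rightarrow> complex \<Rightarrow> complex"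
  where "boundary_values f \<zeta> =
    (if \<exists>l. ((\<lambda>r. f (complex_of_real r * \<zeta>)) \<longlongrightarrow> l) (at_left 1)
     then Lim (at_left 1) (\<lambda>r. f (complex_of_real r * \<zeta>)) else 0)"

definition Hardy_Orlicz :: "(real \<Rightarrow> real) \<Rightarrow> (complex \<Rightarrow> complex) set"
  where "Hardy_Orlicz \<Psi> =
    {f \<in> Hardy_space_1. boundary_values f \<in> Orlicz_space \<Psi> circle_measure}"

definition Hardy_Orlicz_norm :: "(real \<Rightarrow> real) \<Rightarrow> (complex \<Rightarrow> complex) \<Rightarrow> real"
  where "Hardy_Orlicz_norm \<Psi> f = Luxemburg_norm \<Psi> circle_measure (boundary_values f)"

definition Bergman_Orlicz :: "(real \<Rightarrow> real) \<Rightarrow> (complex \<Rightarrow> complex) set"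
  where "Bergman_Orlicz \<Psi> = analytic_on_disc \<inter> Orlicz_space \<Psi> disc_measure"

definition Bergman_Orlicz_norm :: "(real \<Rightarrow> real) \<Rightarrow> (complex \<Rightarrow> complex) \<Rightarrow> real"
  where "Bergman_Orlicz_norm \<Psi> = Luxemburg_norm \<Psi> disc_measure"

definition canonical_injection ::
  "(real \<Rightarrow> real) \<Rightarrow> (complex \<Rightarrow> complex) \<Rightarrow> (complex \<Rightarrow> complex)"
  where "canonical_injection \<Psi> = (\<lambda>f\<in>Hardy_Orlicz \<Psi>. f)"

end

theory Submission imports Defs begin

text \<open>Compactness implies weak compactness for topological reasons: the identity is continuous from the
  norm to the weak topology of the Bergman-Orlicz space, and the weak topology is Hausdorff because
  point evaluations are bounded. The converse goes through the growth condition
  \<open>\<Psi> (B x) / (\<Psi> x)\<^sup>2 \<longlongrightarrow> 0\<close> for every \<open>B > 1\<close>.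

  Weak compactness implies the growth condition (\<open>growth_condition\<close>). The monotone ratio
  \<open>\<Psi> (A x) / \<Psi> x\<close> is bounded or tends to infinity. If it is bounded, \<open>\<Psi> (B x)\<close> is \<open>O(\<Psi> x)\<close> and the
  growth condition is clear. If it tends to infinity and the growth condition fails, there are large
  \<open>x\<close> with \<open>\<Psi> (B x) \<ge> \<epsilon> (\<Psi> x)\<^sup>2\<close>. For such an \<open>x\<close> the bump of height \<open>x\<close> and width \<open>1 / \<Psi> x\<close> at the
  boundary point 1 belongs to a fixed multiple of the Hardy-Orlicz unit ball, and evaluation at its
  tip, a point at distance \<open>1 / \<Psi> x\<close> from the circle, has norm \<open>O(x)\<close> on the Bergman-Orlicz space.
  Bumps of rapidly growing heights behave like the unit vectors of \<open>c\<^sub>0\<close>: their partial sums stay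
  bounded, and a cluster point of the normalized evaluations at the tips separates all partial sums
  from every weak cluster point of them (\<open>not_weakly_compact\<close>).

  The growth condition implies compactness (\<open>unit_ball_subsequence\<close>). The key is an estimate of the
  integral of \<open>(\<Psi> (\<bar>h\<bar> / A))\<^sup>2\<close> over the disc by the modular of the boundary values
  (\<open>square_modular_le\<close>). Carleman's inequality bounds the integral of \<open>\<bar>g\<bar>\<^sup>4\<close> over the disc by the
  square of the integral of \<open>\<bar>g\<bar>\<^sup>2\<close> over the circle for holomorphic \<open>g\<close>, so \<open>\<Psi> (\<bar>h\<bar> / A)\<close> has to be
  dominated by some \<open>\<bar>g\<bar>\<^sup>2\<close>. This is where the hypothesis on \<open>\<Psi>\<close> enters a second time: it makes \<open>\<Psi>\<close>,
  up to the factor \<open>A\<close> in the argument, a supremum of power functions \<open>c y\<^sup>s\<close> (\<open>power_minorant\<close>), and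
  an outer function that dominates \<open>c \<bar>h\<bar>\<^sup>s\<close> on the circle does so in the disc. The growth condition
  turns the estimate into uniform integrability of \<open>\<Psi> (\<bar>h\<bar> / \<epsilon>)\<close>, and a locally uniformly convergent
  subsequence, which Montel's theorem provides, converges in the Bergman-Orlicz norm.

  The elements of the Hardy-Orlicz space are given by their radial limits, so the argument also needs
  Fatou's theorem and the Poisson formula for \<open>H\<^sup>1\<close>. Both follow from the fact that the dilates of an
  \<open>H\<^sup>1\<close> function are Cauchy in \<open>L\<^sup>1\<close> (\<open>Hardy_dilates_Cauchy\<close>), which a factorization into two \<open>H\<^sup>2\<close>
  functions reduces to Parseval's identity; almost everywhere convergence then comes from the
  maximal inequality.\<close>

section \<open>Orlicz functions and the Luxemburg norm\<close>

locale orlicz =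
  fixes \<Psi> :: "real \<Rightarrow> real"
  assumes Orlicz: "Orlicz_function \<Psi>"
begin

lemma nonneg: "0 \<le> x \<Longrightarrow> 0 \<le> \<Psi> x"
  using Orlicz by (simp add: Orlicz_function_def)

lemma zero [simp]: "\<Psi> 0 = 0"
  using Orlicz by (simp add: Orlicz_function_def)

lemma mono: "0 \<le> x \<Longrightarrow> x \<le> y \<Longrightarrow> \<Psi> x \<le> \<Psi> y"
  using Orlicz by (auto simp: Orlicz_function_def mono_on_def)

lemma tendsto_infinity: "filterlim \<Psi> at_top at_top"
  using Orlicz by (simp add: Orlicz_function_def)

lemma convex:
  assumes "0 \<le> x" "0 \<le> y" "0 \<le> u" "0 \<le> v" "u + v = 1"
  shows "\<Psi> (u * x + v * y) \<le> u * \<Psi> x + v * \<Psi> y"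
  using Orlicz assms unfolding Orlicz_function_def convex_on_def by auto

lemma convex_abs: "convex_on UNIV (\<lambda>x. \<Psi> \<bar>x\<bar>)"
  unfolding convex_on_def
proof (intro conjI strip)
  fix x y u v :: real
  assume "0 \<le> u" "0 \<le> v" "u + v = 1"
  have "\<Psi> \<bar>u *\<^sub>R x + v *\<^sub>R y\<bar> \<le> \<Psi> (u * \<bar>x\<bar> + v * \<bar>y\<bar>)"
    using \<open>0 \<le> u\<close> \<open>0 \<le> v\<close> abs_triangle_ineq[of "u * x" "v * y"]
    by (intro mono) (auto simp: abs_mult)
  also have "\<dots> \<le> u * \<Psi> \<bar>x\<bar> + v * \<Psi> \<bar>y\<bar>"
    using \<open>0 \<le> u\<close> \<open>0 \<le> v\<close> \<open>u + v = 1\<close> by (intro convex) auto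
  finally show "\<Psi> \<bar>u *\<^sub>R x + v *\<^sub>R y\<bar> \<le> u * \<Psi> \<bar>x\<bar> + v * \<Psi> \<bar>y\<bar>" .
qed auto

lemma continuous_abs: "continuous_on UNIV (\<lambda>x. \<Psi> \<bar>x\<bar>)"
  using convex_abs by (intro convex_on_continuous) auto

lemma continuous_Psi:
  assumes "continuous_on S g" "\<And>x. x \<in> S \<Longrightarrow> 0 \<le> g x"
  shows "continuous_on S (\<lambda>x. \<Psi> (g x))"
proof -
  have "continuous_on S (\<lambda>x. \<Psi> \<bar>g x\<bar>)"
    using continuous_on_compose2[OF continuous_abs assms(1)] by auto
  then show ?thesis
    by (rule continuous_on_cong[THEN iffD1, rotated -1]) (use assms(2) in auto)
qed

lemma measurable_Psi:
  assumes "g \<in> borel_measurable M" "\<And>x. x \<in> space M \<Longrightarrow> 0 \<le> g x"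
  shows "(\<lambda>x. \<Psi> (g x)) \<in> borel_measurable M"
proof -
  have "(\<lambda>x. \<Psi> \<bar>g x\<bar>) \<in> borel_measurable M"
    using measurable_compose[OF assms(1) borel_measurable_continuous_onI[OF continuous_abs]] .
  then show ?thesis
    by (rule measurable_cong[THEN iffD1, rotated -1]) (use assms(2) in auto)
qed

lemma measurable_modular:
  assumes "f \<in> borel_measurable M" "0 \<le> C"
  shows "(\<lambda>x. ennreal (\<Psi> (cmod (f x) / C))) \<in> borel_measurable M"
  using assms by (intro measurable_compose[OF _ measurable_ennreal] measurable_Psi) auto

lemma scale:
  assumes "0 \<le> t" "t \<le> 1" "0 \<le> x"
  shows "\<Psi> (t * x) \<le> t * \<Psi> x"
  using convex[of x 0 t "1 - t"] assms by simp

text \<open>Convexity and \<open>\<Psi> 0 = 0\<close> make \<open>\<Psi>\<close> strictly increasing as soon as it is positive.\<close>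

lemma reflects_le:
  assumes "\<Psi> s \<le> \<Psi> t" "0 < \<Psi> t" "0 \<le> t"
  shows "s \<le> t"
proof (rule ccontr)
  assume "\<not> s \<le> t"
  then have "s > 0" "t < s" using assms by auto
  have "\<Psi> t \<le> (t / s) * \<Psi> s"
    using scale[of "t / s" s] \<open>t < s\<close> \<open>s > 0\<close> \<open>0 \<le> t\<close> by simp
  also have "\<dots> \<le> (t / s) * \<Psi> t"
    using assms \<open>s > 0\<close> by (intro mult_left_mono) auto
  also have "\<dots> < 1 * \<Psi> t"
    using assms \<open>t < s\<close> \<open>s > 0\<close> by (intro mult_strict_right_mono) auto
  finally show False by simp
qed

lemma eventually_ge: "eventually (\<lambda>x. K \<le> \<Psi> x) at_top"
  using tendsto_infinity by (simp add: filterlim_at_top)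

lemma ex_ge: "\<exists>x>y. K \<le> \<Psi> x"
  using eventually_conj[OF eventually_ge[of K] eventually_gt_at_top[of y]]
  by (auto dest!: eventually_happens)

text \<open>\<open>\<Psi>\<close> grows at least linearly, along the chord from 0 to a point where it is at least 1.\<close>

lemma linear_bound: "\<exists>c>0. \<forall>x\<ge>0. x \<le> c * (1 + \<Psi> x)"
proof -
  obtain y where y: "y > 0" "1 \<le> \<Psi> y" using ex_ge by blast
  have "x \<le> y * (1 + \<Psi> x)" if "x \<ge> 0" for x
  proof (cases "x \<le> y")
    case True
    then show ?thesis using nonneg[OF that] y
      by (smt (verit) mult_left_mono mult_cancel_left1)
  next
    case False
    have "x * 1 \<le> x * \<Psi> y" using False y by (intro mult_left_mono) auto
    also have "\<dots> \<le> y * \<Psi> x" using scale[of "y / x" x] False y by (simp add: field_simps)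
    finally have "x \<le> y * \<Psi> x" by simp
    then show ?thesis using y by (simp add: algebra_simps)
  qed
  then show ?thesis using y by blast
qed

lemma modular_scale:
  assumes "f \<in> borel_measurable M" "0 < C" "C \<le> D"
  shows "(\<integral>\<^sup>+ x. ennreal (\<Psi> (cmod (f x) / D)) \<partial>M)
    \<le> ennreal (C / D) * (\<integral>\<^sup>+ x. ennreal (\<Psi> (cmod (f x) / C)) \<partial>M)"
proof -
  have "(\<integral>\<^sup>+ x. ennreal (\<Psi> (cmod (f x) / D)) \<partial>M)
    \<le> (\<integral>\<^sup>+ x. ennreal (C / D) * ennreal (\<Psi> (cmod (f x) / C)) \<partial>M)"
  proof (rule nn_integral_mono)
    fix x
    have "\<Psi> (cmod (f x) / D) \<le> (C / D) * \<Psi> (cmod (f x) / C)"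
      using scale[of "C / D" "cmod (f x) / C"] assms by simp
    then show "ennreal (\<Psi> (cmod (f x) / D)) \<le> ennreal (C / D) * ennreal (\<Psi> (cmod (f x) / C))"
      using assms nonneg by (simp add: ennreal_mult'[symmetric])
  qed
  also have "\<dots> = ennreal (C / D) * (\<integral>\<^sup>+ x. ennreal (\<Psi> (cmod (f x) / C)) \<partial>M)"
    using assms by (intro nn_integral_cmult measurable_modular) auto
  finally show ?thesis .
qed

lemma Luxemburg_le:
  assumes "C > 0" "(\<integral>\<^sup>+ x. ennreal (\<Psi> (cmod (f x) / C)) \<partial>M) \<le> 1"
  shows "Luxemburg_norm \<Psi> M f \<le> C"
  unfolding Luxemburg_norm_def using assms by (intro cInf_lower) (auto intro: bdd_belowI[of _ 0])

lemma ex_modular_le_1: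
  assumes "f \<in> Orlicz_space \<Psi> M"
  shows "\<exists>C>0. (\<integral>\<^sup>+ x. ennreal (\<Psi> (cmod (f x) / C)) \<partial>M) \<le> 1"
proof -
  obtain C where C: "C > 0" "(\<integral>\<^sup>+ x. ennreal (\<Psi> (cmod (f x) / C)) \<partial>M) < \<infinity>"
    and f: "f \<in> borel_measurable M"
    using assms by (auto simp: Orlicz_space_def)
  define I where "I = enn2real (\<integral>\<^sup>+ x. ennreal (\<Psi> (cmod (f x) / C)) \<partial>M)"
  have I: "(\<integral>\<^sup>+ x. ennreal (\<Psi> (cmod (f x) / C)) \<partial>M) = ennreal I" "I \<ge> 0"
    using C by (auto simp: I_def)
  have "(\<integral>\<^sup>+ x. ennreal (\<Psi> (cmod (f x) / (C * (1 + I)))) \<partial>M) \<le> ennreal (C / (C * (1 + I))) * ennreal I"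
    using modular_scale[OF f C(1), of "C * (1 + I)"] I C by simp
  also have "\<dots> \<le> 1"
  proof -
    have "C / (C * (1 + I)) * I \<le> 1" using C I by (simp add: divide_le_eq)
    then show ?thesis using C I by (simp add: ennreal_mult'[symmetric] ennreal_le_1)
  qed
  finally show ?thesis using C I by (intro exI[of _ "C * (1 + I)"]) (auto intro!: mult_pos_pos)
qed

lemma Luxemburg_less:
  assumes "f \<in> Orlicz_space \<Psi> M" "Luxemburg_norm \<Psi> M f < C"
  shows "C > 0" "(\<integral>\<^sup>+ x. ennreal (\<Psi> (cmod (f x) / C)) \<partial>M) \<le> 1"
proof -
  obtain D where D: "D > 0" "D < C" "(\<integral>\<^sup>+ x. ennreal (\<Psi> (cmod (f x) / D)) \<partial>M) \<le> 1"
    using assms(2) ex_modular_le_1[OF assms(1)] unfolding Luxemburg_norm_def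
    by (subst (asm) cInf_less_iff) (auto intro: bdd_belowI[of _ 0])
  show "C > 0" using D by simp
  have "(\<integral>\<^sup>+ x. ennreal (\<Psi> (cmod (f x) / C)) \<partial>M) \<le> ennreal (D / C) * 1"
    using order_trans[OF modular_scale mult_left_mono[OF D(3)]] assms D by (auto simp: Orlicz_space_def)
  also have "\<dots> \<le> 1" using D by (simp add: ennreal_le_1)
  finally show "(\<integral>\<^sup>+ x. ennreal (\<Psi> (cmod (f x) / C)) \<partial>M) \<le> 1" .
qed

lemma Luxemburg_nonneg:
  assumes "f \<in> Orlicz_space \<Psi> M"
  shows "0 \<le> Luxemburg_norm \<Psi> M f"
  using Luxemburg_less(1)[OF assms] by (meson linorder_not_less not_less_iff_gr_or_eq)

lemma Orlicz_spaceI: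
  assumes "f \<in> borel_measurable M" "C > 0" "(\<integral>\<^sup>+ x. ennreal (\<Psi> (cmod (f x) / C)) \<partial>M) < \<infinity>"
  shows "f \<in> Orlicz_space \<Psi> M"
  using assms by (auto simp: Orlicz_space_def)

text \<open>The triangle inequality for the Luxemburg norm: \<open>(f - g) / (C + D)\<close> is a convex combination of
  \<open>f / C\<close> and \<open>- g / D\<close>.\<close>

lemma modular_diff:
  assumes "f \<in> borel_measurable M" "g \<in> borel_measurable M" "C > 0" "D > 0"
    and "(\<integral>\<^sup>+ x. ennreal (\<Psi> (cmod (f x) / C)) \<partial>M) \<le> 1"
    and "(\<integral>\<^sup>+ x. ennreal (\<Psi> (cmod (g x) / D)) \<partial>M) \<le> 1"
  shows "(\<integral>\<^sup>+ x. ennreal (\<Psi> (cmod (f x - g x) / (C + D))) \<partial>M) \<le> 1"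
proof -
  have "(\<integral>\<^sup>+ x. ennreal (\<Psi> (cmod (f x - g x) / (C + D))) \<partial>M) \<le>
    (\<integral>\<^sup>+ x. ennreal (C / (C + D)) * ennreal (\<Psi> (cmod (f x) / C))
          + ennreal (D / (C + D)) * ennreal (\<Psi> (cmod (g x) / D)) \<partial>M)"
  proof (rule nn_integral_mono)
    fix x
    have "cmod (f x - g x) / (C + D) \<le> C / (C + D) * (cmod (f x) / C) + D / (C + D) * (cmod (g x) / D)"
      using assms norm_triangle_ineq4[of "f x" "g x"] by (simp add: add_divide_distrib[symmetric] divide_right_mono)
    then have "\<Psi> (cmod (f x - g x) / (C + D))
        \<le> \<Psi> (C / (C + D) * (cmod (f x) / C) + D / (C + D) * (cmod (g x) / D))"
      using assms by (intro mono) auto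
    also have "\<dots> \<le> C / (C + D) * \<Psi> (cmod (f x) / C) + D / (C + D) * \<Psi> (cmod (g x) / D)"
      using assms by (intro convex) (auto simp: add_divide_distrib[symmetric])
    finally show "ennreal (\<Psi> (cmod (f x - g x) / (C + D))) \<le> ennreal (C / (C + D)) * ennreal (\<Psi> (cmod (f x) / C))
          + ennreal (D / (C + D)) * ennreal (\<Psi> (cmod (g x) / D))"
      using assms nonneg by (simp add: ennreal_mult'[symmetric] ennreal_plus[symmetric] del: ennreal_plus)
  qed
  also have "\<dots> = ennreal (C / (C + D)) * (\<integral>\<^sup>+ x. ennreal (\<Psi> (cmod (f x) / C)) \<partial>M)
          + ennreal (D / (C + D)) * (\<integral>\<^sup>+ x. ennreal (\<Psi> (cmod (g x) / D)) \<partial>M)"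
    using assms by (subst nn_integral_add) (auto intro!: borel_measurable_times_ennreal measurable_modular
        simp: nn_integral_cmult measurable_modular)
  also have "\<dots> \<le> ennreal (C / (C + D)) * 1 + ennreal (D / (C + D)) * 1"
    using assms by (intro add_mono mult_left_mono) auto
  also have "\<dots> = 1"
    using assms by (simp add: ennreal_plus[symmetric] add_divide_distrib[symmetric] del: ennreal_plus)
  finally show ?thesis .
qed

lemma Luxemburg_diff:
  assumes "f \<in> Orlicz_space \<Psi> M" "g \<in> Orlicz_space \<Psi> M"
  shows "(\<lambda>x. f x - g x) \<in> Orlicz_space \<Psi> M"
    and "Luxemburg_norm \<Psi> M (\<lambda>x. f x - g x) \<le> Luxemburg_norm \<Psi> M f + Luxemburg_norm \<Psi> M g"
proof -
  have meas: "f \<in> borel_measurable M" "g \<in> borel_measurable M"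
    using assms by (auto simp: Orlicz_space_def)
  obtain C D where CD: "C > 0" "D > 0" "(\<integral>\<^sup>+ x. ennreal (\<Psi> (cmod (f x) / C)) \<partial>M) \<le> 1"
    "(\<integral>\<^sup>+ x. ennreal (\<Psi> (cmod (g x) / D)) \<partial>M) \<le> 1"
    using ex_modular_le_1[OF assms(1)] ex_modular_le_1[OF assms(2)] by auto
  show "(\<lambda>x. f x - g x) \<in> Orlicz_space \<Psi> M"
    using modular_diff[OF meas CD] meas CD
    by (intro Orlicz_spaceI[of _ _ "C + D"]) (auto simp: le_less_trans[OF _ ennreal_one_less_top])
  show "Luxemburg_norm \<Psi> M (\<lambda>x. f x - g x) \<le> Luxemburg_norm \<Psi> M f + Luxemburg_norm \<Psi> M g"
  proof (rule field_le_epsilon)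
    fix e :: real assume "e > 0"
    then have *: "Luxemburg_norm \<Psi> M f < Luxemburg_norm \<Psi> M f + e / 2"
      "Luxemburg_norm \<Psi> M g < Luxemburg_norm \<Psi> M g + e / 2" by auto
    note f = Luxemburg_less[OF assms(1) *(1)] and g = Luxemburg_less[OF assms(2) *(2)]
    have "Luxemburg_norm \<Psi> M (\<lambda>x. f x - g x)
      \<le> (Luxemburg_norm \<Psi> M f + e / 2) + (Luxemburg_norm \<Psi> M g + e / 2)"
      using modular_diff[OF meas f(1) g(1) f(2) g(2)] f(1) g(1) by (intro Luxemburg_le) auto
    then show "Luxemburg_norm \<Psi> M (\<lambda>x. f x - g x) \<le> Luxemburg_norm \<Psi> M f + Luxemburg_norm \<Psi> M g + e"
      by simp
  qed
qed

lemma Orlicz_space_cmult: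
  assumes "f \<in> Orlicz_space \<Psi> M"
  shows "(\<lambda>x. c * f x) \<in> Orlicz_space \<Psi> M"
proof -
  obtain C where C: "C > 0" "(\<integral>\<^sup>+ x. ennreal (\<Psi> (cmod (f x) / C)) \<partial>M) < \<infinity>"
    and f: "f \<in> borel_measurable M"
    using assms by (auto simp: Orlicz_space_def)
  show ?thesis
  proof (cases "c = 0")
    case True
    then show ?thesis by (intro Orlicz_spaceI[of _ _ 1]) auto
  next
    case False
    then show ?thesis using C f
      by (intro Orlicz_spaceI[of _ _ "cmod c * C"]) (auto simp: norm_mult)
  qed
qed

end

section \<open>Integration over the unit circle\<close>

lemma space_circle_measure [simp]: "space circle_measure = sphere 0 1"
  by (simp add: circle_measure_def space_restrict_space)

lemma sets_circle_measure: "sets circle_measure = sets (restrict_space borel (sphere 0 1))"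
  by (simp add: circle_measure_def)

lemma cis_measurable_circle:
  "cis \<in> measurable (uniform_measure lborel {0..2 * pi}) (restrict_space borel (sphere 0 1))"
  unfolding measurable_cong_sets[OF sets_uniform_measure refl] measurable_lborel1
  by (intro measurable_restrict_space2)
     (auto intro!: borel_measurable_continuous_onI continuous_intros)

lemma prob_space_circle: "prob_space circle_measure"
  unfolding circle_measure_def
  by (intro prob_space.prob_space_distr prob_space_uniform_measure cis_measurable_circle) auto

interpretation circle: prob_space circle_measure
  by (rule prob_space_circle)

lemma continuous_imp_measurable_circle:
  fixes f :: "complex \<Rightarrow> 'a::topological_space"
  assumes "continuous_on (sphere 0 1) f"
  shows "f \<in> borel_measurable circle_measure"
  using borel_measurable_continuous_on_restrict[OF assms]
  by (simp add: measurable_cong_sets[OF sets_circle_measure refl])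

lemma measurable_circle_cis:
  assumes "f \<in> measurable circle_measure N"
  shows "(\<lambda>t. f (cis t)) \<in> measurable lborel N"
proof -
  have "f \<in> measurable (restrict_space borel (sphere 0 1)) N"
    using assms by (simp add: measurable_cong_sets[OF sets_circle_measure refl])
  moreover have "cis \<in> measurable lborel (restrict_space borel (sphere 0 1))"
    by (intro measurable_restrict_space2)
       (auto intro!: borel_measurable_continuous_onI continuous_intros)
  ultimately show ?thesis by (rule measurable_compose[rotated])
qed

lemma nn_integral_circle:
  assumes "f \<in> borel_measurable circle_measure"
  shows "(\<integral>\<^sup>+ \<zeta>. f \<zeta> \<partial>circle_measure)
    = ennreal (1 / (2 * pi)) * (\<integral>\<^sup>+ t. f (cis t) * indicator {0..2 * pi} t \<partial>lborel)"
proof -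
  have "(\<integral>\<^sup>+ \<zeta>. f \<zeta> \<partial>circle_measure) = (\<integral>\<^sup>+ t. f (cis t) \<partial>uniform_measure lborel {0..2 * pi})"
    unfolding circle_measure_def using assms
    by (intro nn_integral_distr cis_measurable_circle)
       (simp add: circle_measure_def)
  also have "\<dots> = (\<integral>\<^sup>+ t. f (cis t) * indicator {0..2 * pi} t \<partial>lborel) / ennreal (2 * pi)"
    using measurable_circle_cis[OF assms] by (subst nn_integral_uniform_measure) auto
  finally show ?thesis
    by (simp add: divide_ennreal_def inverse_ennreal mult.commute inverse_eq_divide)
qed

lemma integral_circle:
  fixes f :: "complex \<Rightarrow> 'a::euclidean_space"
  assumes "continuous_on (sphere 0 1) f"
  shows "integrable circle_measure f"
    and "((\<lambda>t. f (cis t)) has_integral (2 * pi) *\<^sub>R (\<integral>\<zeta>. f \<zeta> \<partial>circle_measure)) {0..2 * pi}"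
proof -
  have meas: "f \<in> borel_measurable circle_measure"
    using assms by (rule continuous_imp_measurable_circle)
  have "bounded (f ` sphere 0 1)"
    using assms by (intro compact_imp_bounded compact_continuous_image) auto
  then obtain B where "\<forall>z\<in>sphere 0 1. norm (f z) \<le> B"
    unfolding bounded_iff ball_simps by blast
  then show "integrable circle_measure f"
    using meas by (intro circle.integrable_const_bound[of _ B]) auto
  have cont: "continuous_on {0..2 * pi} (\<lambda>t. f (cis t))"
    by (intro continuous_on_compose2[OF assms]) (auto intro!: continuous_intros)
  have si: "set_integrable lborel {0..2 * pi} (\<lambda>t. f (cis t))"
    using cont by (rule borel_integrable_atLeastAtMost')
  have "(\<integral>\<zeta>. f \<zeta> \<partial>circle_measure) = (\<integral>t. f (cis t) \<partial>uniform_measure lborel {0..2 * pi})"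
    unfolding circle_measure_def using meas
    by (intro integral_distr cis_measurable_circle) (simp add: circle_measure_def)
  also have "uniform_measure lborel {0..2 * pi}
      = density lborel (\<lambda>t. ennreal (indicator {0..2 * pi} t / (2 * pi)))"
    unfolding uniform_measure_def
    by (intro density_cong) (auto simp: indicator_def divide_ennreal[symmetric])
  also have "(\<integral>t. f (cis t) \<partial>density lborel (\<lambda>t. ennreal (indicator {0..2 * pi} t / (2 * pi))))
      = (\<integral>t. (indicator {0..2 * pi} t / (2 * pi)) *\<^sub>R f (cis t) \<partial>lborel)"
    using measurable_circle_cis[OF meas] by (intro integral_density) auto
  also have "\<dots> = (1 / (2 * pi)) *\<^sub>R (LINT t:{0..2 * pi}|lborel. f (cis t))"
  proof -
    have "(\<lambda>t. (indicator {0..2 * pi} t / (2 * pi)) *\<^sub>R f (cis t))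
        = (\<lambda>t. (1 / (2 * pi)) *\<^sub>R (indicator {0..2 * pi} t *\<^sub>R f (cis t)))"
      by (simp add: fun_eq_iff)
    then show ?thesis
      unfolding set_lebesgue_integral_def by (simp only: integral_scaleR_right)
  qed
  finally have "(2 * pi) *\<^sub>R (\<integral>\<zeta>. f \<zeta> \<partial>circle_measure) = (LINT t:{0..2 * pi}|lborel. f (cis t))"
    by simp
  then show "((\<lambda>t. f (cis t)) has_integral (2 * pi) *\<^sub>R (\<integral>\<zeta>. f \<zeta> \<partial>circle_measure)) {0..2 * pi}"
    using set_borel_integral_eq_integral[OF si] by (simp add: integrable_integral)
qed

lemma nn_integral_circle_continuous:
  fixes f :: "complex \<Rightarrow> real"
  assumes "continuous_on (sphere 0 1) f" "\<And>\<zeta>. \<zeta> \<in> sphere 0 1 \<Longrightarrow> 0 \<le> f \<zeta>"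
  shows "(\<integral>\<^sup>+ \<zeta>. ennreal (f \<zeta>) \<partial>circle_measure) = ennreal (\<integral>\<zeta>. f \<zeta> \<partial>circle_measure)"
  using integral_circle(1)[OF assms(1)] assms(2) by (intro nn_integral_eq_integral) (auto intro!: AE_I2)

lemma Cauchy_formula_circle:
  assumes "continuous_on (cball 0 1) F" "F holomorphic_on ball 0 1" "z \<in> ball 0 1"
  shows "(\<integral>\<zeta>. F \<zeta> * \<zeta> / (\<zeta> - z) \<partial>circle_measure) = F z"
proof -
  have ne: "\<zeta> - z \<noteq> 0" if "\<zeta> \<in> sphere 0 1" for \<zeta> using assms(3) that by auto
  have cont: "continuous_on (sphere 0 1) (\<lambda>\<zeta>. F \<zeta> * \<zeta> / (\<zeta> - z))"
    using ne by (intro continuous_intros continuous_on_subset[OF assms(1)]) auto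
  have "((\<lambda>u. F u / (u - z)) has_contour_integral (2 * of_real pi * \<i> * F z))
     (part_circlepath 0 1 0 (2 * pi))"
    using Cauchy_integral_circlepath[of 0 1 F z] assms by (simp add: circlepath_def)
  then have "((\<lambda>t. \<i> * (F (cis t) * cis t / (cis t - z))) has_integral (2 * of_real pi * \<i> * F z)) {0..2 * pi}"
    by (simp add: has_contour_integral_part_circlepath_iff mult_ac)
  moreover have "((\<lambda>t. \<i> * (F (cis t) * cis t / (cis t - z))) has_integral
      \<i> * ((2 * pi) *\<^sub>R (\<integral>\<zeta>. F \<zeta> * \<zeta> / (\<zeta> - z) \<partial>circle_measure))) {0..2 * pi}"
    by (intro has_integral_mult_right integral_circle(2)[OF cont])
  ultimately have "2 * of_real pi * \<i> * F z
      = \<i> * ((2 * pi) *\<^sub>R (\<integral>\<zeta>. F \<zeta> * \<zeta> / (\<zeta> - z) \<partial>circle_measure))"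
    by (rule has_integral_unique)
  then show ?thesis by (simp add: scaleR_conv_of_real)
qed

lemma mean_value_circle:
  assumes "continuous_on (cball 0 1) F" "F holomorphic_on ball 0 1"
  shows "(\<integral>\<zeta>. F \<zeta> \<partial>circle_measure) = F 0"
proof -
  have "(\<integral>\<zeta>. F \<zeta> \<partial>circle_measure) = (\<integral>\<zeta>. F \<zeta> * \<zeta> / (\<zeta> - 0) \<partial>circle_measure)"
    by (intro Bochner_Integration.integral_cong) auto
  then show ?thesis using Cauchy_formula_circle[OF assms, of 0] by simp
qed

lemma circle_orthogonal:
  "(\<integral>\<zeta>. \<zeta> ^ m * cnj (\<zeta> ^ n) \<partial>circle_measure) = (if m = n then 1 else 0)"
proof -
  have le: "(\<integral>\<zeta>. \<zeta> ^ m * cnj (\<zeta> ^ n) \<partial>circle_measure) = (if m = n then 1 else 0)" if "n \<le> m" for m n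
  proof -
    have "(\<integral>\<zeta>. \<zeta> ^ m * cnj (\<zeta> ^ n) \<partial>circle_measure) = (\<integral>\<zeta>. \<zeta> ^ (m - n) \<partial>circle_measure)"
    proof (intro Bochner_Integration.integral_cong refl)
      fix \<zeta> assume "\<zeta> \<in> space circle_measure"
      then have "\<zeta> * cnj \<zeta> = 1" by (simp add: complex_norm_square[symmetric])
      then have "(\<zeta> * cnj \<zeta>) ^ n = 1" by simp
      moreover have "\<zeta> ^ m = \<zeta> ^ (m - n) * \<zeta> ^ n" using that by (simp add: power_add[symmetric])
      ultimately show "\<zeta> ^ m * cnj (\<zeta> ^ n) = \<zeta> ^ (m - n)"
        by (simp add: power_mult_distrib mult.assoc)
    qed
    also have "\<dots> = 0 ^ (m - n)" by (intro mean_value_circle) (auto intro!: continuous_intros holomorphic_intros)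
    finally show ?thesis using that by (simp add: zero_power)
  qed
  show ?thesis
  proof (cases "n \<le> m")
    case False
    have "(\<integral>\<zeta>. \<zeta> ^ m * cnj (\<zeta> ^ n) \<partial>circle_measure) = (\<integral>\<zeta>. cnj (\<zeta> ^ n * cnj (\<zeta> ^ m)) \<partial>circle_measure)"
      by (simp add: mult.commute)
    also have "\<dots> = cnj (\<integral>\<zeta>. \<zeta> ^ n * cnj (\<zeta> ^ m) \<partial>circle_measure)" by (rule Bochner_Integration.integral_cnj)
    finally show ?thesis using le[of m n] False by auto
  qed (rule le)
qed

definition Poisson_kernel :: "complex \<Rightarrow> complex \<Rightarrow> real"
  where "Poisson_kernel z \<zeta> = (1 - (cmod z)\<^sup>2) / (cmod (\<zeta> - z))\<^sup>2"

lemma Poisson_kernel_nonneg: "z \<in> ball 0 1 \<Longrightarrow> 0 \<le> Poisson_kernel z \<zeta>"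
  by (auto simp: Poisson_kernel_def power_le_one_iff)

lemma Poisson_kernel_le:
  assumes "z \<in> ball 0 1" "\<zeta> \<in> sphere 0 1"
  shows "Poisson_kernel z \<zeta> \<le> 2 / (1 - cmod z)"
proof -
  have z: "cmod z < 1" "cmod \<zeta> = 1" using assms by auto
  have "1 - cmod z \<le> cmod (\<zeta> - z)" using norm_triangle_ineq2[of \<zeta> z] z by simp
  then have "(1 - cmod z)\<^sup>2 \<le> (cmod (\<zeta> - z))\<^sup>2" using z by (intro power_mono) auto
  then have "Poisson_kernel z \<zeta> \<le> (1 - (cmod z)\<^sup>2) / (1 - cmod z)\<^sup>2"
    unfolding Poisson_kernel_def using z \<open>1 - cmod z \<le> cmod (\<zeta> - z)\<close>
    by (intro divide_left_mono mult_pos_pos zero_less_power) (auto simp: power_le_one_iff)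
  also have "\<dots> = (1 + cmod z) / (1 - cmod z)"
  proof -
    have "1 - (cmod z)\<^sup>2 = (1 + cmod z) * (1 - cmod z)" by (simp add: power2_eq_square algebra_simps)
    then show ?thesis using z by (simp add: power2_eq_square)
  qed
  also have "\<dots> \<le> 2 / (1 - cmod z)" using z by (intro divide_right_mono) auto
  finally show ?thesis .
qed

lemma continuous_Poisson_kernel:
  assumes "z \<in> ball 0 1"
  shows "continuous_on (sphere 0 1) (Poisson_kernel z)"
  unfolding Poisson_kernel_def using assms by (intro continuous_intros) auto

lemma Poisson_kernel_commute:
  assumes "\<zeta> \<in> sphere 0 1" "\<xi> \<in> sphere 0 1"
  shows "Poisson_kernel (of_real r * \<zeta>) \<xi> = Poisson_kernel (of_real r * \<xi>) \<zeta>"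
proof -
  have "(cmod (\<xi> - of_real r * \<zeta>))\<^sup>2 = (cmod (\<zeta> - of_real r * \<xi>))\<^sup>2"
    using assms unfolding cmod_power2
    by (simp add: norm_complex_def) (simp add: power2_eq_square, algebra)
  then show ?thesis using assms by (simp add: Poisson_kernel_def norm_mult)
qed

text \<open>Cauchy's formula for the function \<open>w \<mapsto> F w (1 - \<bar>z\<bar>\<^sup>2) / (1 - cnj z w)\<close>, which has the
  value \<open>F z\<close> at \<open>z\<close>, has the Poisson kernel as its kernel.\<close>

lemma Poisson_formula:
  assumes "continuous_on (cball 0 1) F" "F holomorphic_on ball 0 1" "z \<in> ball 0 1"
  shows "(\<integral>\<zeta>. of_real (Poisson_kernel z \<zeta>) * F \<zeta> \<partial>circle_measure) = F z"
proof -
  have z: "cmod z < 1" using assms by auto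
  have ne: "1 - cnj z * w \<noteq> 0" if "w \<in> cball 0 1" for w
  proof
    assume "1 - cnj z * w = 0"
    then have "cmod z * cmod w = 1" by (metis complex_mod_cnj eq_iff_diff_eq_0 norm_mult norm_one)
    moreover have "cmod z * cmod w \<le> cmod z" using that by (simp add: mult_left_le)
    ultimately show False using z by simp
  qed
  define G where "G w = F w * (of_real (1 - (cmod z)\<^sup>2) / (1 - cnj z * w))" for w
  have "(\<integral>\<zeta>. G \<zeta> * \<zeta> / (\<zeta> - z) \<partial>circle_measure) = G z"
  proof (rule Cauchy_formula_circle)
    show "continuous_on (cball 0 1) G" unfolding G_def
      using ne by (intro continuous_intros assms(1)) auto
    show "G holomorphic_on ball 0 1" unfolding G_def
      using ne by (intro holomorphic_intros assms(2)) auto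
  qed (use assms in auto)
  also have "G z = F z"
  proof -
    have "1 - cnj z * z = of_real (1 - (cmod z)\<^sup>2)"
      by (metis complex_norm_square mult.commute of_real_1 of_real_diff)
    then show ?thesis using ne[of z] z by (simp add: G_def)
  qed
  also have "(\<integral>\<zeta>. G \<zeta> * \<zeta> / (\<zeta> - z) \<partial>circle_measure)
      = (\<integral>\<zeta>. of_real (Poisson_kernel z \<zeta>) * F \<zeta> \<partial>circle_measure)"
  proof (intro Bochner_Integration.integral_cong refl)
    fix \<zeta> assume "\<zeta> \<in> space circle_measure"
    then have \<zeta>: "cmod \<zeta> = 1" by simp
    then have "\<zeta> * cnj \<zeta> = 1" by (simp add: complex_norm_square[symmetric])
    then have "\<zeta> * cnj (\<zeta> - z) = 1 - cnj z * \<zeta>" by (simp add: algebra_simps)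
    then have "(1 - cnj z * \<zeta>) * (\<zeta> - z) = \<zeta> * of_real ((cmod (\<zeta> - z))\<^sup>2)"
      by (simp only: complex_norm_square) (metis (no_types, lifting) mult.assoc mult.commute)
    moreover have "\<zeta> \<noteq> 0" "\<zeta> - z \<noteq> 0" using \<zeta> z by auto
    ultimately show "G \<zeta> * \<zeta> / (\<zeta> - z) = of_real (Poisson_kernel z \<zeta>) * F \<zeta>"
      using ne[of \<zeta>] \<zeta> unfolding G_def Poisson_kernel_def
      by (simp add: divide_simps)
  qed
  finally show ?thesis .
qed

lemma Poisson_kernel_integral:
  assumes "z \<in> ball 0 1"
  shows "(\<integral>\<zeta>. Poisson_kernel z \<zeta> \<partial>circle_measure) = 1"
    and "(\<integral>\<^sup>+ \<zeta>. ennreal (Poisson_kernel z \<zeta>) \<partial>circle_measure) = 1"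
proof -
  show *: "(\<integral>\<zeta>. Poisson_kernel z \<zeta> \<partial>circle_measure) = 1"
    using Poisson_formula[of "\<lambda>_. 1" z] assms by (simp add: integral_complex_of_real)
  show "(\<integral>\<^sup>+ \<zeta>. ennreal (Poisson_kernel z \<zeta>) \<partial>circle_measure) = 1"
    using assms by (subst nn_integral_circle_continuous)
      (auto simp: * continuous_Poisson_kernel Poisson_kernel_nonneg)
qed

lemma integrable_Poisson_mult:
  fixes b :: "complex \<Rightarrow> complex"
  assumes "z \<in> ball 0 1" "integrable circle_measure b"
  shows "integrable circle_measure (\<lambda>\<zeta>. of_real (Poisson_kernel z \<zeta>) * b \<zeta>)"
proof (rule Bochner_Integration.integrable_bound[of _ "\<lambda>\<zeta>. of_real (2 / (1 - cmod z)) * b \<zeta>"])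
  show "integrable circle_measure (\<lambda>\<zeta>. of_real (2 / (1 - cmod z)) * b \<zeta>)"
    by (intro integrable_mult_right assms(2))
  show "(\<lambda>\<zeta>. of_real (Poisson_kernel z \<zeta>) * b \<zeta>) \<in> borel_measurable circle_measure"
  proof (intro borel_measurable_times borel_measurable_integrable[OF assms(2)])
    show "(\<lambda>\<zeta>. complex_of_real (Poisson_kernel z \<zeta>)) \<in> borel_measurable circle_measure"
      by (intro continuous_imp_measurable_circle continuous_on_of_real continuous_Poisson_kernel assms)
  qed
  show "AE \<zeta> in circle_measure. norm (of_real (Poisson_kernel z \<zeta>) * b \<zeta>) \<le> norm (of_real (2 / (1 - cmod z)) * b \<zeta>)"
  proof (rule AE_I2)
    fix \<zeta> assume "\<zeta> \<in> space circle_measure"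
    then have "\<bar>Poisson_kernel z \<zeta>\<bar> \<le> \<bar>2 / (1 - cmod z)\<bar>"
      using Poisson_kernel_le[OF assms(1), of \<zeta>] Poisson_kernel_nonneg[OF assms(1), of \<zeta>] assms(1) by simp
    then show "norm (of_real (Poisson_kernel z \<zeta>) * b \<zeta>) \<le> norm (of_real (2 / (1 - cmod z)) * b \<zeta>)"
      unfolding norm_mult norm_of_real by (rule mult_right_mono) simp
  qed
qed

section \<open>Integration over the unit disc\<close>

lemma lborel_complex:
  "(lborel :: complex measure) = distr (lborel \<Otimes>\<^sub>M lborel) borel (\<lambda>(x, y). Complex x y)"
proof (rule lborel_eqI)
  have meas: "(\<lambda>(x, y). Complex x y) \<in> (lborel \<Otimes>\<^sub>M lborel) \<rightarrow>\<^sub>M (borel :: complex measure)"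
    by (auto simp: lborel_prod case_prod_beta Complex_eq intro!: borel_measurable_continuous_onI continuous_intros)
  fix l u :: complex
  assume le: "\<And>b. b \<in> Basis \<Longrightarrow> l \<bullet> b \<le> u \<bullet> b"
  have "(\<lambda>(x, y). Complex x y) -` box l u \<inter> space (lborel \<Otimes>\<^sub>M lborel)
      = {Re l<..<Re u} \<times> {Im l<..<Im u}"
    by (auto simp: box_def Basis_complex_def space_pair_measure)
  then show "emeasure (distr (lborel \<Otimes>\<^sub>M lborel) borel (\<lambda>(x, y). Complex x y)) (box l u)
      = ennreal (\<Prod>b\<in>Basis. (u - l) \<bullet> b)"
    using le[of 1] le[of \<i>] meas
    by (subst emeasure_distr)
       (auto simp: lborel.emeasure_pair_measure_Times Basis_complex_def ennreal_mult'[symmetric])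
qed simp

lemma nn_integral_lborel_complex:
  assumes [measurable]: "h \<in> borel_measurable borel"
  shows "(\<integral>\<^sup>+ z. h z \<partial>lborel) = (\<integral>\<^sup>+ x. \<integral>\<^sup>+ y. h (Complex x y) \<partial>lborel \<partial>lborel)" (is ?xy)
    and "(\<integral>\<^sup>+ z. h z \<partial>lborel) = (\<integral>\<^sup>+ y. \<integral>\<^sup>+ x. h (Complex x y) \<partial>lborel \<partial>lborel)" (is ?yx)
proof -
  have [measurable]: "(\<lambda>(x, y). Complex x y) \<in> (lborel \<Otimes>\<^sub>M lborel) \<rightarrow>\<^sub>M (borel :: complex measure)"
    by (auto simp: lborel_prod case_prod_beta Complex_eq intro!: borel_measurable_continuous_onI continuous_intros)
  have meas: "(\<lambda>(x, y). h (Complex x y)) \<in> borel_measurable (lborel \<Otimes>\<^sub>M lborel)"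
    by (simp add: case_prod_beta Complex_eq)
  have *: "(\<integral>\<^sup>+ z. h z \<partial>lborel) = (\<integral>\<^sup>+ p. (case p of (x, y) \<Rightarrow> h (Complex x y)) \<partial>(lborel \<Otimes>\<^sub>M lborel))"
    by (subst lborel_complex, subst nn_integral_distr) (auto simp: split_beta')
  show ?xy unfolding * using lborel.nn_integral_fst[OF meas] by simp
  show ?yx unfolding * using lborel_pair.nn_integral_snd[OF meas] by simp
qed

lemma nn_integral_lborel_shear:
  assumes [measurable]: "h \<in> borel_measurable borel"
  shows "(\<integral>\<^sup>+ z. h (Complex (Re z + k * Im z) (Im z)) \<partial>lborel) = (\<integral>\<^sup>+ z. h z \<partial>lborel)" (is ?x)
    and "(\<integral>\<^sup>+ z. h (Complex (Re z) (Im z + k * Re z)) \<partial>lborel) = (\<integral>\<^sup>+ z. h z \<partial>lborel)" (is ?y)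
proof -
  have [measurable]: "(\<lambda>x. h (Complex x y)) \<in> borel_measurable borel"
    "(\<lambda>x. h (Complex y x)) \<in> borel_measurable borel" for y
    by (simp_all add: Complex_eq)
  have shift: "(\<integral>\<^sup>+ x. g (x + t) \<partial>lborel) = (\<integral>\<^sup>+ x. g x \<partial>lborel)"
    if "g \<in> borel_measurable borel" for g and t :: real
    using nn_integral_real_affine[OF that, of 1 t] by (simp add: add.commute)
  have "(\<lambda>z. h (Complex (Re z + k * Im z) (Im z))) \<in> borel_measurable borel"
    "(\<lambda>z. h (Complex (Re z) (Im z + k * Re z))) \<in> borel_measurable borel"
    by (simp_all add: Complex_eq)
  note meas = this
  show ?x
    unfolding nn_integral_lborel_complex(2)[OF meas(1)] nn_integral_lborel_complex(2)[OF assms]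
    by (simp add: shift[of "\<lambda>x. h (Complex x y)" for y])
  show ?y
    unfolding nn_integral_lborel_complex(1)[OF meas(2)] nn_integral_lborel_complex(1)[OF assms]
    by (simp add: shift[of "\<lambda>y. h (Complex x y)" for x])
qed

text \<open>A rotation by an angle other than \<open>\<pi>\<close> is a product of three shears, each of which preserves area
  by Fubini; the half turn is two quarter turns.\<close>

lemma nn_integral_lborel_rotate:
  assumes [measurable]: "h \<in> borel_measurable borel" and "cmod c = 1"
  shows "(\<integral>\<^sup>+ z. h (c * z) \<partial>lborel) = (\<integral>\<^sup>+ z. h z \<partial>lborel)"
proof -
  have *: "(\<integral>\<^sup>+ z. h (c * z) \<partial>lborel) = (\<integral>\<^sup>+ z. h z \<partial>lborel)"
    if [measurable]: "h \<in> borel_measurable borel" and c: "cmod c = 1" "c \<noteq> -1" for h :: "complex \<Rightarrow> ennreal" and c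
  proof -
    have c2: "(Re c)\<^sup>2 + (Im c)\<^sup>2 = 1" using c(1) by (simp add: cmod_power2[symmetric])
    have ne: "1 + Re c \<noteq> 0"
    proof
      assume "1 + Re c = 0"
      then have "Re c = -1" by simp
      moreover from this have "Im c = 0" using c2 by simp
      ultimately show False using c(2) by (simp add: complex_eq_iff)
    qed
    \<comment> \<open>With \<open>c = cis \<theta>\<close> this is \<open>- tan (\<theta> / 2)\<close>.\<close>
    define k where "k = - Im c / (1 + Re c)"
    define S where "S z = Complex (Re z + k * Im z) (Im z)" for z
    define R where "R z = Complex (Re z) (Im z + Im c * Re z)" for z
    have kc: "k * (1 + Re c) = - Im c" using ne by (simp add: k_def)
    have k1: "1 + k * Im c = Re c"
    proof -
      have "(1 + k * Im c) * (1 + Re c) = (1 + Re c) + (k * (1 + Re c)) * Im c"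
        by (simp add: algebra_simps)
      also have "\<dots> = (1 + Re c) - (Im c)\<^sup>2" unfolding kc by (simp add: power2_eq_square)
      also have "\<dots> = Re c * (1 + Re c)" using c2 by (simp add: algebra_simps power2_eq_square)
      finally show ?thesis using ne by simp
    qed
    have SRS: "S (R (S z)) = c * z" for z
    proof (rule complex_eqI)
      have "Re (S (R (S z))) = (1 + k * Im c) * Re z + k * (1 + (1 + k * Im c)) * Im z"
        by (simp add: S_def R_def algebra_simps)
      also have "\<dots> = Re c * Re z - Im c * Im z"
        by (simp only: k1 kc)
      finally show "Re (S (R (S z))) = Re (c * z)" by simp
      have "Im (S (R (S z))) = (1 + k * Im c) * Im z + Im c * Re z"
        by (simp add: S_def R_def algebra_simps)
      then show "Im (S (R (S z))) = Im (c * z)" by (simp only: k1) simp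
    qed
    have [measurable]: "S \<in> borel_measurable borel" "R \<in> borel_measurable borel"
      by (simp_all add: S_def[abs_def] R_def[abs_def] Complex_eq)
    have "(\<integral>\<^sup>+ z. h (c * z) \<partial>lborel) = (\<integral>\<^sup>+ z. h (S (R (S z))) \<partial>lborel)" by (simp add: SRS)
    also have "\<dots> = (\<integral>\<^sup>+ z. h (S (R z)) \<partial>lborel)"
      using nn_integral_lborel_shear(1)[of "\<lambda>z. h (S (R z))" k] unfolding S_def[symmetric] by simp
    also have "\<dots> = (\<integral>\<^sup>+ z. h (S z) \<partial>lborel)"
      using nn_integral_lborel_shear(2)[of "\<lambda>z. h (S z)" "Im c"] by (simp add: R_def)
    also have "\<dots> = (\<integral>\<^sup>+ z. h z \<partial>lborel)"
      using nn_integral_lborel_shear(1)[of "\<lambda>z. h z" k] by (simp add: S_def)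
    finally show ?thesis .
  qed
  show ?thesis
  proof (cases "c = -1")
    case True
    have "\<i> \<noteq> -1" by (simp add: complex_eq_iff)
    then have "(\<integral>\<^sup>+ z. h (\<i> * (\<i> * z)) \<partial>lborel) = (\<integral>\<^sup>+ z. h z \<partial>lborel)"
      using *[of "\<lambda>z. h (\<i> * z)" \<i>] *[of h \<i>] by simp
    then show ?thesis using True by (simp add: mult.assoc[symmetric])
  qed (use * assms in auto)
qed

lemma space_disc_measure [simp]: "space disc_measure = ball 0 1"
  by (simp add: disc_measure_def space_scale_measure space_restrict_space)

lemma sets_disc_measure: "sets disc_measure = sets (restrict_space borel (ball 0 1))"
  by (simp add: disc_measure_def sets_restrict_space)

lemma measurable_disc_iff:
  "h \<in> borel_measurable disc_measure \<longleftrightarrow> (\<lambda>z. h z * indicator (ball 0 1) z :: ennreal) \<in> borel_measurable borel"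
  by (subst borel_measurable_restrict_space_iff_ennreal[symmetric])
     (auto simp: measurable_cong_sets[OF sets_disc_measure refl])

lemma nn_integral_disc:
  assumes "h \<in> borel_measurable disc_measure"
  shows "(\<integral>\<^sup>+ z. h z \<partial>disc_measure) = ennreal (1 / pi) * (\<integral>\<^sup>+ z. h z * indicator (ball 0 1) z \<partial>lborel)"
proof -
  have "h \<in> borel_measurable (restrict_space lborel (ball 0 1))"
    using assms by (simp add: disc_measure_def)
  then show ?thesis unfolding disc_measure_def
    by (simp add: nn_integral_scale_measure nn_integral_restrict_space)
qed

lemma continuous_imp_measurable_disc:
  fixes f :: "complex \<Rightarrow> 'a::topological_space"
  assumes "continuous_on (ball 0 1) f"
  shows "f \<in> borel_measurable disc_measure"
  using borel_measurable_continuous_on_restrict[OF assms]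
  by (simp add: measurable_cong_sets[OF sets_disc_measure refl])

lemma emeasure_disc:
  assumes "0 \<le> r" "r \<le> 1"
  shows "emeasure disc_measure (ball 0 r) = ennreal (r\<^sup>2)"
proof -
  have "emeasure disc_measure (ball 0 r) = ennreal (1 / pi) * emeasure lborel (ball (0::complex) r)"
    unfolding disc_measure_def using assms
    by (subst emeasure_scale_measure) (subst emeasure_restrict_space; auto)
  also have "emeasure lborel (ball (0::complex) r) = ennreal (pi * r\<^sup>2)"
    using emeasure_ball[of r "0::complex"] assms by (simp add: unit_ball_vol_2)
  finally show ?thesis by (simp add: ennreal_mult'[symmetric])
qed

lemma prob_space_disc: "prob_space disc_measure"
  by (rule prob_spaceI) (use emeasure_disc[of 1] in simp)

interpretation disc: prob_space disc_measure
  by (rule prob_space_disc)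

lemma nn_integral_disc_rotate:
  assumes "h \<in> borel_measurable disc_measure" "cmod c = 1"
  shows "(\<integral>\<^sup>+ z. h (c * z) \<partial>disc_measure) = (\<integral>\<^sup>+ z. h z \<partial>disc_measure)"
proof -
  have h: "(\<lambda>z. h z * indicator (ball 0 1) z) \<in> borel_measurable borel"
    using assms(1) by (simp add: measurable_disc_iff)
  have ind: "indicator (ball 0 1) (c * z) = (indicator (ball 0 1) z :: ennreal)" for z
    using assms(2) by (simp add: indicator_def norm_mult)
  have "(\<lambda>z. h (c * z) * indicator (ball 0 1) (c * z)) \<in> borel_measurable borel"
    by (rule measurable_compose[OF _ h]) simp
  then have "(\<lambda>z. h (c * z)) \<in> borel_measurable disc_measure"
    by (simp add: measurable_disc_iff ind)
  then have "(\<integral>\<^sup>+ z. h (c * z) \<partial>disc_measure)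
      = ennreal (1 / pi) * (\<integral>\<^sup>+ z. h (c * z) * indicator (ball 0 1) (c * z) \<partial>lborel)"
    unfolding ind by (rule nn_integral_disc)
  also have "\<dots> = (\<integral>\<^sup>+ z. h z \<partial>disc_measure)"
    unfolding nn_integral_lborel_rotate[OF h assms(2)] by (rule nn_integral_disc[OF assms(1), symmetric])
  finally show ?thesis .
qed

lemma mult_measurable_disc:
  "(\<lambda>p. fst p * snd p) \<in> circle_measure \<Otimes>\<^sub>M disc_measure \<rightarrow>\<^sub>M disc_measure"
proof -
  have c: "(\<lambda>x. x) \<in> borel_measurable circle_measure" and d: "(\<lambda>x. x) \<in> borel_measurable disc_measure"
    by (auto intro: continuous_imp_measurable_circle continuous_imp_measurable_disc)
  have "(\<lambda>p. fst p * snd p) \<in> borel_measurable (circle_measure \<Otimes>\<^sub>M disc_measure)"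
    using measurable_compose[OF measurable_fst c] measurable_compose[OF measurable_snd d]
    by (intro borel_measurable_times) auto
  then show ?thesis
    unfolding measurable_cong_sets[OF refl sets_disc_measure]
    by (intro measurable_restrict_space2) (auto simp: space_pair_measure norm_mult)
qed

text \<open>The measure on the disc is invariant under rotations, so every integral over the disc is an
  integral of means over circles.\<close>

lemma nn_integral_disc_circle_means:
  assumes "h \<in> borel_measurable disc_measure"
  shows "(\<integral>\<^sup>+ z. h z \<partial>disc_measure) = (\<integral>\<^sup>+ z. (\<integral>\<^sup>+ \<zeta>. h (\<zeta> * z) \<partial>circle_measure) \<partial>disc_measure)"
proof -
  interpret pair_sigma_finite circle_measure disc_measure
    by unfold_locales
  have "(\<lambda>p. h (fst p * snd p)) \<in> borel_measurable (circle_measure \<Otimes>\<^sub>M disc_measure)"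
    by (rule measurable_compose[OF mult_measurable_disc assms])
  then have meas: "(\<lambda>(\<zeta>, z). h (\<zeta> * z)) \<in> borel_measurable (circle_measure \<Otimes>\<^sub>M disc_measure)"
    by (simp add: case_prod_beta)
  have "(\<integral>\<^sup>+ z. h z \<partial>disc_measure) = (\<integral>\<^sup>+ \<zeta>. (\<integral>\<^sup>+ z. h z \<partial>disc_measure) \<partial>circle_measure)"
    using circle.emeasure_space_1 by simp
  also have "\<dots> = (\<integral>\<^sup>+ \<zeta>. (\<integral>\<^sup>+ z. h (\<zeta> * z) \<partial>disc_measure) \<partial>circle_measure)"
    by (rule nn_integral_cong) (simp add: nn_integral_disc_rotate[OF assms])
  also have "\<dots> = (\<integral>\<^sup>+ z. (\<integral>\<^sup>+ \<zeta>. h (\<zeta> * z) \<partial>circle_measure) \<partial>disc_measure)"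
    by (rule Fubini'[OF meas, symmetric])
  finally show ?thesis .
qed

text \<open>The squared modulus is uniformly distributed on the unit interval, because a disc of radius
  \<open>sqrt t\<close> has normalized area \<open>t\<close>.\<close>

lemma disc_moment:
  "(\<integral>\<^sup>+ z. ennreal (cmod z ^ (2 * n)) \<partial>disc_measure) = ennreal (1 / real (Suc n))"
proof -
  have m: "(\<lambda>z. (cmod z)\<^sup>2) \<in> borel_measurable disc_measure"
    by (intro continuous_imp_measurable_disc continuous_intros)
  have "distributed disc_measure lborel (\<lambda>z. (cmod z)\<^sup>2) (\<lambda>x. indicator {0..1} x / measure lborel {0..1::real})"
  proof (rule disc.uniform_distrI_borel_atLeastAtMost[OF m])
    fix t :: real assume t: "0 \<le> t" "t \<le> 1"
    have "emeasure disc_measure (ball 0 1 \<inter> cball 0 (sqrt t)) = ennreal (1 / pi) * emeasure lborel (ball 0 1 \<inter> cball (0::complex) (sqrt t))"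
      unfolding disc_measure_def 
      by (subst emeasure_scale_measure) (subst emeasure_restrict_space; auto)
    also have "emeasure lborel (ball 0 1 \<inter> cball (0::complex) (sqrt t)) = ennreal (pi * t)"
    proof (rule antisym)
      have "emeasure lborel (ball 0 1 \<inter> cball (0::complex) (sqrt t)) \<le> emeasure lborel (cball (0::complex) (sqrt t))"
        by (intro emeasure_mono) auto
      then show "emeasure lborel (ball 0 1 \<inter> cball (0::complex) (sqrt t)) \<le> ennreal (pi * t)"
        using emeasure_cball[of "sqrt t" "0::complex"] t by (simp add: unit_ball_vol_2)
      have "emeasure lborel (ball (0::complex) (sqrt t)) \<le> emeasure lborel (ball 0 1 \<inter> cball (0::complex) (sqrt t))"
        using subset_ball[of "sqrt t" 1 "0::complex"] t by (intro emeasure_mono) auto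
      then show "ennreal (pi * t) \<le> emeasure lborel (ball 0 1 \<inter> cball (0::complex) (sqrt t))"
        using emeasure_ball[of "sqrt t" "0::complex"] t by (simp add: unit_ball_vol_2)
    qed
    finally have em: "emeasure disc_measure (ball 0 1 \<inter> cball 0 (sqrt t)) = ennreal t"
      by (simp add: ennreal_mult'[symmetric])
    have eq: "{x \<in> space disc_measure. (cmod x)\<^sup>2 \<le> t} = ball 0 1 \<inter> cball 0 (sqrt t)"
    proof -
      have "(cmod x)\<^sup>2 \<le> t \<longleftrightarrow> cmod x \<le> sqrt t" for x
        using real_sqrt_le_iff[of "(cmod x)\<^sup>2" t] by simp
      then show ?thesis
        by (intro set_eqI) (simp only: mem_Collect_eq Int_iff mem_ball_0 mem_cball_0 space_disc_measure)
    qed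
    show "measure disc_measure {x \<in> space disc_measure. (cmod x)\<^sup>2 \<le> t} = (t - 0) / (1 - 0)"
      unfolding eq measure_def em using t by simp
  qed simp
  then have "(\<integral>\<^sup>+ z. ennreal (((cmod z)\<^sup>2) ^ n) \<partial>disc_measure)
      = (\<integral>\<^sup>+ x. indicator {0..1} x / measure lborel {0..1::real} * ennreal (x ^ n) \<partial>lborel)"
    by (intro distributed_nn_integral[symmetric]) auto
  also have "\<dots> = (\<integral>\<^sup>+ x. ennreal (x ^ n) * indicator {0..1} x \<partial>lborel)"
    by (intro nn_integral_cong) (auto simp: indicator_def)
  also have "\<dots> = ennreal (1 ^ Suc n / real (Suc n) - 0 ^ Suc n / real (Suc n))"
    by (rule nn_integral_FTC_Icc[where F="\<lambda>x. x ^ Suc n / real (Suc n)"])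
       (auto intro!: derivative_eq_intros simp del: power_Suc)
  finally show ?thesis by (simp add: power_mult)
qed

lemma affine_in_disc:
  assumes "0 < \<delta>" "cmod a + \<delta> \<le> 1" "z \<in> ball 0 1"
  shows "a + of_real \<delta> * z \<in> ball 0 1"
proof -
  have "cmod (a + of_real \<delta> * z) \<le> cmod a + \<delta> * cmod z"
    using norm_triangle_ineq[of a "of_real \<delta> * z"] assms(1) by (simp add: norm_mult)
  also have "\<dots> < cmod a + \<delta> * 1" using assms by (intro add_strict_left_mono mult_strict_left_mono) auto
  finally show ?thesis using assms(2) by simp
qed

lemma nn_integral_disc_affine:
  assumes h: "h \<in> borel_measurable disc_measure" and "0 < \<delta>" "cmod a + \<delta> \<le> 1"
  shows "(\<integral>\<^sup>+ z. h (a + of_real \<delta> * z) \<partial>disc_measure) \<le> ennreal (1 / \<delta>\<^sup>2) * (\<integral>\<^sup>+ z. h z \<partial>disc_measure)"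
proof -
  note in_ball = affine_in_disc[OF assms(2,3)]
  define H where "H = (\<lambda>z. h z * indicator (ball 0 1) z)"
  have H[measurable]: "H \<in> borel_measurable borel"
    using h by (simp add: measurable_disc_iff H_def)
  have Haff: "(\<lambda>z. H (a + of_real \<delta> * z)) \<in> borel_measurable borel" by simp
  have "(\<lambda>z. h (a + of_real \<delta> * z)) \<in> borel_measurable disc_measure"
  proof -
    have "(\<lambda>z. H (a + of_real \<delta> * z) * indicator (ball 0 1) z) \<in> borel_measurable borel"
      using Haff by (intro borel_measurable_times_ennreal borel_measurable_indicator) auto
    also have "(\<lambda>z. H (a + of_real \<delta> * z) * indicator (ball 0 1) z)
        = (\<lambda>z. h (a + of_real \<delta> * z) * indicator (ball 0 1) z)"
      using in_ball by (auto simp: H_def indicator_def fun_eq_iff)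
    finally show ?thesis by (simp add: measurable_disc_iff)
  qed
  then have "(\<integral>\<^sup>+ z. h (a + of_real \<delta> * z) \<partial>disc_measure)
      = ennreal (1 / pi) * (\<integral>\<^sup>+ z. h (a + of_real \<delta> * z) * indicator (ball 0 1) z \<partial>lborel)"
    by (rule nn_integral_disc)
  also have "\<dots> \<le> ennreal (1 / pi) * (\<integral>\<^sup>+ z. H (a + of_real \<delta> * z) \<partial>lborel)"
    using in_ball by (intro mult_left_mono nn_integral_mono) (auto simp: H_def indicator_def)
  also have "(\<integral>\<^sup>+ z. H (a + of_real \<delta> * z) \<partial>lborel) = ennreal (1 / \<delta>\<^sup>2) * (\<integral>\<^sup>+ z. H z \<partial>lborel)"
  proof -
    have "(\<integral>\<^sup>+ z. H z \<partial>lborel) = (\<integral>\<^sup>+ z. H z \<partial>density (distr lborel borel (\<lambda>x. a + \<delta> *\<^sub>R x)) (\<lambda>_. \<bar>\<delta>\<bar> ^ DIM(complex)))"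
      using assms(2) by (subst lborel_affine[of \<delta> a]) auto
    also have "\<dots> = ennreal (\<delta>\<^sup>2) * (\<integral>\<^sup>+ z. H (a + of_real \<delta> * z) \<partial>lborel)"
      using assms(2) by (simp add: nn_integral_density nn_integral_distr nn_integral_cmult scaleR_conv_of_real)
    finally have "ennreal (1 / \<delta>\<^sup>2) * (\<integral>\<^sup>+ z. H z \<partial>lborel)
        = ennreal (1 / \<delta>\<^sup>2) * (ennreal (\<delta>\<^sup>2) * (\<integral>\<^sup>+ z. H (a + of_real \<delta> * z) \<partial>lborel))" by simp
    also have "\<dots> = ennreal (1 / \<delta>\<^sup>2 * \<delta>\<^sup>2) * (\<integral>\<^sup>+ z. H (a + of_real \<delta> * z) \<partial>lborel)"
      by (subst ennreal_mult') (auto simp: mult.assoc)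
    finally show ?thesis using assms(2) by simp
  qed
  also have "ennreal (1 / pi) * (ennreal (1 / \<delta>\<^sup>2) * (\<integral>\<^sup>+ z. H z \<partial>lborel))
      = ennreal (1 / \<delta>\<^sup>2) * (\<integral>\<^sup>+ z. h z \<partial>disc_measure)"
    by (simp add: nn_integral_disc[OF h] H_def mult.left_commute)
  finally show ?thesis .
qed

section \<open>Parseval's identity and Carleman's inequality\<close>

definition power_series_on :: "real \<Rightarrow> (nat \<Rightarrow> complex) \<Rightarrow> (complex \<Rightarrow> complex) \<Rightarrow> bool"
  where "power_series_on R a f \<longleftrightarrow> (\<forall>w\<in>ball 0 R. (\<lambda>n. a n * w ^ n) sums f w)"

lemma holomorphic_imp_power_series_on:
  assumes "f holomorphic_on ball 0 R"
  obtains a where "power_series_on R a f"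
proof -
  have "power_series_on R (\<lambda>n. (deriv ^^ n) f 0 / fact n) f"
    unfolding power_series_on_def using holomorphic_power_series[OF assms] by simp
  then show thesis by (rule that)
qed

lemma power_series_on_imp_holomorphic:
  "power_series_on R a f \<Longrightarrow> f holomorphic_on ball 0 R"
  unfolding power_series_on_def by (rule power_series_holomorphic[of 0 R a]) simp

lemma power_series_on_summable_norm:
  assumes "power_series_on R a f" "cmod z < R"
  shows "summable (\<lambda>n. cmod (a n) * cmod z ^ n)"
proof -
  obtain \<rho> where \<rho>: "cmod z < \<rho>" "\<rho> < R" using dense[OF assms(2)] by blast
  then have "\<rho> \<ge> 0" using norm_ge_zero[of z] by linarith
  then have "summable (\<lambda>n. a n * of_real \<rho> ^ n)"
    using assms(1) \<rho> unfolding power_series_on_def by (auto intro: sums_summable)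
  from powser_insidea[OF this, of z] show ?thesis
    using \<rho> \<open>\<rho> \<ge> 0\<close> by (simp add: norm_mult norm_power)
qed

lemma power_series_on_mult:
  assumes a: "power_series_on R a f" and b: "power_series_on R b g"
  shows "power_series_on R (\<lambda>n. \<Sum>i\<le>n. a i * b (n - i)) (\<lambda>z. f z * g z)"
  unfolding power_series_on_def
proof
  fix w assume w: "w \<in> ball (0::complex) R"
  then have "(\<lambda>n. a n * w ^ n) sums f w" "(\<lambda>n. b n * w ^ n) sums g w"
    using a b by (auto simp: power_series_on_def)
  then have fg: "f w = (\<Sum>n. a n * w ^ n)" "g w = (\<Sum>n. b n * w ^ n)" by (auto simp: sums_iff)
  have "(\<lambda>k. \<Sum>i\<le>k. (a i * w ^ i) * (b (k - i) * w ^ (k - i))) sums (f w * g w)"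
    unfolding fg using w power_series_on_summable_norm[OF a, of w] power_series_on_summable_norm[OF b, of w]
    by (intro Cauchy_product_sums) (auto simp: norm_mult norm_power)
  also have "(\<lambda>k. \<Sum>i\<le>k. (a i * w ^ i) * (b (k - i) * w ^ (k - i)))
      = (\<lambda>n. (\<Sum>i\<le>n. a i * b (n - i)) * w ^ n)"
  proof
    fix k
    have "(a i * w ^ i) * (b (k - i) * w ^ (k - i)) = a i * b (k - i) * w ^ k" if "i \<le> k" for i
    proof -
      have "w ^ k = w ^ i * w ^ (k - i)" using that by (simp add: power_add[symmetric])
      then show ?thesis by simp
    qed
    then show "(\<Sum>i\<le>k. (a i * w ^ i) * (b (k - i) * w ^ (k - i))) = (\<Sum>i\<le>k. a i * b (k - i)) * w ^ k"
      unfolding sum_distrib_right by (intro sum.cong) auto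
  qed
  finally show "(\<lambda>n. (\<Sum>i\<le>n. a i * b (n - i)) * w ^ n) sums (f w * g w)" .
qed

lemma Parseval_polynomial:
  "(\<integral>\<zeta>. (cmod (\<Sum>i<N. c i * \<zeta> ^ i))\<^sup>2 \<partial>circle_measure) = (\<Sum>i<N. (cmod (c i))\<^sup>2)"
proof -
  have [simp]: "integrable circle_measure (\<lambda>\<zeta>. c i * cnj (c j) * (\<zeta> ^ i * cnj (\<zeta> ^ j)))" for i j
    by (intro integral_circle(1) continuous_intros)
  have "complex_of_real (\<integral>\<zeta>. (cmod (\<Sum>i<N. c i * \<zeta> ^ i))\<^sup>2 \<partial>circle_measure)
      = (\<integral>\<zeta>. complex_of_real ((cmod (\<Sum>i<N. c i * \<zeta> ^ i))\<^sup>2) \<partial>circle_measure)"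
    by (simp only: integral_complex_of_real)
  also have "\<dots> = (\<integral>\<zeta>. (\<Sum>i<N. \<Sum>j<N. c i * cnj (c j) * (\<zeta> ^ i * cnj (\<zeta> ^ j))) \<partial>circle_measure)"
    by (intro Bochner_Integration.integral_cong refl)
       (simp only: complex_norm_square cnj_sum sum_product complex_cnj_mult mult_ac)
  also have "\<dots> = (\<Sum>i<N. \<Sum>j<N. c i * cnj (c j) * (if i = j then 1 else 0))"
    by (simp add: Bochner_Integration.integral_sum circle_orthogonal del: complex_cnj_power)
  also have "\<dots> = (\<Sum>i<N. c i * cnj (c i))"
    by (intro sum.cong refl) (simp add: if_distrib[of "\<lambda>x. _ * x"] sum.delta cong: if_cong)
  also have "\<dots> = complex_of_real (\<Sum>i<N. (cmod (c i))\<^sup>2)"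
    by (simp add: complex_norm_square del: of_real_power)
  finally show ?thesis using of_real_eq_iff by blast
qed

lemma Parseval:
  assumes a: "power_series_on R a f" and z: "cmod z < R"
  shows "(\<lambda>n. (cmod (a n))\<^sup>2 * cmod z ^ (2 * n)) sums (\<integral>\<zeta>. (cmod (f (\<zeta> * z)))\<^sup>2 \<partial>circle_measure)"
proof -
  define M where "M = (\<Sum>n. cmod (a n) * cmod z ^ n)"
  define S where "S N \<zeta> = (\<Sum>i<N. a i * z ^ i * \<zeta> ^ i)" for N \<zeta>
  have sum: "summable (\<lambda>n. cmod (a n) * cmod z ^ n)"
    by (rule power_series_on_summable_norm[OF a z])
  have lim: "(\<lambda>N. S N \<zeta>) \<longlonglongrightarrow> f (\<zeta> * z)" if "\<zeta> \<in> sphere 0 1" for \<zeta>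
  proof -
    have "\<zeta> * z \<in> ball 0 R" using that z by (simp add: norm_mult)
    then have "(\<lambda>n. a n * (\<zeta> * z) ^ n) sums f (\<zeta> * z)"
      using a by (simp add: power_series_on_def)
    then show ?thesis by (simp add: sums_def S_def power_mult_distrib mult_ac)
  qed
  have bound: "cmod (S N \<zeta>) \<le> M" if "\<zeta> \<in> sphere 0 1" for N \<zeta>
  proof -
    have "cmod (S N \<zeta>) \<le> (\<Sum>i<N. cmod (a i) * cmod z ^ i)"
      unfolding S_def using that by (intro sum_norm_le) (simp add: norm_mult norm_power)
    also have "\<dots> \<le> M" unfolding M_def by (intro sum_le_suminf sum) auto
    finally show ?thesis .
  qed
  have "(\<lambda>N. \<integral>\<zeta>. (cmod (S N \<zeta>))\<^sup>2 \<partial>circle_measure) \<longlonglongrightarrow> (\<integral>\<zeta>. (cmod (f (\<zeta> * z)))\<^sup>2 \<partial>circle_measure)"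
  proof (rule integral_dominated_convergence[where w="\<lambda>_. M\<^sup>2"])
    show "AE \<zeta> in circle_measure. (\<lambda>N. (cmod (S N \<zeta>))\<^sup>2) \<longlonglongrightarrow> (cmod (f (\<zeta> * z)))\<^sup>2"
      by (intro AE_I2 tendsto_intros lim) simp
    show "AE \<zeta> in circle_measure. norm ((cmod (S N \<zeta>))\<^sup>2) \<le> M\<^sup>2" for N
      using bound by (intro AE_I2) (simp add: power_mono)
    show "(\<lambda>\<zeta>. (cmod (S N \<zeta>))\<^sup>2) \<in> borel_measurable circle_measure" for N
      unfolding S_def by (intro continuous_imp_measurable_circle continuous_intros)
    have "continuous_on (ball 0 R) f"
      using power_series_on_imp_holomorphic[OF a] by (rule holomorphic_on_imp_continuous_on)
    then have "continuous_on (sphere 0 1) (\<lambda>\<zeta>. f (\<zeta> * z))"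
      by (rule continuous_on_compose2) (use z in \<open>auto intro!: continuous_intros simp: norm_mult\<close>)
    then show "(\<lambda>\<zeta>. (cmod (f (\<zeta> * z)))\<^sup>2) \<in> borel_measurable circle_measure"
      by (intro continuous_imp_measurable_circle continuous_intros)
  qed auto
  moreover have "(\<integral>\<zeta>. (cmod (S N \<zeta>))\<^sup>2 \<partial>circle_measure) = (\<Sum>i<N. (cmod (a i))\<^sup>2 * cmod z ^ (2 * i))" for N
    using Parseval_polynomial[where N=N and c="\<lambda>i. a i * z ^ i"]
    by (simp add: S_def norm_mult norm_power power_mult_distrib power_mult[symmetric] mult.commute)
  ultimately show ?thesis by (simp add: sums_def)
qed

text \<open>The coefficients of the square are Cauchy products, and the weight \<open>1 / (n + 1)\<close> that the area
  measure puts on the \<open>n\<close>-th of them cancels the loss in the Cauchy-Schwarz inequality for its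
  \<open>n + 1\<close> summands.\<close>

lemma Carleman_inequality:
  assumes "g holomorphic_on ball 0 R" "1 < R"
  shows "(\<integral>\<^sup>+ z. ennreal (cmod (g z) ^ 4) \<partial>disc_measure)
    \<le> ennreal ((\<integral>\<zeta>. (cmod (g \<zeta>))\<^sup>2 \<partial>circle_measure)\<^sup>2)"
proof -
  obtain a where a: "power_series_on R a g"
    using holomorphic_imp_power_series_on[OF assms(1)] .
  define b where "b n = (\<Sum>i\<le>n. a i * a (n - i))" for n
  define I where "I = (\<integral>\<zeta>. (cmod (g \<zeta>))\<^sup>2 \<partial>circle_measure)"
  have b: "power_series_on R b (\<lambda>z. g z * g z)"
    using power_series_on_mult[OF a a] by (simp add: b_def[abs_def])
  have hol: "(\<lambda>z. g z * g z) holomorphic_on ball 0 R" by (intro holomorphic_intros assms)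
  then have cont: "continuous_on (ball 0 R) (\<lambda>z. g z * g z)" by (rule holomorphic_on_imp_continuous_on)
  have I: "(\<lambda>n. (cmod (a n))\<^sup>2) sums I"
    using Parseval[OF a, of 1] assms(2) by (simp add: I_def)
  have bsq: "(cmod (b n))\<^sup>2 / real (Suc n) \<le> (\<Sum>i\<le>n. (cmod (a i))\<^sup>2 * (cmod (a (n - i)))\<^sup>2)" for n
  proof -
    have "cmod (b n) \<le> (\<Sum>i\<le>n. cmod (a i) * cmod (a (n - i)))"
      unfolding b_def by (intro sum_norm_le) (simp add: norm_mult)
    then have "(cmod (b n))\<^sup>2 \<le> (\<Sum>i\<le>n. cmod (a i) * cmod (a (n - i)))\<^sup>2" by (intro power_mono) auto
    also have "\<dots> \<le> (\<Sum>i\<le>n. (cmod (a i) * cmod (a (n - i)))\<^sup>2) * real (Suc n)"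
      using sum_squared_le_sum_of_squares[of "\<lambda>i. cmod (a i) * cmod (a (n - i))" "{..n}"] by simp
    finally show ?thesis by (simp add: power_mult_distrib divide_le_eq)
  qed
  have prod: "(\<lambda>n. \<Sum>i\<le>n. (cmod (a i))\<^sup>2 * (cmod (a (n - i)))\<^sup>2) sums (I * I)"
    using Cauchy_product_sums[of "\<lambda>n. (cmod (a n))\<^sup>2" "\<lambda>n. (cmod (a n))\<^sup>2"] I by (simp add: sums_iff)
  have meas: "(\<lambda>z. ennreal (cmod (g z) ^ 4)) \<in> borel_measurable disc_measure"
    using holomorphic_on_imp_continuous_on[OF assms(1)] assms(2)
    by (intro measurable_compose[OF _ measurable_ennreal] continuous_imp_measurable_disc continuous_intros)
       (auto elim: continuous_on_subset)
  have "(\<integral>\<^sup>+ z. ennreal (cmod (g z) ^ 4) \<partial>disc_measure)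
      = (\<integral>\<^sup>+ z. (\<integral>\<^sup>+ \<zeta>. ennreal (cmod (g (\<zeta> * z)) ^ 4) \<partial>circle_measure) \<partial>disc_measure)"
    by (rule nn_integral_disc_circle_means[OF meas])
  also have "\<dots> = (\<integral>\<^sup>+ z. (\<Sum>n. ennreal ((cmod (b n))\<^sup>2) * ennreal (cmod z ^ (2 * n))) \<partial>disc_measure)"
  proof (rule nn_integral_cong)
    fix z assume "z \<in> space disc_measure"
    then have z: "cmod z < 1" by simp
    have "continuous_on (sphere 0 1) (\<lambda>\<zeta>. g (\<zeta> * z) * g (\<zeta> * z))"
      by (rule continuous_on_compose2[OF cont]) (use z assms(2) in \<open>auto intro!: continuous_intros simp: norm_mult\<close>)
    then have "(\<integral>\<^sup>+ \<zeta>. ennreal ((cmod (g (\<zeta> * z) * g (\<zeta> * z)))\<^sup>2) \<partial>circle_measure)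
        = ennreal (\<integral>\<zeta>. (cmod (g (\<zeta> * z) * g (\<zeta> * z)))\<^sup>2 \<partial>circle_measure)"
      by (intro nn_integral_circle_continuous continuous_on_power continuous_on_norm) auto
    also have "\<dots> = (\<Sum>n. ennreal ((cmod (b n))\<^sup>2 * cmod z ^ (2 * n)))"
      using Parseval[OF b, of z] z assms(2) by (intro suminf_ennreal_eq[symmetric]) auto
    finally show "(\<integral>\<^sup>+ \<zeta>. ennreal (cmod (g (\<zeta> * z)) ^ 4) \<partial>circle_measure)
        = (\<Sum>n. ennreal ((cmod (b n))\<^sup>2) * ennreal (cmod z ^ (2 * n)))"
      by (simp add: norm_mult ennreal_mult power2_eq_square power4_eq_xxxx mult.assoc)
  qed
  also have "\<dots> = (\<Sum>n. ennreal ((cmod (b n))\<^sup>2) * ennreal (1 / real (Suc n)))"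
  proof -
    have m: "(\<lambda>z. ennreal (cmod z ^ n)) \<in> borel_measurable disc_measure" for n
      by (intro measurable_compose[OF _ measurable_ennreal] continuous_imp_measurable_disc continuous_intros)
    show ?thesis
      by (subst nn_integral_suminf)
         (simp_all only: nn_integral_cmult[OF m] disc_moment borel_measurable_times_ennreal m borel_measurable_const)
  qed
  also have "\<dots> = (\<Sum>n. ennreal ((cmod (b n))\<^sup>2 / real (Suc n)))"
    by (simp add: ennreal_mult'[symmetric])
  also have "\<dots> \<le> (\<Sum>n. ennreal (\<Sum>i\<le>n. (cmod (a i))\<^sup>2 * (cmod (a (n - i)))\<^sup>2))"
    by (intro suminf_le ennreal_leI bsq) auto
  also have "\<dots> = ennreal (I * I)"
    using prod by (intro suminf_ennreal_eq) (auto intro: sum_nonneg)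
  finally show ?thesis by (simp add: I_def power2_eq_square)
qed

section \<open>Outer functions and the factorization of the Hardy space\<close>

text \<open>On the circle a real polynomial in the coordinates is a trigonometric polynomial, that is
  \<open>\<zeta> \<mapsto> P \<zeta> / \<zeta>^N\<close> for a complex polynomial \<open>P\<close>.\<close>

lemma real_polynomial_on_circle:
  assumes "real_polynomial_function (g :: complex \<Rightarrow> real)"
  shows "\<exists>N P. \<forall>\<zeta>\<in>sphere 0 1. of_real (g \<zeta>) * \<zeta> ^ N = poly P \<zeta>"
  using assms
proof induction
  case (linear f)
  interpret bounded_linear f by (rule linear)
  define c where "c = Complex (f 1) (f \<i>)"
  have "of_real (f \<zeta>) * \<zeta> ^ 1 = poly [:c / 2, 0, cnj c / 2:] \<zeta>" if "\<zeta> \<in> sphere 0 1" for \<zeta>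
  proof -
    have "f \<zeta> = f (Re \<zeta> *\<^sub>R 1 + Im \<zeta> *\<^sub>R \<i>)"
      by (rule arg_cong[of _ _ f]) (simp add: complex_eq_iff)
    also have "\<dots> = Re c * Re \<zeta> + Im c * Im \<zeta>" by (simp add: add scaleR c_def)
    finally have "of_real (f \<zeta>) = (c * cnj \<zeta> + cnj c * \<zeta>) / 2"
      by (simp add: complex_eq_iff)
    moreover have "\<zeta> * cnj \<zeta> = 1" using that by (simp add: complex_norm_square[symmetric])
    ultimately have "of_real (f \<zeta>) * \<zeta> = (c * (\<zeta> * cnj \<zeta>) + cnj c * \<zeta> * \<zeta>) / 2"
      by (simp add: algebra_simps)
    then show ?thesis using \<open>\<zeta> * cnj \<zeta> = 1\<close> by (simp add: algebra_simps add_divide_distrib)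
  qed
  then show ?case by blast
next
  case (const c)
  have "of_real c * \<zeta> ^ 0 = poly [:of_real c:] \<zeta>" for \<zeta> :: complex by simp
  then show ?case by blast
next
  case (add f g)
  then obtain N P M Q where "\<forall>\<zeta>\<in>sphere 0 1. of_real (f \<zeta>) * \<zeta> ^ N = poly P \<zeta>"
    "\<forall>\<zeta>\<in>sphere 0 1. of_real (g \<zeta>) * \<zeta> ^ M = poly Q \<zeta>" by blast
  then have "\<forall>\<zeta>\<in>sphere 0 1. of_real (f \<zeta> + g \<zeta>) * \<zeta> ^ (N + M) = poly (P * monom 1 M + Q * monom 1 N) \<zeta>"
    by (auto simp: poly_monom power_add algebra_simps)
  then show ?case by blast
next
  case (mult f g)
  then obtain N P M Q where "\<forall>\<zeta>\<in>sphere 0 1. of_real (f \<zeta>) * \<zeta> ^ N = poly P \<zeta>"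
    "\<forall>\<zeta>\<in>sphere 0 1. of_real (g \<zeta>) * \<zeta> ^ M = poly Q \<zeta>" by blast
  moreover have "of_real (f \<zeta> * g \<zeta>) * \<zeta> ^ (N + M) = (of_real (f \<zeta>) * \<zeta> ^ N) * (of_real (g \<zeta>) * \<zeta> ^ M)" for \<zeta>
    by (simp add: power_add)
  ultimately have "\<forall>\<zeta>\<in>sphere 0 1. of_real (f \<zeta> * g \<zeta>) * \<zeta> ^ (N + M) = poly (P * Q) \<zeta>"
    by (metis poly_mult)
  then show ?case by blast
qed

text \<open>Conjugating its terms of negative degree turns a trigonometric polynomial into a polynomial
  with the same real part on the circle.\<close>

lemma Re_holomorphic_approximation:
  assumes "continuous_on (sphere 0 1) v" "0 < e"
  obtains p where "p holomorphic_on UNIV" "\<And>\<zeta>. \<zeta> \<in> sphere 0 1 \<Longrightarrow> \<bar>Re (p \<zeta>) - v \<zeta>\<bar> < e"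
proof -
  obtain g where g: "real_polynomial_function g" "\<And>\<zeta>. \<zeta> \<in> sphere 0 1 \<Longrightarrow> \<bar>v \<zeta> - g \<zeta>\<bar> < e"
    using Stone_Weierstrass_real_polynomial_function[OF _ assms] compact_sphere by blast
  obtain N P where P: "\<And>\<zeta>. \<zeta> \<in> sphere 0 1 \<Longrightarrow> of_real (g \<zeta>) * \<zeta> ^ N = poly P \<zeta>"
    using real_polynomial_on_circle[OF g(1)] by blast
  define p where "p z = (\<Sum>k\<le>degree P. if N \<le> k then coeff P k * z ^ (k - N) else cnj (coeff P k) * z ^ (N - k))" for z
  show thesis
  proof
    have "(\<lambda>z. if N \<le> k then coeff P k * z ^ (k - N) else cnj (coeff P k) * z ^ (N - k)) holomorphic_on UNIV" for k
      by (cases "N \<le> k") (auto intro!: holomorphic_intros)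
    then show "p holomorphic_on UNIV" unfolding p_def by (intro holomorphic_intros)
    fix \<zeta> :: complex assume \<zeta>: "\<zeta> \<in> sphere 0 1"
    then have one: "\<zeta> * cnj \<zeta> = 1" by (simp add: complex_norm_square[symmetric])
    then have pow: "\<zeta> ^ n * cnj \<zeta> ^ n = 1" for n by (metis power_mult_distrib power_one)
    have "of_real (g \<zeta>) = of_real (g \<zeta>) * \<zeta> ^ N * cnj \<zeta> ^ N" using pow[of N] by (simp add: mult.assoc)
    also have "\<dots> = (\<Sum>k\<le>degree P. coeff P k * (\<zeta> ^ k * cnj \<zeta> ^ N))"
      by (simp add: P[OF \<zeta>] poly_altdef sum_distrib_right mult.assoc)
    finally have "g \<zeta> = Re (\<Sum>k\<le>degree P. coeff P k * (\<zeta> ^ k * cnj \<zeta> ^ N))" by (metis Re_complex_of_real)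
    also have "\<dots> = Re (p \<zeta>)"
      unfolding p_def Re_sum
    proof (intro sum.cong refl)
      fix k
      show "Re (coeff P k * (\<zeta> ^ k * cnj \<zeta> ^ N))
        = Re (if N \<le> k then coeff P k * \<zeta> ^ (k - N) else cnj (coeff P k) * \<zeta> ^ (N - k))"
      proof (cases "N \<le> k")
        case True
        have "\<zeta> ^ k * cnj \<zeta> ^ N = \<zeta> ^ (k - N) * (\<zeta> ^ N * cnj \<zeta> ^ N)"
          using True by (simp add: mult.assoc[symmetric] power_add[symmetric])
        then show ?thesis using pow[of N] True by simp
      next
        case False
        have "\<zeta> ^ k * cnj \<zeta> ^ N = cnj \<zeta> ^ (N - k) * (\<zeta> ^ k * cnj \<zeta> ^ k)"
          using False power_add[of "cnj \<zeta>" "N - k" k] by (simp add: mult_ac)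
        then have "coeff P k * (\<zeta> ^ k * cnj \<zeta> ^ N) = cnj (cnj (coeff P k) * \<zeta> ^ (N - k))"
          using pow[of k] by simp
        then have "Re (coeff P k * (\<zeta> ^ k * cnj \<zeta> ^ N)) = Re (cnj (coeff P k) * \<zeta> ^ (N - k))"
          by (simp only: cnj.simps)
        then show ?thesis by (simp only: False if_False)
      qed
    qed
    finally show "\<bar>Re (p \<zeta>) - v \<zeta>\<bar> < e" using g(2)[OF \<zeta>] by linarith
  qed
qed

lemma square_mean_mono:
  assumes "f holomorphic_on ball 0 R" "1 < R" "cmod z \<le> 1"
  shows "(\<integral>\<zeta>. (cmod (f (\<zeta> * z)))\<^sup>2 \<partial>circle_measure) \<le> (\<integral>\<zeta>. (cmod (f \<zeta>))\<^sup>2 \<partial>circle_measure)"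
proof -
  obtain a where a: "power_series_on R a f" using holomorphic_imp_power_series_on[OF assms(1)] .
  have z: "(\<lambda>n. (cmod (a n))\<^sup>2 * cmod z ^ (2 * n)) sums (\<integral>\<zeta>. (cmod (f (\<zeta> * z)))\<^sup>2 \<partial>circle_measure)"
    using assms by (intro Parseval[OF a]) linarith
  have one: "(\<lambda>n. (cmod (a n))\<^sup>2) sums (\<integral>\<zeta>. (cmod (f \<zeta>))\<^sup>2 \<partial>circle_measure)"
    using Parseval[OF a, of 1] assms(2) by simp
  show ?thesis
    by (rule sums_le[OF _ z one]) (simp add: mult_left_le power_le_one assms(3))
qed

definition bounded_square_means :: "real \<Rightarrow> (complex \<Rightarrow> complex) \<Rightarrow> bool"
  where "bounded_square_means C g \<longleftrightarrow> g holomorphic_on ball 0 1 \<and>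
    (\<forall>r\<in>{0..<1}. (\<integral>\<zeta>. (cmod (g (of_real r * \<zeta>)))\<^sup>2 \<partial>circle_measure) \<le> C)"

lemma continuous_on_dilate:
  assumes "f holomorphic_on ball 0 1" "0 \<le> r" "r < 1"
  shows "continuous_on (sphere 0 1) (\<lambda>\<zeta>. f (of_real r * \<zeta>))"
proof (rule continuous_on_compose2[OF holomorphic_on_imp_continuous_on[OF assms(1)]])
  show "(\<lambda>\<zeta>::complex. of_real r * \<zeta>) ` sphere 0 1 \<subseteq> ball 0 1"
    using assms(2,3) by (auto simp: norm_mult)
qed (intro continuous_intros)

lemma holomorphic_on_dilate:
  assumes "f holomorphic_on ball 0 1" "0 < r"
  shows "(\<lambda>z. f (of_real r * z)) holomorphic_on ball 0 (1 / r)"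
proof (rule holomorphic_on_compose_gen[of "\<lambda>z. of_real r * z" _ f "ball 0 1", unfolded o_def])
  show "(\<lambda>z::complex. of_real r * z) ` ball 0 (1 / r) \<subseteq> ball 0 1"
    using assms(2) by (auto simp: norm_mult field_simps)
qed (intro holomorphic_intros assms)+

lemma dilates_tendsto:
  assumes "f holomorphic_on ball 0 1" "z \<in> ball 0 1" "(\<lambda>i. r i) \<longlonglongrightarrow> 1"
  shows "(\<lambda>i. f (of_real (r i) * z)) \<longlonglongrightarrow> f z"
proof -
  have "isCont f z"
    using holomorphic_on_imp_continuous_on[OF assms(1)] assms(2) by (simp add: continuous_on_eq_continuous_at)
  moreover have "(\<lambda>i. of_real (r i) * z) \<longlonglongrightarrow> of_real 1 * z" by (intro tendsto_intros assms(3))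
  ultimately show ?thesis by (intro isCont_tendsto_compose[of _ f]) auto
qed

lemma compact_subset_disc:
  assumes "compact K" "K \<subseteq> ball (0 :: complex) 1"
  obtains \<rho> where "0 \<le> \<rho>" "\<rho> < 1" "\<And>z. z \<in> K \<Longrightarrow> cmod z \<le> \<rho>"
proof (cases "K = {}")
  case False
  obtain w where w: "w \<in> K" "\<And>z. z \<in> K \<Longrightarrow> cmod z \<le> cmod w"
    using continuous_attains_sup[OF assms(1) False, of cmod] by (auto intro: continuous_intros)
  have "cmod w < 1" using w(1) assms(2) by auto
  then show thesis by (intro that[of "cmod w"] w(2)) auto
qed (auto intro: that[of 0])

text \<open>Bounded means over the circle give bounds on compact subsets of the disc, by the Poisson formula
  for \<open>g\<^sup>2\<close>. This is the input of Montel's theorem below.\<close>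

lemma square_le_Poisson:
  assumes "g holomorphic_on ball 0 R" "1 < R" "z \<in> ball 0 1"
  shows "(cmod (g z))\<^sup>2 \<le> 2 / (1 - cmod z) * (\<integral>\<zeta>. (cmod (g \<zeta>))\<^sup>2 \<partial>circle_measure)"
proof -
  have cont: "continuous_on (cball 0 1) g"
    using holomorphic_on_imp_continuous_on[OF assms(1)] by (rule continuous_on_subset) (use assms in auto)
  have cont': "continuous_on (sphere 0 1) g" using cont by (rule continuous_on_subset) auto
  have "g holomorphic_on ball 0 1" using assms by (auto elim: holomorphic_on_subset)
  then have "(\<integral>\<zeta>. of_real (Poisson_kernel z \<zeta>) * (g \<zeta> * g \<zeta>) \<partial>circle_measure) = g z * g z"
    using cont assms by (intro Poisson_formula continuous_intros holomorphic_intros)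
  then have "(cmod (g z))\<^sup>2 = cmod (\<integral>\<zeta>. of_real (Poisson_kernel z \<zeta>) * (g \<zeta> * g \<zeta>) \<partial>circle_measure)"
    by (simp add: norm_mult power2_eq_square)
  also have "\<dots> \<le> (\<integral>\<zeta>. Poisson_kernel z \<zeta> * (cmod (g \<zeta>))\<^sup>2 \<partial>circle_measure)"
    using assms Poisson_kernel_nonneg[of z]
    by (intro order_trans[OF integral_norm_bound] eq_refl Bochner_Integration.integral_cong)
       (auto simp: norm_mult power2_eq_square)
  also have "\<dots> \<le> (\<integral>\<zeta>. 2 / (1 - cmod z) * (cmod (g \<zeta>))\<^sup>2 \<partial>circle_measure)"
    using Poisson_kernel_le[OF assms(3)]
    by (intro integral_mono integral_circle(1) continuous_intros cont' continuous_Poisson_kernel assms mult_right_mono) auto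
  also have "\<dots> = 2 / (1 - cmod z) * (\<integral>\<zeta>. (cmod (g \<zeta>))\<^sup>2 \<partial>circle_measure)" by simp
  finally show ?thesis .
qed

text \<open>Normal families, with Fatou's lemma to pass the bound on the means to the limit.\<close>

lemma square_means_subsequence:
  assumes hol: "\<And>j. G j holomorphic_on ball 0 (1 / r j)" and r: "\<And>j. 0 < r j" "\<And>j. r j < 1"
    and C: "\<And>j. (\<integral>\<zeta>. (cmod (G j \<zeta>))\<^sup>2 \<partial>circle_measure) \<le> C"
  obtains g s where "bounded_square_means C g" "strict_mono (s :: nat \<Rightarrow> nat)"
    "\<And>z. z \<in> ball 0 1 \<Longrightarrow> (\<lambda>j. G (s j) z) \<longlonglongrightarrow> g z"
proof -
  have R: "1 < 1 / r j" for j using r[of j] by simp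
  have hol1: "G j holomorphic_on ball 0 1" for j
    using hol[of j] R[of j] by (auto elim: holomorphic_on_subset)
  have C0: "0 \<le> C" using C[of 0] by (rule order_trans[rotated]) simp
  have bd: "\<exists>B. \<forall>h\<in>range G. \<forall>z\<in>K. cmod (h z) \<le> B" if K: "compact K" "K \<subseteq> ball 0 1" for K
  proof -
    obtain \<rho> where \<rho>: "\<rho> < 1" "\<And>z. z \<in> K \<Longrightarrow> cmod z \<le> \<rho>" using compact_subset_disc[OF K] by blast
    have "cmod (G j z) \<le> sqrt (2 / (1 - \<rho>) * C)" if "z \<in> K" for j z
    proof -
      have zr: "cmod z \<le> \<rho>" "cmod z < 1" using \<rho> that by (auto intro: le_less_trans)
      have "(cmod (G j z))\<^sup>2 \<le> 2 / (1 - cmod z) * (\<integral>\<zeta>. (cmod (G j \<zeta>))\<^sup>2 \<partial>circle_measure)"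
        using zr by (intro square_le_Poisson[OF hol R]) auto
      also have "\<dots> \<le> 2 / (1 - \<rho>) * C"
        using zr \<rho>(1) C[of j] by (intro mult_mono divide_left_mono) auto
      finally show ?thesis by (rule real_le_rsqrt)
    qed
    then show ?thesis by blast
  qed
  obtain g s where g: "g holomorphic_on ball 0 1" and s: "strict_mono s"
    and lim: "\<And>z. z \<in> ball 0 1 \<Longrightarrow> (\<lambda>j. G (s j) z) \<longlonglongrightarrow> g z"
  proof (rule Montel[of "ball 0 1" "range G" G, OF open_ball _ bd order_refl])
    show "h holomorphic_on ball 0 1" if "h \<in> range G" for h using that hol1 by auto
  qed (blast intro: that)+
  have "(\<integral>\<zeta>. (cmod (g (of_real \<rho> * \<zeta>)))\<^sup>2 \<partial>circle_measure) \<le> C" if \<rho>: "0 \<le> \<rho>" "\<rho> < 1" for \<rho>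
  proof -
    have "ennreal (\<integral>\<zeta>. (cmod (g (of_real \<rho> * \<zeta>)))\<^sup>2 \<partial>circle_measure)
        = (\<integral>\<^sup>+ \<zeta>. ennreal ((cmod (g (of_real \<rho> * \<zeta>)))\<^sup>2) \<partial>circle_measure)"
      using \<rho> g by (intro nn_integral_circle_continuous[symmetric] continuous_intros continuous_on_dilate) auto
    also have "\<dots> = (\<integral>\<^sup>+ \<zeta>. liminf (\<lambda>j. ennreal ((cmod (G (s j) (of_real \<rho> * \<zeta>)))\<^sup>2)) \<partial>circle_measure)"
    proof (rule nn_integral_cong)
      fix \<zeta> assume "\<zeta> \<in> space circle_measure"
      then have "(\<lambda>j. ennreal ((cmod (G (s j) (of_real \<rho> * \<zeta>)))\<^sup>2)) \<longlonglongrightarrow> ennreal ((cmod (g (of_real \<rho> * \<zeta>)))\<^sup>2)"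
        using \<rho> by (intro tendsto_intros tendsto_ennrealI lim) (auto simp: norm_mult)
      then show "ennreal ((cmod (g (of_real \<rho> * \<zeta>)))\<^sup>2)
          = liminf (\<lambda>j. ennreal ((cmod (G (s j) (of_real \<rho> * \<zeta>)))\<^sup>2))"
        by (intro lim_imp_Liminf[symmetric]) auto
    qed
    also have "\<dots> \<le> liminf (\<lambda>j. \<integral>\<^sup>+ \<zeta>. ennreal ((cmod (G (s j) (of_real \<rho> * \<zeta>)))\<^sup>2) \<partial>circle_measure)"
      using \<rho> hol1 by (intro nn_integral_liminf measurable_compose[OF _ measurable_ennreal]
        continuous_imp_measurable_circle continuous_intros continuous_on_dilate) auto
    also have "\<dots> \<le> ennreal C"
    proof (rule Liminf_le)
      show "\<forall>\<^sub>F j in sequentially. (\<integral>\<^sup>+ \<zeta>. ennreal ((cmod (G (s j) (of_real \<rho> * \<zeta>)))\<^sup>2) \<partial>circle_measure) \<le> ennreal C"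
      proof (rule always_eventually, rule allI)
        fix j
        have "(\<integral>\<^sup>+ \<zeta>. ennreal ((cmod (G (s j) (of_real \<rho> * \<zeta>)))\<^sup>2) \<partial>circle_measure)
            = ennreal (\<integral>\<zeta>. (cmod (G (s j) (of_real \<rho> * \<zeta>)))\<^sup>2 \<partial>circle_measure)"
          using \<rho> hol1 by (intro nn_integral_circle_continuous continuous_intros continuous_on_dilate) auto
        also have "\<dots> \<le> ennreal (\<integral>\<zeta>. (cmod (G (s j) \<zeta>))\<^sup>2 \<partial>circle_measure)"
          using square_mean_mono[OF hol R, of "of_real \<rho>" "s j"] \<rho> by (simp add: mult.commute ennreal_leI)
        also have "\<dots> \<le> ennreal C" using C by (rule ennreal_leI)
        finally show "(\<integral>\<^sup>+ \<zeta>. ennreal ((cmod (G (s j) (of_real \<rho> * \<zeta>)))\<^sup>2) \<partial>circle_measure) \<le> ennreal C" .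
      qed
    qed simp
    finally show ?thesis using C0 by simp
  qed
  then have "bounded_square_means C g" using g by (auto simp: bounded_square_means_def)
  then show thesis using s lim by (rule that)
qed

text \<open>On each dilate \<open>F\<close> of \<open>f\<close>, take an entire \<open>p\<close> whose real part is close to \<open>ln (\<bar>F\<bar> + 1)\<close> on
  the circle: \<open>F = (F exp (- p / 2)) exp (p / 2)\<close>, and both factors have squared modulus at most a
  constant times \<open>\<bar>F\<bar> + 1\<close> there. Normal families pass the factorizations to the limit. All
  zeros of \<open>F\<close> stay in the first factor.\<close>

lemma Hardy_factorization:
  assumes f: "f holomorphic_on ball 0 1"
    and C: "\<And>r. 0 \<le> r \<Longrightarrow> r < 1 \<Longrightarrow> (\<integral>\<zeta>. cmod (f (of_real r * \<zeta>)) \<partial>circle_measure) \<le> C"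
  obtains k g where "bounded_square_means (exp 1 * (C + 1)) k" "bounded_square_means (exp 1 * (C + 1)) g"
    "\<And>z. z \<in> ball 0 1 \<Longrightarrow> f z = k z * g z"
proof -
  define r where "r j = 1 - 1 / real (j + 2)" for j
  have r: "0 < r j" "r j < 1" for j by (auto simp: r_def field_simps)
  have rlim: "r \<longlonglongrightarrow> 1" unfolding r_def by real_asymp
  define F where "F j z = f (of_real (r j) * z)" for j z
  have Fhol: "F j holomorphic_on ball 0 (1 / r j)" for j
    unfolding F_def by (rule holomorphic_on_dilate[OF f r(1)])
  have Fcont: "continuous_on (sphere 0 1) (F j)" for j
    unfolding F_def by (rule continuous_on_dilate[OF f]) (use r in \<open>auto intro: less_imp_le\<close>)
  have "\<exists>p. p holomorphic_on UNIV \<and> (\<forall>\<zeta>\<in>sphere 0 1. \<bar>Re (p \<zeta>) - ln (cmod (F j \<zeta>) + 1)\<bar> < 1)" for j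
  proof -
    have "continuous_on (sphere 0 1) (\<lambda>\<zeta>. ln (cmod (F j \<zeta>) + 1))"
      by (intro continuous_intros Fcont) (metis add_nonneg_pos less_irrefl norm_ge_zero zero_less_one)
    from Re_holomorphic_approximation[OF this, of 1] show ?thesis by (metis zero_less_one)
  qed
  then obtain p where p: "\<And>j. p j holomorphic_on UNIV"
    "\<And>j \<zeta>. \<zeta> \<in> sphere 0 1 \<Longrightarrow> \<bar>Re (p j \<zeta>) - ln (cmod (F j \<zeta>) + 1)\<bar> < 1"
    by metis
  define G where "G j z = exp (p j z / 2)" for j z
  define K where "K j z = F j z * exp (- p j z / 2)" for j z
  have hol: "G j holomorphic_on ball 0 (1 / r j)" "K j holomorphic_on ball 0 (1 / r j)" for j
    unfolding G_def K_def using p(1)[of j] Fhol[of j]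
    by (auto intro!: holomorphic_intros elim: holomorphic_on_subset)
  have cont: "continuous_on (sphere 0 1) (G j)" "continuous_on (sphere 0 1) (K j)" for j
    using hol[of j] r[of j] by (auto intro!: continuous_on_subset[OF holomorphic_on_imp_continuous_on])
  have KG: "F j z = K j z * G j z" for j z
    by (simp add: K_def G_def mult.assoc exp_add[symmetric])
  have Gsq: "(cmod (G j \<zeta>))\<^sup>2 \<le> exp 1 * (cmod (F j \<zeta>) + 1)"
    and Ksq: "(cmod (K j \<zeta>))\<^sup>2 \<le> exp 1 * (cmod (F j \<zeta>) + 1)" if "\<zeta> \<in> sphere 0 1" for j \<zeta>
  proof -
    have pos: "cmod (F j \<zeta>) + 1 > 0" by (simp add: add_nonneg_pos)
    have le: "ln (cmod (F j \<zeta>) + 1) - 1 \<le> Re (p j \<zeta>)" "Re (p j \<zeta>) \<le> 1 + ln (cmod (F j \<zeta>) + 1)"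
      using p(2)[OF that, of j] by linarith+
    have "(cmod (G j \<zeta>))\<^sup>2 = exp (Re (p j \<zeta>))"
      by (simp add: G_def power2_eq_square exp_add[symmetric])
    also have "\<dots> \<le> exp (1 + ln (cmod (F j \<zeta>) + 1))" using le by simp
    finally show "(cmod (G j \<zeta>))\<^sup>2 \<le> exp 1 * (cmod (F j \<zeta>) + 1)" using pos by (simp add: exp_add)
    have "(cmod (K j \<zeta>))\<^sup>2 = (cmod (F j \<zeta>))\<^sup>2 * exp (- Re (p j \<zeta>))"
      by (simp add: K_def norm_mult power_mult_distrib power2_eq_square exp_add[symmetric])
    also have "\<dots> \<le> (cmod (F j \<zeta>) + 1)\<^sup>2 * exp (1 - ln (cmod (F j \<zeta>) + 1))"
      using le by (intro mult_mono power_mono) auto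
    also have "exp (1 - ln (cmod (F j \<zeta>) + 1)) = exp 1 / (cmod (F j \<zeta>) + 1)"
      using pos by (simp add: exp_diff)
    also have "(cmod (F j \<zeta>) + 1)\<^sup>2 * (exp 1 / (cmod (F j \<zeta>) + 1)) = exp 1 * (cmod (F j \<zeta>) + 1)"
      using pos by (simp add: power2_eq_square)
    finally show "(cmod (K j \<zeta>))\<^sup>2 \<le> exp 1 * (cmod (F j \<zeta>) + 1)" .
  qed
  have bound: "(\<integral>\<zeta>. (cmod (H \<zeta>))\<^sup>2 \<partial>circle_measure) \<le> exp 1 * (C + 1)"
    if "continuous_on (sphere 0 1) H" "\<And>\<zeta>. \<zeta> \<in> sphere 0 1 \<Longrightarrow> (cmod (H \<zeta>))\<^sup>2 \<le> exp 1 * (cmod (F j \<zeta>) + 1)" for H j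
  proof -
    have iF: "integrable circle_measure (\<lambda>\<zeta>. cmod (F j \<zeta>))" by (intro integral_circle(1) continuous_intros Fcont)
    have "(\<integral>\<zeta>. (cmod (H \<zeta>))\<^sup>2 \<partial>circle_measure) \<le> (\<integral>\<zeta>. exp 1 * (cmod (F j \<zeta>) + 1) \<partial>circle_measure)"
      using that by (intro integral_mono integral_circle(1) continuous_intros Fcont) auto
    also have "\<dots> = exp 1 * ((\<integral>\<zeta>. cmod (F j \<zeta>) \<partial>circle_measure) + 1)"
      using iF by (simp add: circle.prob_space[simplified])
    also have "\<dots> \<le> exp 1 * (C + 1)"
      using C[of "r j"] r[of j] unfolding F_def by (intro mult_left_mono) (auto intro: less_imp_le)
    finally show ?thesis .
  qed
  obtain g s where g: "bounded_square_means (exp 1 * (C + 1)) g" "strict_mono s"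
    and glim: "\<And>z. z \<in> ball 0 1 \<Longrightarrow> (\<lambda>j. G (s j) z) \<longlonglongrightarrow> g z"
    using square_means_subsequence[of G r "exp 1 * (C + 1)"] hol r bound[OF cont(1) Gsq] by blast
  obtain k t where k: "bounded_square_means (exp 1 * (C + 1)) k" "strict_mono t"
    and klim: "\<And>z. z \<in> ball 0 1 \<Longrightarrow> (\<lambda>j. K (s (t j)) z) \<longlonglongrightarrow> k z"
    using square_means_subsequence[of "\<lambda>j. K (s j)" "\<lambda>j. r (s j)" "exp 1 * (C + 1)"] hol r bound[OF cont(2) Ksq] by blast
  have "f z = k z * g z" if z: "z \<in> ball 0 1" for z
  proof (rule LIMSEQ_unique)
    have st: "filterlim (\<lambda>j. s (t j)) sequentially sequentially"
      using filterlim_compose[OF filterlim_subseq[OF g(2)] filterlim_subseq[OF k(2)]] .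
    show "(\<lambda>j. F (s (t j)) z) \<longlonglongrightarrow> f z"
      unfolding F_def by (rule dilates_tendsto[OF f z filterlim_compose[OF rlim st]])
    show "(\<lambda>j. F (s (t j)) z) \<longlonglongrightarrow> k z * g z"
      unfolding KG using filterlim_compose[OF glim[OF z] filterlim_subseq[OF k(2)]]
      by (intro tendsto_mult klim z) (simp add: o_def)
  qed
  then show thesis using k(1) g(1) by (intro that) auto
qed

text \<open>The mean square \<open>I(r) = \<Sum> \<bar>a n\<bar>\<^sup>2 r^(2n)\<close> is increasing and bounded, and \<open>(x - y)\<^sup>2 \<le> \<bar>x\<^sup>2 - y\<^sup>2\<bar>\<close>
  for \<open>x, y \<ge> 0\<close> bounds the distance of two dilates by a difference of values of \<open>I\<close>.\<close>

lemma square_means_Cauchy: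
  assumes g: "bounded_square_means C g" and e: "0 < e"
  obtains \<sigma> where "0 \<le> \<sigma>" "\<sigma> < 1"
    "\<And>s t. \<sigma> \<le> s \<Longrightarrow> s < 1 \<Longrightarrow> \<sigma> \<le> t \<Longrightarrow> t < 1 \<Longrightarrow>
      (\<integral>\<zeta>. (cmod (g (of_real s * \<zeta>) - g (of_real t * \<zeta>)))\<^sup>2 \<partial>circle_measure) \<le> e"
proof -
  have hol: "g holomorphic_on ball 0 1" using g unfolding bounded_square_means_def by blast
  obtain a where a: "power_series_on 1 a g" using holomorphic_imp_power_series_on[OF hol] .
  define I where "I r = (\<integral>\<zeta>. (cmod (g (of_real r * \<zeta>)))\<^sup>2 \<partial>circle_measure)" for r :: real
  have I: "(\<lambda>n. (cmod (a n))\<^sup>2 * r ^ (2 * n)) sums I r" if "0 \<le> r" "r < 1" for r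
    using Parseval[OF a, of "of_real r"] that by (simp add: I_def mult.commute)
  have diff: "(\<integral>\<zeta>. (cmod (g (of_real s * \<zeta>) - g (of_real t * \<zeta>)))\<^sup>2 \<partial>circle_measure) \<le> I t - I s"
    if st: "0 \<le> s" "s \<le> t" "t < 1" for s t
  proof -
    \<comment> \<open>Parseval's identity on the circle needs a radius of convergence beyond 1; any number between
  1 and \<open>1 / t\<close> would do.\<close>
    have R: "1 < 1 / ((1 + t) / 2)" using st by simp
    have "power_series_on (1 / ((1 + t) / 2)) (\<lambda>n. a n * (of_real s ^ n - of_real t ^ n))
       (\<lambda>z. g (of_real s * z) - g (of_real t * z))"
      unfolding power_series_on_def
    proof
      fix w :: complex assume "w \<in> ball 0 (1 / ((1 + t) / 2))"
      then have w: "cmod w * (1 + t) < 2" using st by (simp add: field_simps)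
      have "cmod w * t < 1"
      proof (cases "cmod w \<le> 1")
        case True
        then show ?thesis using st by (smt (verit) mult_left_le_one_le norm_ge_zero)
      next
        case False
        then show ?thesis using w by (simp add: distrib_left)
      qed
      moreover have "cmod w * s \<le> cmod w * t" using st by (intro mult_left_mono) auto
      ultimately have "of_real s * w \<in> ball 0 1" "of_real t * w \<in> ball 0 1"
        using st by (auto simp: norm_mult mult.commute)
      then have "(\<lambda>n. a n * (of_real s * w) ^ n - a n * (of_real t * w) ^ n)
          sums (g (of_real s * w) - g (of_real t * w))"
        using a unfolding power_series_on_def by (intro sums_diff) auto
      then show "(\<lambda>n. a n * (of_real s ^ n - of_real t ^ n) * w ^ n)
          sums (g (of_real s * w) - g (of_real t * w))"
        by (simp add: power_mult_distrib algebra_simps)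
    qed
    from Parseval[OF this, of 1] R
    have A: "(\<lambda>n. (cmod (a n * (of_real s ^ n - of_real t ^ n)))\<^sup>2) sums
        (\<integral>\<zeta>. (cmod (g (of_real s * \<zeta>) - g (of_real t * \<zeta>)))\<^sup>2 \<partial>circle_measure)" by simp
    have B: "(\<lambda>n. (cmod (a n))\<^sup>2 * t ^ (2 * n) - (cmod (a n))\<^sup>2 * s ^ (2 * n)) sums (I t - I s)"
      using st by (intro sums_diff I) auto
    have "(cmod (a n * (of_real s ^ n - of_real t ^ n)))\<^sup>2
        \<le> (cmod (a n))\<^sup>2 * t ^ (2 * n) - (cmod (a n))\<^sup>2 * s ^ (2 * n)" for n
    proof -
      have le: "0 \<le> s ^ n" "s ^ n \<le> t ^ n" using st by (auto intro: power_mono)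
      have eq: "cmod (of_real s ^ n - of_real t ^ n) = t ^ n - s ^ n"
        using le by (simp flip: of_real_power of_real_diff add: norm_of_real)
      have sq: "(t ^ n - s ^ n)\<^sup>2 \<le> (t ^ n)\<^sup>2 - (s ^ n)\<^sup>2"
        using mult_left_mono[OF le(2) le(1)] by (simp add: power2_eq_square algebra_simps)
      have "(cmod (a n * (of_real s ^ n - of_real t ^ n)))\<^sup>2 = (cmod (a n))\<^sup>2 * (t ^ n - s ^ n)\<^sup>2"
        by (simp add: norm_mult power_mult_distrib eq)
      also have "\<dots> \<le> (cmod (a n))\<^sup>2 * ((t ^ n)\<^sup>2 - (s ^ n)\<^sup>2)"
        by (intro mult_left_mono sq) simp
      also have "\<dots> = (cmod (a n))\<^sup>2 * t ^ (2 * n) - (cmod (a n))\<^sup>2 * s ^ (2 * n)"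
        by (simp only: power_mult[symmetric] mult.commute[of n 2] right_diff_distrib)
      finally show ?thesis .
    qed
    then show ?thesis by (rule sums_le[OF _ A B])
  qed
  define L where "L = (SUP r\<in>{0..<1}. I r)"
  have bdd: "bdd_above (I ` {0..<1})"
    using g unfolding bounded_square_means_def I_def[symmetric] by (intro bdd_aboveI2[of _ _ C]) blast
  obtain \<sigma> where \<sigma>: "0 \<le> \<sigma>" "\<sigma> < 1" "L - e < I \<sigma>"
    using less_cSUP_iff[OF _ bdd, of "L - e"] e by (auto simp: L_def)
  have I_le: "I r \<le> L" if "0 \<le> r" "r < 1" for r
    unfolding L_def using that by (intro cSUP_upper bdd) auto
  have I_mono: "I s \<le> I t" if "0 \<le> s" "s \<le> t" "t < 1" for s t
    using order_trans[OF _ diff[OF that], of 0] by simp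
  have le: "(\<integral>\<zeta>. (cmod (g (of_real s * \<zeta>) - g (of_real t * \<zeta>)))\<^sup>2 \<partial>circle_measure) \<le> e"
    if "\<sigma> \<le> s" "s \<le> t" "t < 1" for s t
    using diff[of s t] I_le[of t] I_mono[of \<sigma> s] \<sigma> that by auto
  show thesis
  proof (rule that[OF \<sigma>(1,2)])
    fix s t assume "\<sigma> \<le> s" "s < 1" "\<sigma> \<le> t" "t < 1"
    then show "(\<integral>\<zeta>. (cmod (g (of_real s * \<zeta>) - g (of_real t * \<zeta>)))\<^sup>2 \<partial>circle_measure) \<le> e"
      using le[of s t] le[of t s] by (cases "s \<le> t") (auto simp: norm_minus_commute)
  qed
qed

text \<open>Write \<open>f = k g\<close> with bounded square means and \<open>k g - k' g' = k (g - g') + g' (k - k')\<close>. The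
  inequality \<open>2 x y \<le> \<eta> x\<^sup>2 + y\<^sup>2 / \<eta>\<close> with a small \<open>\<eta>\<close> makes the bounded factors contribute little,
  and the square means of the differences are small for radii close to 1.\<close>

lemma Hardy_dilates_Cauchy:
  assumes f: "f holomorphic_on ball 0 1"
    and C: "\<And>r. 0 \<le> r \<Longrightarrow> r < 1 \<Longrightarrow> (\<integral>\<zeta>. cmod (f (of_real r * \<zeta>)) \<partial>circle_measure) \<le> C"
    and e: "0 < e"
  obtains \<sigma> where "0 \<le> \<sigma>" "\<sigma> < 1"
    "\<And>s t. \<sigma> \<le> s \<Longrightarrow> s < 1 \<Longrightarrow> \<sigma> \<le> t \<Longrightarrow> t < 1 \<Longrightarrow>
      (\<integral>\<zeta>. cmod (f (of_real s * \<zeta>) - f (of_real t * \<zeta>)) \<partial>circle_measure) \<le> e"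
proof -
  obtain k g where k: "bounded_square_means (exp 1 * (C + 1)) k" and g: "bounded_square_means (exp 1 * (C + 1)) g"
    and fkg: "\<And>z. z \<in> ball 0 1 \<Longrightarrow> f z = k z * g z"
    using Hardy_factorization[OF f C] by blast
  define B where "B = exp 1 * (C + 1) + 1"
  have "0 \<le> C" using C[of 0] by (rule order_trans[rotated]) auto
  then have B: "0 < B" by (simp add: B_def add_pos_pos)
  define \<eta> where "\<eta> = e / (2 * B)"
  have \<eta>: "0 < \<eta>" using e B by (simp add: \<eta>_def)
  have pos: "0 < \<eta> * e / 2" using \<eta> e by simp
  obtain \<sigma>1 where \<sigma>1: "0 \<le> \<sigma>1" "\<sigma>1 < 1" "\<And>s t. \<sigma>1 \<le> s \<Longrightarrow> s < 1 \<Longrightarrow> \<sigma>1 \<le> t \<Longrightarrow> t < 1 \<Longrightarrow>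
      (\<integral>\<zeta>. (cmod (g (of_real s * \<zeta>) - g (of_real t * \<zeta>)))\<^sup>2 \<partial>circle_measure) \<le> \<eta> * e / 2"
    using square_means_Cauchy[OF g pos] by blast
  obtain \<sigma>2 where \<sigma>2: "0 \<le> \<sigma>2" "\<sigma>2 < 1" "\<And>s t. \<sigma>2 \<le> s \<Longrightarrow> s < 1 \<Longrightarrow> \<sigma>2 \<le> t \<Longrightarrow> t < 1 \<Longrightarrow>
      (\<integral>\<zeta>. (cmod (k (of_real s * \<zeta>) - k (of_real t * \<zeta>)))\<^sup>2 \<partial>circle_measure) \<le> \<eta> * e / 2"
    using square_means_Cauchy[OF k pos] by blast
  have hol: "k holomorphic_on ball 0 1" "g holomorphic_on ball 0 1"
    using k g unfolding bounded_square_means_def by blast+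
  show thesis
  proof (rule that[of "max \<sigma>1 \<sigma>2"])
    fix s t assume st: "max \<sigma>1 \<sigma>2 \<le> s" "s < 1" "max \<sigma>1 \<sigma>2 \<le> t" "t < 1"
    then have st0: "0 \<le> s" "0 \<le> t" using \<sigma>1 \<sigma>2 by auto
    have cont: "continuous_on (sphere 0 1) (\<lambda>\<zeta>. k (of_real s * \<zeta>))" "continuous_on (sphere 0 1) (\<lambda>\<zeta>. g (of_real s * \<zeta>))"
      "continuous_on (sphere 0 1) (\<lambda>\<zeta>. k (of_real t * \<zeta>))" "continuous_on (sphere 0 1) (\<lambda>\<zeta>. g (of_real t * \<zeta>))"
      "continuous_on (sphere 0 1) (\<lambda>\<zeta>. f (of_real s * \<zeta>))" "continuous_on (sphere 0 1) (\<lambda>\<zeta>. f (of_real t * \<zeta>))"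
      using st st0 by (auto intro!: continuous_on_dilate hol f)
    have amgm: "x * y \<le> (\<eta> * x\<^sup>2 + y\<^sup>2 / \<eta>) / 2" for x y :: real
    proof -
      have "0 \<le> (\<eta> * x - y)\<^sup>2 / \<eta>" using \<eta> by simp
      also have "\<dots> = \<eta> * x\<^sup>2 + y\<^sup>2 / \<eta> - 2 * (x * y)"
        using \<eta> by (simp add: power2_eq_square field_simps)
      finally show ?thesis by simp
    qed
    have pt: "cmod (f (of_real s * \<zeta>) - f (of_real t * \<zeta>)) \<le>
        \<eta> / 2 * (cmod (k (of_real s * \<zeta>)))\<^sup>2 + 1 / (2 * \<eta>) * (cmod (g (of_real s * \<zeta>) - g (of_real t * \<zeta>)))\<^sup>2
        + (\<eta> / 2 * (cmod (g (of_real t * \<zeta>)))\<^sup>2 + 1 / (2 * \<eta>) * (cmod (k (of_real s * \<zeta>) - k (of_real t * \<zeta>)))\<^sup>2)"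
      if "\<zeta> \<in> sphere 0 1" for \<zeta>
    proof -
      have "of_real s * \<zeta> \<in> ball 0 1" "of_real t * \<zeta> \<in> ball 0 1" using that st st0 by (auto simp: norm_mult)
      then have "f (of_real s * \<zeta>) - f (of_real t * \<zeta>)
        = k (of_real s * \<zeta>) * (g (of_real s * \<zeta>) - g (of_real t * \<zeta>))
          + g (of_real t * \<zeta>) * (k (of_real s * \<zeta>) - k (of_real t * \<zeta>))"
        by (simp add: fkg algebra_simps)
      then have "cmod (f (of_real s * \<zeta>) - f (of_real t * \<zeta>))
        \<le> cmod (k (of_real s * \<zeta>)) * cmod (g (of_real s * \<zeta>) - g (of_real t * \<zeta>))
          + cmod (g (of_real t * \<zeta>)) * cmod (k (of_real s * \<zeta>) - k (of_real t * \<zeta>))"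
        by (metis norm_mult norm_triangle_ineq)
      also have "\<dots> \<le> (\<eta> * (cmod (k (of_real s * \<zeta>)))\<^sup>2 + (cmod (g (of_real s * \<zeta>) - g (of_real t * \<zeta>)))\<^sup>2 / \<eta>) / 2
          + (\<eta> * (cmod (g (of_real t * \<zeta>)))\<^sup>2 + (cmod (k (of_real s * \<zeta>) - k (of_real t * \<zeta>)))\<^sup>2 / \<eta>) / 2"
        by (intro add_mono amgm)
      finally show ?thesis by (simp add: add_divide_distrib mult.commute)
    qed
    have [simp]: "integrable circle_measure (\<lambda>\<zeta>. (cmod (k (of_real s * \<zeta>)))\<^sup>2)"
      "integrable circle_measure (\<lambda>\<zeta>. (cmod (g (of_real t * \<zeta>)))\<^sup>2)"
      "integrable circle_measure (\<lambda>\<zeta>. (cmod (g (of_real s * \<zeta>) - g (of_real t * \<zeta>)))\<^sup>2)"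
      "integrable circle_measure (\<lambda>\<zeta>. (cmod (k (of_real s * \<zeta>) - k (of_real t * \<zeta>)))\<^sup>2)"
      "integrable circle_measure (\<lambda>\<zeta>. cmod (f (of_real s * \<zeta>) - f (of_real t * \<zeta>)))"
      by (intro integral_circle(1) continuous_intros cont)+
    have "(\<integral>\<zeta>. cmod (f (of_real s * \<zeta>) - f (of_real t * \<zeta>)) \<partial>circle_measure) \<le>
      (\<integral>\<zeta>. \<eta> / 2 * (cmod (k (of_real s * \<zeta>)))\<^sup>2 + 1 / (2 * \<eta>) * (cmod (g (of_real s * \<zeta>) - g (of_real t * \<zeta>)))\<^sup>2
        + (\<eta> / 2 * (cmod (g (of_real t * \<zeta>)))\<^sup>2 + 1 / (2 * \<eta>) * (cmod (k (of_real s * \<zeta>) - k (of_real t * \<zeta>)))\<^sup>2) \<partial>circle_measure)"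
      using pt by (intro integral_mono) auto
    also have "\<dots> = \<eta> / 2 * (\<integral>\<zeta>. (cmod (k (of_real s * \<zeta>)))\<^sup>2 \<partial>circle_measure)
        + 1 / (2 * \<eta>) * (\<integral>\<zeta>. (cmod (g (of_real s * \<zeta>) - g (of_real t * \<zeta>)))\<^sup>2 \<partial>circle_measure)
        + (\<eta> / 2 * (\<integral>\<zeta>. (cmod (g (of_real t * \<zeta>)))\<^sup>2 \<partial>circle_measure)
          + 1 / (2 * \<eta>) * (\<integral>\<zeta>. (cmod (k (of_real s * \<zeta>) - k (of_real t * \<zeta>)))\<^sup>2 \<partial>circle_measure))"
      by simp
    also have "\<dots> \<le> \<eta> / 2 * B + 1 / (2 * \<eta>) * (\<eta> * e / 2) + (\<eta> / 2 * B + 1 / (2 * \<eta>) * (\<eta> * e / 2))"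
    proof -
      have "(\<integral>\<zeta>. (cmod (k (of_real s * \<zeta>)))\<^sup>2 \<partial>circle_measure) \<le> B"
        "(\<integral>\<zeta>. (cmod (g (of_real t * \<zeta>)))\<^sup>2 \<partial>circle_measure) \<le> B"
        using k g st st0 unfolding bounded_square_means_def B_def
        by (metis add_increasing2 atLeastLessThan_iff zero_le_one)+
      moreover have "(\<integral>\<zeta>. (cmod (g (of_real s * \<zeta>) - g (of_real t * \<zeta>)))\<^sup>2 \<partial>circle_measure) \<le> \<eta> * e / 2"
        "(\<integral>\<zeta>. (cmod (k (of_real s * \<zeta>) - k (of_real t * \<zeta>)))\<^sup>2 \<partial>circle_measure) \<le> \<eta> * e / 2"
        by (rule \<sigma>1(3); use st in simp) (rule \<sigma>2(3); use st in simp)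
      ultimately show ?thesis using \<eta> by (intro add_mono mult_left_mono) auto
    qed
    also have "\<dots> = e" using \<eta> B by (simp add: \<eta>_def field_simps)
    finally show "(\<integral>\<zeta>. cmod (f (of_real s * \<zeta>) - f (of_real t * \<zeta>)) \<partial>circle_measure) \<le> e" .
  qed (use \<sigma>1 \<sigma>2 in auto)
qed

section \<open>The maximal inequality\<close>

text \<open>If all means of \<open>w\<close> over the intervals \<open>[0, \<delta>]\<close> are at most \<open>c\<close>, so is its mean against any
  decreasing kernel: integrate by parts and compare with the constant function \<open>c\<close>.\<close>

lemma integral_decreasing_kernel_le:
  fixes P w :: "real \<Rightarrow> real"
  assumes P: "\<And>t. t \<in> {0..a} \<Longrightarrow> (P has_real_derivative P' t) (at t)"
    and P': "continuous_on {0..a} P'" "\<And>t. t \<in> {0..a} \<Longrightarrow> P' t \<le> 0" and Pa: "0 \<le> P a" and a: "0 \<le> a"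
    and w: "continuous_on {0..a} w" and mean: "\<And>\<delta>. \<delta> \<in> {0..a} \<Longrightarrow> integral {0..\<delta>} w \<le> c * \<delta>"
  shows "integral {0..a} (\<lambda>t. P t * w t) \<le> c * integral {0..a} P"
proof -
  define U where "U \<delta> = integral {0..\<delta>} w - c * \<delta>" for \<delta>
  have U': "(U has_vector_derivative (w t - c)) (at t within {0..a})" if "t \<in> {0..a}" for t
    unfolding U_def
    by (intro derivative_eq_intros integral_has_vector_derivative[OF w that] refl
        has_vector_derivative_diff) (auto intro!: derivative_eq_intros)
  have P'': "(P has_vector_derivative P' t) (at t within {0..a})" if "t \<in> {0..a}" for t
    using P[OF that] by (simp add: has_real_derivative_iff_has_vector_derivative has_vector_derivative_at_within)
  have contP: "continuous_on {0..a} P"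
    using P'' by (intro continuous_on_vector_derivative)
  have contU: "continuous_on {0..a} U"
    using U' by (intro continuous_on_vector_derivative)
  have I1: "((\<lambda>t. P t * (w t - c)) has_integral integral {0..a} (\<lambda>t. P t * (w t - c))) {0..a}"
    by (intro integrable_integral integrable_continuous_real continuous_intros contP w)
  have I2: "((\<lambda>t. P' t * U t) has_integral integral {0..a} (\<lambda>t. P' t * U t)) {0..a}"
    by (intro integrable_integral integrable_continuous_real continuous_intros contU P')
  have I3: "((\<lambda>t. P t * (w t - c) + P' t * U t) has_integral P a * U a - P 0 * U 0) {0..a}"
    using has_vector_derivative_mult[OF P'' U'] a
    by (intro fundamental_theorem_of_calculus) (auto simp: algebra_simps)
  have eq: "integral {0..a} (\<lambda>t. P t * (w t - c)) + integral {0..a} (\<lambda>t. P' t * U t) = P a * U a - P 0 * U 0"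
    by (rule has_integral_unique[OF has_integral_add[OF I1 I2] I3])
  have Ule: "U t \<le> 0" if "t \<in> {0..a}" for t using mean[OF that] by (simp add: U_def)
  have "0 \<le> integral {0..a} (\<lambda>t. P' t * U t)"
    using P'(2) Ule by (intro integral_nonneg integrable_continuous_real continuous_intros contU P' mult_nonpos_nonpos) auto
  moreover have "P a * U a \<le> 0" using Pa Ule[of a] a by (intro mult_nonneg_nonpos) auto
  moreover have "U 0 = 0" by (simp add: U_def)
  ultimately have "integral {0..a} (\<lambda>t. P t * (w t - c)) \<le> 0" using eq by simp
  moreover have "integral {0..a} (\<lambda>t. P t * (w t - c)) = integral {0..a} (\<lambda>t. P t * w t) - integral {0..a} (\<lambda>t. P t * c)"
    by (subst Henstock_Kurzweil_Integration.integral_diff[symmetric])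
       (auto intro!: integrable_continuous_real continuous_intros contP w simp: right_diff_distrib)
  moreover have "integral {0..a} (\<lambda>t. P t * c) = c * integral {0..a} P" by (simp add: mult.commute)
  ultimately show ?thesis by linarith
qed

lemma Poisson_kernel_cis:
  "Poisson_kernel (of_real r) (cis t) = (1 - r\<^sup>2) / (1 - 2 * r * cos t + r\<^sup>2)"
proof -
  have "(cmod (cis t - of_real r))\<^sup>2 = (cos t - r)\<^sup>2 + (sin t)\<^sup>2" by (simp add: cmod_power2)
  also have "\<dots> = 1 - 2 * r * cos t + r\<^sup>2"
    using sin_cos_squared_add[of t] by (simp add: power2_eq_square algebra_simps)
  finally show ?thesis by (simp add: Poisson_kernel_def)
qed

lemma integral_circle_halves:
  fixes f :: "complex \<Rightarrow> real"
  assumes "continuous_on (sphere 0 1) f"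
  shows "2 * pi * (\<integral>\<zeta>. f \<zeta> \<partial>circle_measure) = integral {0..pi} (\<lambda>t. f (cis t) + f (cis (- t)))"
proof -
  have cont: "continuous_on S (\<lambda>t. f (cis (g t)))" if "continuous_on S g" for S :: "real set" and g
    by (intro continuous_on_compose2[OF assms]) (auto intro!: continuous_intros that)
  have int: "(\<lambda>t. f (cis t)) integrable_on {x..y}" for x y
    by (intro integrable_continuous_real cont continuous_intros)
  have "2 * pi * (\<integral>\<zeta>. f \<zeta> \<partial>circle_measure) = integral {0..2 * pi} (\<lambda>t. f (cis t))"
    using integral_circle(2)[OF assms] by (simp add: integral_unique)
  also have "\<dots> = integral {0..pi} (\<lambda>t. f (cis t)) + integral {pi..2 * pi} (\<lambda>t. f (cis t))"
    by (intro Henstock_Kurzweil_Integration.integral_combine[symmetric] int) auto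
  also have "integral {pi..2 * pi} (\<lambda>t. f (cis t)) = integral {-(2 * pi)..-pi} (\<lambda>t. f (cis (- t)))"
    by (rule Henstock_Kurzweil_Integration.integral_reflect_real[symmetric])
  also have "\<dots> = integral {0..pi} (\<lambda>t. f (cis (- t)))"
  proof -
    have "((\<lambda>t. f (cis (- t))) has_integral integral {-(2 * pi)..-pi} (\<lambda>t. f (cis (- t)))) {-(2 * pi)..-pi}"
      by (intro integrable_integral integrable_continuous_real cont continuous_intros)
    from has_integral_affinity'[of _ _ "-(2 * pi)" "-pi" 1 "-(2 * pi)", unfolded cbox_interval, OF this]
    have "((\<lambda>t. f (cis (2 * pi - t))) has_integral integral {-(2 * pi)..-pi} (\<lambda>t. f (cis (- t)))) {0..pi}"
      by simp
    moreover have "cis (2 * pi - t) = cis (- t)" for t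
      by (simp add: complex_eq_iff cos_diff sin_diff)
    ultimately show ?thesis by (simp add: integral_unique)
  qed
  also have "integral {0..pi} (\<lambda>t. f (cis t)) + integral {0..pi} (\<lambda>t. f (cis (- t)))
      = integral {0..pi} (\<lambda>t. f (cis t) + f (cis (- t)))"
    by (intro Henstock_Kurzweil_Integration.integral_add[symmetric] integrable_continuous_real cont continuous_intros)
  finally show ?thesis .
qed

text \<open>The Poisson kernel of a point on the radius of \<open>cis \<theta>\<close> is symmetric about \<open>\<theta>\<close> and decreases away
  from it, so a Poisson integral over \<open>c\<close> forces the mean over some arc centred at \<open>\<theta>\<close> over \<open>c\<close>.\<close>

lemma ex_large_mean:
  assumes F: "continuous_on (cball 0 1) F" "F holomorphic_on ball 0 1"
    and r: "0 \<le> r" "r < 1" and large: "c < cmod (F (of_real r * cis \<theta>))"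
  shows "\<exists>\<delta>\<in>{0<..pi}. 2 * c * \<delta> < integral {\<theta> - \<delta>..\<theta> + \<delta>} (\<lambda>t. cmod (F (cis t)))"
proof (rule ccontr)
  assume "\<not> ?thesis"
  then have small: "integral {\<theta> - \<delta>..\<theta> + \<delta>} (\<lambda>t. cmod (F (cis t))) \<le> 2 * c * \<delta>" if "\<delta> \<in> {0<..pi}" for \<delta>
    using that by (meson not_less)
  have contF: "continuous_on (sphere 0 1) F" using F(1) by (rule continuous_on_subset) auto
  define u where "u t = cmod (F (cis t))" for t
  have cont: "continuous_on S u" for S
    unfolding u_def by (intro continuous_on_norm continuous_on_compose2[OF contF]) (auto intro!: continuous_intros)
  define P where "P t = (1 - r\<^sup>2) / (1 - 2 * r * cos t + r\<^sup>2)" for t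
  have den: "0 < 1 - 2 * r * cos t + r\<^sup>2" for t
  proof -
    have "r * cos t \<le> r * 1" using r by (intro mult_left_mono) auto
    moreover have "0 < (1 - r)\<^sup>2" using r by simp
    ultimately show ?thesis by (simp add: power2_eq_square algebra_simps)
  qed
  define P' where "P' t = - ((1 - r\<^sup>2) * (2 * r * sin t)) / (1 - 2 * r * cos t + r\<^sup>2)\<^sup>2" for t
  have derP: "(P has_real_derivative P' t) (at t)" for t
    unfolding P_def P'_def using den[of t]
    by (auto intro!: derivative_eq_intros simp: power2_eq_square)
  have r2: "0 \<le> 1 - r\<^sup>2" using r by (simp add: power_le_one)
  \<comment> \<open>Folding the circle at \<open>\<theta>\<close> turns symmetric arcs into intervals \<open>[0, \<delta>]\<close>.\<close>
  define w where "w t = u (\<theta> + t) + u (\<theta> - t)" for t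
  have contw: "continuous_on S w" for S
    unfolding w_def u_def
    by (intro continuous_on_add continuous_on_norm continuous_on_compose2[OF contF]) (auto intro!: continuous_intros)
  have intw: "integral {0..\<delta>} w = integral {\<theta> - \<delta>..\<theta> + \<delta>} u" if "0 \<le> \<delta>" for \<delta>
  proof -
    have i: "(u has_integral integral {x..y} u) {x..y}" for x y
      by (intro integrable_integral integrable_continuous_real cont)
    have "((\<lambda>t. u (\<theta> + t)) has_integral integral {\<theta>..\<theta> + \<delta>} u) {0..\<delta>}"
      using has_integral_affinity'[of u _ \<theta> "\<theta> + \<delta>" 1 \<theta>, unfolded cbox_interval, OF i] by (simp add: add.commute)
    moreover have "((\<lambda>t. u (\<theta> - t)) has_integral integral {\<theta> - \<delta>..\<theta>} u) {0..\<delta>}"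
    proof -
      have "((\<lambda>t. u (- t)) has_integral integral {\<theta> - \<delta>..\<theta>} u) {- \<theta>..\<delta> - \<theta>}"
        using i[of "\<theta> - \<delta>" \<theta>] has_integral_reflect_real[of u "integral {\<theta> - \<delta>..\<theta>} u" \<theta> "\<theta> - \<delta>"] by simp
      from has_integral_affinity'[of _ _ "- \<theta>" "\<delta> - \<theta>" 1 "- \<theta>", unfolded cbox_interval, OF this]
      show ?thesis by simp
    qed
    ultimately have "(w has_integral integral {\<theta>..\<theta> + \<delta>} u + integral {\<theta> - \<delta>..\<theta>} u) {0..\<delta>}"
      unfolding w_def by (rule has_integral_add)
    moreover have "integral {\<theta> - \<delta>..\<theta>} u + integral {\<theta>..\<theta> + \<delta>} u = integral {\<theta> - \<delta>..\<theta> + \<delta>} u"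
      using that by (intro Henstock_Kurzweil_Integration.integral_combine integrable_continuous_real cont) auto
    ultimately show ?thesis by (metis add.commute integral_unique)
  qed
  have "integral {0..pi} (\<lambda>t. P t * w t) \<le> (2 * c) * integral {0..pi} P"
  proof (rule integral_decreasing_kernel_le[where P'=P'])
    show "continuous_on {0..pi} P'" unfolding P'_def
      using den by (intro continuous_intros) (metis less_irrefl power_eq_0_iff)
    show "P' t \<le> 0" if "t \<in> {0..pi}" for t
      using that r r2 sin_ge_zero[of t] den[of t] unfolding P'_def
      by (intro divide_nonpos_nonneg) auto
    show "0 \<le> P pi" using r2 den[of pi] by (simp add: P_def)
    show "integral {0..\<delta>} w \<le> 2 * c * \<delta>" if "\<delta> \<in> {0..pi}" for \<delta>
    proof (cases "\<delta> = 0")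
      case False
      then show ?thesis using small[of \<delta>] that by (auto simp: intw u_def[abs_def])
    qed simp
  qed (use derP contw in auto)
  moreover have "cmod (F (of_real r * cis \<theta>)) * (2 * pi) \<le> integral {0..pi} (\<lambda>t. P t * w t)"
  proof -
    define F1 where "F1 z = F (cis \<theta> * z)" for z
    have F1: "continuous_on (cball 0 1) F1" "F1 holomorphic_on ball 0 1"
      unfolding F1_def
      by (intro continuous_on_compose2[OF F(1)] continuous_intros; auto simp: norm_mult)
         (intro holomorphic_on_compose_gen[OF _ F(2), unfolded o_def] holomorphic_intros; auto simp: norm_mult)
    have contF1: "continuous_on (sphere 0 1) F1" using F1(1) by (rule continuous_on_subset) auto
    have rb: "of_real r \<in> ball (0::complex) 1" using r by simp
    have "F1 (of_real r) = (\<integral>\<zeta>. of_real (Poisson_kernel (of_real r) \<zeta>) * F1 \<zeta> \<partial>circle_measure)"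
      by (rule Poisson_formula[symmetric, OF F1 rb])
    then have "cmod (F1 (of_real r)) \<le> (\<integral>\<zeta>. Poisson_kernel (of_real r) \<zeta> * cmod (F1 \<zeta>) \<partial>circle_measure)"
      using Poisson_kernel_nonneg[OF rb]
      by (simp add: norm_mult order_trans[OF integral_norm_bound])
    then have "cmod (F (of_real r * cis \<theta>)) * (2 * pi)
        \<le> 2 * pi * (\<integral>\<zeta>. Poisson_kernel (of_real r) \<zeta> * cmod (F1 \<zeta>) \<partial>circle_measure)"
      by (simp add: F1_def mult.commute)
    also have "\<dots> = integral {0..pi} (\<lambda>t. Poisson_kernel (of_real r) (cis t) * cmod (F1 (cis t))
        + Poisson_kernel (of_real r) (cis (- t)) * cmod (F1 (cis (- t))))"
      by (intro integral_circle_halves continuous_intros continuous_Poisson_kernel[OF rb] contF1)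
    also have "\<dots> = integral {0..pi} (\<lambda>t. P t * w t)"
      by (intro integral_cong)
         (simp add: Poisson_kernel_cis P_def w_def u_def F1_def cis_mult distrib_left)
    finally show ?thesis .
  qed
  moreover have "2 * integral {0..pi} P = 2 * pi"
  proof -
    have rb: "of_real r \<in> ball (0::complex) 1" using r by simp
    have "2 * pi * (\<integral>\<zeta>. Poisson_kernel (of_real r) \<zeta> \<partial>circle_measure)
        = integral {0..pi} (\<lambda>t. Poisson_kernel (of_real r) (cis t) + Poisson_kernel (of_real r) (cis (- t)))"
      by (intro integral_circle_halves continuous_Poisson_kernel[OF rb])
    also have "\<dots> = integral {0..pi} (\<lambda>t. 2 * P t)"
      by (intro integral_cong) (simp add: Poisson_kernel_cis P_def)
    finally show ?thesis using Poisson_kernel_integral(1)[OF rb] by simp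
  qed
  ultimately have "cmod (F (of_real r * cis \<theta>)) * (2 * pi) \<le> c * (2 * pi)"
    by (metis (no_types, lifting) mult.assoc mult.commute order_trans)
  then show False using large by simp
qed

lemma emeasure_UN_countable_le:
  assumes "countable I" and [measurable]: "\<And>i. i \<in> I \<Longrightarrow> X i \<in> sets M"
  shows "emeasure M (\<Union>i\<in>I. X i) \<le> (\<integral>\<^sup>+ i. emeasure M (X i) \<partial>count_space I)"
proof -
  have "emeasure M (\<Union>i\<in>I. X i) = (\<integral>\<^sup>+ x. indicator (\<Union>i\<in>I. X i) x \<partial>M)"
    using assms by (intro nn_integral_indicator[symmetric] sets.countable_UN') auto
  also have "\<dots> \<le> (\<integral>\<^sup>+ x. \<integral>\<^sup>+ i. indicator (X i) x \<partial>count_space I \<partial>M)"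
  proof (rule nn_integral_mono)
    fix x
    show "indicator (\<Union>i\<in>I. X i) x \<le> (\<integral>\<^sup>+ i. indicator (X i) x \<partial>count_space I)"
    proof (cases "x \<in> (\<Union>i\<in>I. X i)")
      case True
      then obtain i where "i \<in> I" "x \<in> X i" by auto
      then have "(1::ennreal) = indicator (X i) x" by simp
      also have "\<dots> \<le> (\<integral>\<^sup>+ i. indicator (X i) x \<partial>count_space I)"
        using \<open>i \<in> I\<close> by (rule nn_integral_ge_point)
      finally show ?thesis using True by simp
    qed simp
  qed
  also have "\<dots> = (\<integral>\<^sup>+ i. \<integral>\<^sup>+ x. indicator (X i) x \<partial>M \<partial>count_space I)"
    using assms by (intro nn_integral_count_space_nn_integral) auto
  also have "\<dots> = (\<integral>\<^sup>+ i. emeasure M (X i) \<partial>count_space I)"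
    by (intro nn_integral_cong) simp
  finally show ?thesis .
qed

text \<open>The Hardy-Littlewood inequality on the line, for intervals of bounded length: by Vitali's
  lemma disjoint intervals with large means can be chosen whose fivefold enlargements cover the
  exceptional set.\<close>

lemma Hardy_Littlewood_line:
  fixes u :: "real \<Rightarrow> real"
  assumes cont: "continuous_on UNIV u" and nn: "\<And>t. 0 \<le> u t" and c: "0 < c"
  obtains V where "V \<in> sets lborel"
    "\<And>\<theta> \<delta>. \<theta> \<in> {a..b} \<Longrightarrow> \<delta> \<in> {0<..d} \<Longrightarrow> 2 * c * \<delta> < integral {\<theta> - \<delta>..\<theta> + \<delta>} u \<Longrightarrow> \<theta> \<in> V"
    "emeasure lborel V \<le> ennreal (5 / c) * (\<integral>\<^sup>+ t. ennreal (u t) * indicator {a - d..b + d} t \<partial>lborel)"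
proof -
  define K where "K = {(\<theta>, \<delta>). \<theta> \<in> {a..b} \<and> \<delta> \<in> {0<..d} \<and> 2 * c * \<delta> < integral {\<theta> - \<delta>..\<theta> + \<delta>} u}"
  have K: "\<And>i. i \<in> K \<Longrightarrow> 0 < snd i \<and> snd i \<le> d" by (auto simp: K_def)
  have cover: "fst ` K \<subseteq> (\<Union>i\<in>K. cball (fst i) (snd i))" using K by (force simp: less_imp_le)
  obtain C where C: "countable C" "C \<subseteq> K"
    "pairwise (\<lambda>i j. disjnt (cball (fst i) (snd i)) (cball (fst j) (snd j))) C"
    "fst ` K \<subseteq> (\<Union>i\<in>C. cball (fst i) (5 * snd i))"
    using Vitali_covering_lemma_cballs[OF cover K] by blast
  define V where "V = (\<Union>i\<in>C. cball (fst i) (5 * snd i))"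
  have [measurable]: "(\<lambda>t. ennreal (u t)) \<in> borel_measurable lborel"
    using borel_measurable_continuous_onI[OF cont] by simp
  define N where "N = density lborel (\<lambda>t. ennreal (u t))"
  have N: "emeasure N S = (\<integral>\<^sup>+ t. ennreal (u t) * indicator S t \<partial>lborel)" if "S \<in> sets borel" for S
    unfolding N_def using that by (intro emeasure_density) auto
  have large: "emeasure lborel (cball (fst i) (5 * snd i)) \<le> ennreal (5 / c) * emeasure N (cball (fst i) (snd i))"
    if "i \<in> C" for i
  proof -
    have i: "0 < snd i" "2 * c * snd i < integral {fst i - snd i..fst i + snd i} u"
      using that C(2) by (auto simp: K_def)
    have si: "set_integrable lborel {fst i - snd i..fst i + snd i} u"
      by (intro borel_integrable_atLeastAtMost' continuous_on_subset[OF cont]) auto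
    have "emeasure N (cball (fst i) (snd i)) = (\<integral>\<^sup>+ t. ennreal (indicator {fst i - snd i..fst i + snd i} t *\<^sub>R u t) \<partial>lborel)"
      unfolding cball_eq_atLeastAtMost
      by (subst N) (auto intro!: nn_integral_cong simp: indicator_def)
    also have "\<dots> = ennreal (\<integral>t. indicator {fst i - snd i..fst i + snd i} t *\<^sub>R u t \<partial>lborel)"
      using si nn by (intro nn_integral_eq_integral) (auto simp: set_integrable_def)
    also have "(\<integral>t. indicator {fst i - snd i..fst i + snd i} t *\<^sub>R u t \<partial>lborel) = integral {fst i - snd i..fst i + snd i} u"
      using set_borel_integral_eq_integral(2)[OF si] by (simp add: set_lebesgue_integral_def)
    finally have eq: "emeasure N (cball (fst i) (snd i)) = ennreal (integral {fst i - snd i..fst i + snd i} u)" .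
    have "emeasure lborel (cball (fst i) (5 * snd i)) = ennreal (10 * snd i)"
      using i(1) by (simp add: cball_eq_atLeastAtMost)
    also have "10 * snd i = 5 / c * (2 * c * snd i)" using c by simp
    also have "ennreal \<dots> \<le> ennreal (5 / c * integral {fst i - snd i..fst i + snd i} u)"
      using i c by (intro ennreal_leI mult_left_mono) auto
    also have "\<dots> = ennreal (5 / c) * emeasure N (cball (fst i) (snd i))"
      unfolding eq using c i by (intro ennreal_mult') simp
    finally show ?thesis .
  qed
  have "emeasure lborel V \<le> (\<integral>\<^sup>+ i. emeasure lborel (cball (fst i) (5 * snd i)) \<partial>count_space C)"
    unfolding V_def using C(1) by (intro emeasure_UN_countable_le) auto
  also have "\<dots> \<le> (\<integral>\<^sup>+ i. ennreal (5 / c) * emeasure N (cball (fst i) (snd i)) \<partial>count_space C)"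
    using large by (intro nn_integral_mono) auto
  also have "\<dots> = ennreal (5 / c) * (\<integral>\<^sup>+ i. emeasure N (cball (fst i) (snd i)) \<partial>count_space C)"
    by (intro nn_integral_cmult) auto
  also have "(\<integral>\<^sup>+ i. emeasure N (cball (fst i) (snd i)) \<partial>count_space C) = emeasure N (\<Union>i\<in>C. cball (fst i) (snd i))"
    using C(1,3) by (intro emeasure_UN_countable[symmetric])
      (auto simp: N_def disjoint_family_on_def pairwise_def disjnt_def)
  also have "\<dots> \<le> emeasure N {a - d..b + d}"
  proof (rule emeasure_mono)
    show "(\<Union>i\<in>C. cball (fst i) (snd i)) \<subseteq> {a - d..b + d}"
    proof (rule UN_least)
      fix i assume "i \<in> C"
      then have "fst i \<in> {a..b}" "snd i \<le> d" using C(2) by (auto simp: K_def)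
      then show "cball (fst i) (snd i) \<subseteq> {a - d..b + d}" unfolding cball_eq_atLeastAtMost by auto
    qed
  qed (simp add: N_def)
  also have "\<dots> = (\<integral>\<^sup>+ t. ennreal (u t) * indicator {a - d..b + d} t \<partial>lborel)" by (rule N) simp
  finally have "emeasure lborel V \<le> ennreal (5 / c) * (\<integral>\<^sup>+ t. ennreal (u t) * indicator {a - d..b + d} t \<partial>lborel)"
    by (simp add: mult_left_mono)
  moreover have "V \<in> sets lborel" unfolding V_def using C(1) by (intro sets.countable_UN') auto
  moreover have "\<theta> \<in> V" if "\<theta> \<in> {a..b}" "\<delta> \<in> {0<..d}" "2 * c * \<delta> < integral {\<theta> - \<delta>..\<theta> + \<delta>} u" for \<theta> \<delta>
  proof -
    have "(\<theta>, \<delta>) \<in> K" using that by (auto simp: K_def)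
    then have "\<theta> \<in> fst ` K" by force
    then show ?thesis using C(4) unfolding V_def by (rule subsetD[rotated])
  qed
  ultimately show thesis by (intro that)
qed

lemma radial_set_measurable:
  assumes "F holomorphic_on ball 0 1"
  shows "{\<zeta> \<in> sphere 0 1. \<exists>r\<in>{0..<1}. c < cmod (F (of_real r * \<zeta>))} \<in> sets circle_measure"
proof -
  have cont: "continuous_on (ball 0 1) (\<lambda>w. cmod (F w))"
    using holomorphic_on_imp_continuous_on[OF assms] by (rule continuous_on_norm)
  have op: "open (ball 0 1 \<inter> (\<lambda>w. cmod (F w)) -` {c<..})"
    by (rule continuous_open_preimage[OF cont]) auto
  have "open ((\<lambda>\<zeta>::complex. of_real r * \<zeta>) -` (ball 0 1 \<inter> (\<lambda>w. cmod (F w)) -` {c<..}))" for r :: real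
    by (rule open_vimage[OF op]) (intro continuous_intros)
  then have "open (\<Union>r\<in>{0..<1}. (\<lambda>\<zeta>::complex. of_real r * \<zeta>) -` (ball 0 1 \<inter> (\<lambda>w. cmod (F w)) -` {c<..}))"
    by (intro open_UN) auto
  moreover have "{\<zeta> \<in> sphere 0 1. \<exists>r\<in>{0..<1}. c < cmod (F (of_real r * \<zeta>))}
      = sphere 0 1 \<inter> (\<Union>r\<in>{0..<1}. (\<lambda>\<zeta>::complex. of_real r * \<zeta>) -` (ball 0 1 \<inter> (\<lambda>w. cmod (F w)) -` {c<..}))"
    by (auto simp: norm_mult)
  ultimately show ?thesis
    unfolding sets_circle_measure by (auto simp: sets_restrict_space)
qed

text \<open>The Hardy-Littlewood inequality transported to the circle. The arcs around points of \<open>[0, 2 \<pi>]\<close>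
  lie in \<open>[- \<pi>, 3 \<pi>]\<close>, which three periods cover; with the factor 5 of Vitali's lemma this gives the
  constant 15.\<close>

lemma radial_maximal_inequality:
  assumes F: "continuous_on (cball 0 1) F" "F holomorphic_on ball 0 1" and c: "0 < c"
  shows "emeasure circle_measure {\<zeta> \<in> sphere 0 1. \<exists>r\<in>{0..<1}. c < cmod (F (of_real r * \<zeta>))}
    \<le> ennreal (15 / c * (\<integral>\<zeta>. cmod (F \<zeta>) \<partial>circle_measure))" (is "emeasure _ ?M \<le> _")
proof -
  have contF: "continuous_on (sphere 0 1) F" using F(1) by (rule continuous_on_subset) auto
  define u where "u t = cmod (F (cis t))" for t
  have cont: "continuous_on UNIV u"
    unfolding u_def by (intro continuous_on_norm continuous_on_compose2[OF contF]) (auto intro!: continuous_intros)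
  have meas: "(\<lambda>t. ennreal (u t)) \<in> borel_measurable borel"
    using borel_measurable_continuous_onI[OF cont] by simp
  obtain V where V: "V \<in> sets lborel"
    "\<And>\<theta> \<delta>. \<theta> \<in> {0..2 * pi} \<Longrightarrow> \<delta> \<in> {0<..pi} \<Longrightarrow> 2 * c * \<delta> < integral {\<theta> - \<delta>..\<theta> + \<delta>} u \<Longrightarrow> \<theta> \<in> V"
    "emeasure lborel V \<le> ennreal (5 / c) * (\<integral>\<^sup>+ t. ennreal (u t) * indicator {0 - pi..2 * pi + pi} t \<partial>lborel)"
    using Hardy_Littlewood_line[OF cont _ c, of 0 "2 * pi" pi] by (auto simp: u_def)
  define J where "J = (\<integral>\<^sup>+ t. ennreal (u t) * indicator {0..2 * pi} t \<partial>lborel)"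
  have J: "ennreal (\<integral>\<zeta>. cmod (F \<zeta>) \<partial>circle_measure) = ennreal (1 / (2 * pi)) * J"
  proof -
    have "ennreal (\<integral>\<zeta>. cmod (F \<zeta>) \<partial>circle_measure) = (\<integral>\<^sup>+ \<zeta>. ennreal (cmod (F \<zeta>)) \<partial>circle_measure)"
      by (intro nn_integral_circle_continuous[symmetric] continuous_intros contF) auto
    also have "\<dots> = ennreal (1 / (2 * pi)) * J"
      unfolding J_def u_def
      by (intro nn_integral_circle measurable_compose[OF _ measurable_ennreal] continuous_imp_measurable_circle
          continuous_intros contF)
    finally show ?thesis .
  qed
  have shift: "(\<integral>\<^sup>+ t. ennreal (u t) * indicator {s..s + 2 * pi} t \<partial>lborel) = J"
    if "\<And>t. u (s + t) = u t" for s
  proof -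
    have "(\<integral>\<^sup>+ t. ennreal (u t) * indicator {s..s + 2 * pi} t \<partial>lborel)
        = (\<integral>\<^sup>+ t. ennreal (u (s + t)) * indicator {s..s + 2 * pi} (s + t) \<partial>lborel)"
      using nn_integral_real_affine[of "\<lambda>t. ennreal (u t) * indicator {s..s + 2 * pi} t" 1 s] meas by simp
    also have "\<dots> = J" unfolding J_def
      by (intro nn_integral_cong) (auto simp: that indicator_def)
    finally show ?thesis .
  qed
  have per: "u (2 * pi + t) = u t" "u (- (2 * pi) + t) = u t" for t
  proof -
    have "cis (2 * pi + t) = cis t" "cis (- (2 * pi) + t) = cis t"
      by (simp_all add: complex_eq_iff cos_add sin_add cos_diff sin_diff)
    then show "u (2 * pi + t) = u t" "u (- (2 * pi) + t) = u t" unfolding u_def by metis+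
  qed
  have "(\<integral>\<^sup>+ t. ennreal (u t) * indicator {0 - pi..2 * pi + pi} t \<partial>lborel)
    \<le> (\<integral>\<^sup>+ t. (ennreal (u t) * indicator {- (2 * pi)..- (2 * pi) + 2 * pi} t + ennreal (u t) * indicator {0..2 * pi} t)
        + ennreal (u t) * indicator {2 * pi..2 * pi + 2 * pi} t \<partial>lborel)"
    using pi_gt_zero by (intro nn_integral_mono) (auto simp: indicator_def)
  also have "\<dots> = (\<integral>\<^sup>+ t. ennreal (u t) * indicator {- (2 * pi)..- (2 * pi) + 2 * pi} t \<partial>lborel) + J
      + (\<integral>\<^sup>+ t. ennreal (u t) * indicator {2 * pi..2 * pi + 2 * pi} t \<partial>lborel)"
  proof -
    have m: "(\<lambda>t. ennreal (u t) * indicator {x..y} t) \<in> borel_measurable lborel" for x y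
      using meas by simp
    have "(\<lambda>t. ennreal (u t) * indicator {x..y} t + ennreal (u t) * indicator {x'..y'} t) \<in> borel_measurable lborel" for x y x' y'
      using meas by simp
    then show ?thesis unfolding J_def by (simp only: nn_integral_add[OF m m] nn_integral_add[OF _ m])
  qed
  also have "\<dots> = J + J + J" by (simp only: shift[OF per(2)] shift[OF per(1)])
  also have "\<dots> = 3 * J"
  proof -
    have "(3::ennreal) = 1 + 1 + 1" by simp
    then show ?thesis by (simp only: distrib_right mult_1)
  qed
  finally have J3: "(\<integral>\<^sup>+ t. ennreal (u t) * indicator {0 - pi..2 * pi + pi} t \<partial>lborel) \<le> 3 * J" .
  have M: "?M \<in> sets circle_measure" by (rule radial_set_measurable[OF F(2)])
  have "emeasure circle_measure ?M = (\<integral>\<^sup>+ \<zeta>. indicator ?M \<zeta> \<partial>circle_measure)"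
    using M by simp
  also have "\<dots> = ennreal (1 / (2 * pi)) * (\<integral>\<^sup>+ t. indicator ?M (cis t) * indicator {0..2 * pi} t \<partial>lborel)"
    using M by (intro nn_integral_circle) simp
  also have "\<dots> \<le> ennreal (1 / (2 * pi)) * (\<integral>\<^sup>+ t. indicator V t \<partial>lborel)"
  proof (intro mult_left_mono nn_integral_mono)
    fix t
    show "indicator ?M (cis t) * indicator {0..2 * pi} t \<le> (indicator V t :: ennreal)"
    proof (cases "t \<in> {0..2 * pi} \<and> cis t \<in> ?M")
      case True
      then obtain r where r: "0 \<le> r" "r < 1" "c < cmod (F (of_real r * cis t))" by auto
      obtain \<delta> where "\<delta> \<in> {0<..pi}" "2 * c * \<delta> < integral {t - \<delta>..t + \<delta>} u"
        using ex_large_mean[OF F r] unfolding u_def by blast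
      then have "t \<in> V" using True by (intro V(2)) auto
      then show ?thesis by (simp add: indicator_def)
    qed (auto simp: indicator_def)
  qed simp
  also have "\<dots> = ennreal (1 / (2 * pi)) * emeasure lborel V" using V(1) by simp
  also have "\<dots> \<le> ennreal (1 / (2 * pi)) * (ennreal (5 / c) * (3 * J))"
    by (intro mult_left_mono order_trans[OF V(3)] J3) auto
  also have "\<dots> = ennreal (15 / c) * (ennreal (1 / (2 * pi)) * J)"
  proof -
    have "ennreal (15 / c) = ennreal (5 / c) * 3" using c by (simp flip: ennreal_numeral ennreal_mult')
    then show ?thesis by (simp only: mult.assoc mult.left_commute)
  qed
  also have "\<dots> = ennreal (15 / c * (\<integral>\<zeta>. cmod (F \<zeta>) \<partial>circle_measure))"
    unfolding J[symmetric] using c by (intro ennreal_mult'[symmetric]) simp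
  finally show ?thesis .
qed

section \<open>Boundary values\<close>

text \<open>An exchange of limits: \<open>h\<close> is the uniform limit of the functions \<open>r \<mapsto> h (s j r)\<close>, each of which
  has a limit at 1.\<close>

lemma uniform_dilates_imp_radial_limit:
  fixes h :: "real \<Rightarrow> complex"
  assumes cont: "continuous_on {0..<1} h" and s: "\<And>j. 0 \<le> s j \<and> s j < (1::real)"
    and close: "\<And>j r. J \<le> j \<Longrightarrow> 0 \<le> r \<Longrightarrow> r < 1 \<Longrightarrow> cmod (h (s j * r) - h r) \<le> (1 / 2) ^ j"
  shows "\<exists>l. (h \<longlongrightarrow> l) (at_left 1)"
proof -
  have limj: "((\<lambda>r. h (s j * r)) \<longlongrightarrow> h (s j)) (at_left 1)" for j
  proof -
    have "((\<lambda>r. s j * r) \<longlongrightarrow> s j * 1) (at_left 1)" by (intro tendsto_intros)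
    moreover have "eventually (\<lambda>r. s j * r \<in> {0..<1}) (at_left 1)"
      using eventually_at_left_real[of 0 1] s[of j]
      by (auto elim!: eventually_mono intro: le_less_trans[OF mult_left_le])
    ultimately show ?thesis
      using cont s[of j] by (intro continuous_on_tendsto_compose[OF cont]) auto
  qed
  have "Cauchy (\<lambda>j. h (s (J + j)))"
  proof (rule metric_CauchyI)
    fix e :: real assume "0 < e"
    then obtain N where N: "(1 / 2) ^ N < e / 2" using real_arch_pow_inv[of "e / 2" "1 / 2"] by auto
    have "dist (h (s (J + m))) (h (s (J + n))) < e" if "N \<le> m" "N \<le> n" for m n
    proof -
      have "cmod (h (s (J + m)) - h (s (J + n))) \<le> (1 / 2) ^ N + (1 / 2) ^ N"
      proof (rule tendsto_upperbound)
        show "((\<lambda>r. cmod (h (s (J + m) * r) - h (s (J + n) * r))) \<longlongrightarrow> cmod (h (s (J + m)) - h (s (J + n)))) (at_left 1)"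
          by (intro tendsto_intros limj)
        have "cmod (h (s (J + m) * r) - h (s (J + n) * r)) \<le> (1 / 2) ^ N + (1 / 2) ^ N" if "0 \<le> r" "r < 1" for r
        proof -
          have "cmod (h (s (J + m) * r) - h r) \<le> (1 / 2) ^ N" "cmod (h (s (J + n) * r) - h r) \<le> (1 / 2) ^ N"
            using \<open>N \<le> m\<close> \<open>N \<le> n\<close>
            by (auto intro!: order_trans[OF close[OF _ that]] power_decreasing)
          then show ?thesis
            using norm_triangle_ineq4[of "h (s (J + m) * r) - h r" "h (s (J + n) * r) - h r"] by simp
        qed
        then show "\<forall>\<^sub>F r in at_left 1. cmod (h (s (J + m) * r) - h (s (J + n) * r)) \<le> (1 / 2) ^ N + (1 / 2) ^ N"
          using eventually_at_left_real[of 0 1] by (auto elim!: eventually_mono)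
      qed simp
      then show ?thesis using N by (simp add: dist_norm)
    qed
    then show "\<exists>M. \<forall>m\<ge>M. \<forall>n\<ge>M. dist (h (s (J + m))) (h (s (J + n))) < e" by blast
  qed
  then obtain l where l: "(\<lambda>j. h (s (J + j))) \<longlonglongrightarrow> l"
    using Cauchy_convergent by (auto simp: convergent_def)
  have unif: "uniform_limit {0..<1} (\<lambda>j r. h (s (J + j) * r)) h sequentially"
  proof (rule uniform_limitI)
    fix e :: real assume "0 < e"
    have "(\<lambda>j. (1 / 2) ^ (J + j)) \<longlonglongrightarrow> (0::real)"
      by (intro LIMSEQ_ignore_initial_segment[of _ _ J, unfolded add.commute[of _ J]] LIMSEQ_realpow_zero) auto
    then have "\<forall>\<^sub>F j in sequentially. (1 / 2) ^ (J + j) < e" using \<open>0 < e\<close> by (rule order_tendstoD)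
    then show "\<forall>\<^sub>F j in sequentially. \<forall>r\<in>{0..<1}. dist (h (s (J + j) * r)) (h r) < e"
      by eventually_elim (auto simp: dist_norm intro: le_less_trans[OF close])
  qed
  have "(h \<longlongrightarrow> l) (at_left 1)"
  proof (rule swap_uniform_limit'[OF _ l unif])
    show "\<forall>\<^sub>F j in sequentially. ((\<lambda>r. h (s (J + j) * r)) \<longlongrightarrow> h (s (J + j))) (at_left 1)"
      by (simp add: limj)
    show "\<forall>\<^sub>F r in at_left 1. r \<in> {0..<1::real}"
      using eventually_at_left_real[of 0 "1::real"] by (auto elim!: eventually_mono)
  qed simp
  then show ?thesis ..
qed

lemma continuous_on_radius:
  assumes "f holomorphic_on ball 0 1" "\<zeta> \<in> sphere 0 1"
  shows "continuous_on {0..<1} (\<lambda>r. f (of_real r * \<zeta>))"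
proof (rule continuous_on_compose2[OF holomorphic_on_imp_continuous_on[OF assms(1)]])
  show "(\<lambda>r. of_real r * \<zeta>) ` {0..<1} \<subseteq> ball 0 1" using assms(2) by (auto simp: norm_mult)
qed (intro continuous_intros)

text \<open>The dilates are Cauchy in \<open>L\<^sup>1\<close>, so along a suitable sequence of radii \<open>s j\<close>
  the maximal inequality makes \<open>f (s j r \<zeta>)\<close> uniformly close to \<open>f (r \<zeta>)\<close> for \<open>r < 1\<close>, off a set
  of measure \<open>O(2^(-j))\<close>. Borel-Cantelli then gives, for almost every \<open>\<zeta>\<close>, uniform approximation of
  \<open>f\<close> on the radius by functions that are continuous up to its end.\<close>

lemma Fatou_radial_limits:
  assumes f: "f holomorphic_on ball 0 1"
    and C: "\<And>r. 0 \<le> r \<Longrightarrow> r < 1 \<Longrightarrow> (\<integral>\<zeta>. cmod (f (of_real r * \<zeta>)) \<partial>circle_measure) \<le> C"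
  shows "AE \<zeta> in circle_measure. \<exists>l. ((\<lambda>r. f (of_real r * \<zeta>)) \<longlongrightarrow> l) (at_left 1)"
proof -
  have "\<exists>\<sigma>. 0 \<le> \<sigma> \<and> \<sigma> < 1 \<and> (\<forall>s t. \<sigma> \<le> s \<and> s < 1 \<and> \<sigma> \<le> t \<and> t < 1 \<longrightarrow>
      (\<integral>\<zeta>. cmod (f (of_real s * \<zeta>) - f (of_real t * \<zeta>)) \<partial>circle_measure) \<le> (1 / 4) ^ j)" for j :: nat
  proof -
    have e: "0 < (1 / 4 :: real) ^ j" by simp
    obtain \<sigma> where "0 \<le> \<sigma>" "\<sigma> < 1"
      "\<And>s t. \<sigma> \<le> s \<Longrightarrow> s < 1 \<Longrightarrow> \<sigma> \<le> t \<Longrightarrow> t < 1 \<Longrightarrow>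
        (\<integral>\<zeta>. cmod (f (of_real s * \<zeta>) - f (of_real t * \<zeta>)) \<partial>circle_measure) \<le> (1 / 4) ^ j"
      using Hardy_dilates_Cauchy[OF f C e] by blast
    then show ?thesis by blast
  qed
  then obtain \<sigma> where \<sigma>: "\<And>j. 0 \<le> \<sigma> j" "\<And>j. \<sigma> j < (1::real)"
    "\<And>j s t. \<sigma> j \<le> s \<Longrightarrow> s < 1 \<Longrightarrow> \<sigma> j \<le> t \<Longrightarrow> t < 1 \<Longrightarrow>
      (\<integral>\<zeta>. cmod (f (of_real s * \<zeta>) - f (of_real t * \<zeta>)) \<partial>circle_measure) \<le> (1 / 4) ^ j"
    by metis
  \<comment> \<open>With \<open>s\<^sup>2 = \<sigma>\<close>, both \<open>s t\<close> and \<open>t\<close> are at least \<open>\<sigma>\<close> for every \<open>t \<ge> s\<close>.\<close>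
  define s where "s j = sqrt (\<sigma> j)" for j
  have s: "0 \<le> s j" "s j < 1" "s j * s j = \<sigma> j" for j using \<sigma>(1,2)[of j] by (auto simp: s_def)
  \<comment> \<open>The maximal inequality applies to functions that are continuous up to the circle, so the radius
  is exhausted by the radii \<open>t j i < 1\<close>.\<close>
  define t where "t j i = max (s j) (1 - 1 / real (i + 2))" for j i
  have t: "s j \<le> t j i" "0 < t j i" "t j i < 1" "t j i \<le> t j (Suc i)" for j i
  proof -
    have "1 - 1 / real (i + 2) \<le> 1 - 1 / real (Suc i + 2)" by (simp add: field_simps)
    moreover have "0 < 1 - 1 / real (i + 2)" "1 - 1 / real (i + 2) < 1" by (auto simp: field_simps)
    ultimately show "s j \<le> t j i" "0 < t j i" "t j i < 1" "t j i \<le> t j (Suc i)"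
      using s(2)[of j] unfolding t_def by linarith+
  qed
  have tlim: "\<exists>i. r < t j i" if r: "r < 1" for r j
  proof -
    have "0 < 1 - r" using r by simp
    then obtain i where "inverse (real (Suc i)) < 1 - r" using reals_Archimedean by blast
    moreover have "1 / real (i + 2) \<le> inverse (real (Suc i))" by (simp add: field_simps)
    ultimately show ?thesis by (intro exI[of _ i]) (auto simp: t_def)
  qed
  define F where "F j i z = f (of_real (s j * t j i) * z) - f (of_real (t j i) * z)" for j i z
  define A where "A j i = {\<zeta> \<in> sphere 0 1. \<exists>r\<in>{0..<1}. (1 / 2) ^ j < cmod (F j i (of_real r * \<zeta>))}" for j i
  have in_ball: "of_real (c * t j i) * z \<in> ball 0 1" if "cmod z \<le> 1" "0 \<le> c" "c \<le> 1" for c z j i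
  proof -
    have "c * t j i * cmod z \<le> 1 * t j i * 1" using that t(2)[of j i] by (intro mult_mono) auto
    moreover have "cmod (of_real (c * t j i) * z) = c * t j i * cmod z"
      using that t(2)[of j i] by (simp add: norm_mult)
    ultimately have "cmod (of_real (c * t j i) * z) < 1" using t(3)[of j i] by linarith
    then show ?thesis by simp
  qed
  have cball_F: "continuous_on (cball 0 1) (F j i)" for j i
  proof -
    have "continuous_on (cball 0 1) (\<lambda>z. f (of_real (c * t j i) * z))" if "0 \<le> c" "c \<le> 1" for c
      by (rule continuous_on_compose2[OF holomorphic_on_imp_continuous_on[OF f]])
         (use in_ball that in \<open>auto intro!: continuous_intros simp del: of_real_mult\<close>)
    from this[of "s j"] this[of 1] show ?thesis
      unfolding F_def using s[of j] by (intro continuous_on_diff) auto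
  qed
  have hol_F: "F j i holomorphic_on ball 0 1" for j i
  proof -
    have "(\<lambda>z. f (of_real (c * t j i) * z)) holomorphic_on ball 0 1" if "0 \<le> c" "c \<le> 1" for c
      by (rule holomorphic_on_compose_gen[OF _ f, unfolded o_def])
         (use in_ball that in \<open>auto intro!: holomorphic_intros simp del: of_real_mult\<close>)
    from this[of "s j"] this[of 1] show ?thesis
      unfolding F_def using s[of j] by (intro holomorphic_on_diff) auto
  qed
  have A_sets: "A j i \<in> sets circle_measure" for j i
    unfolding A_def by (rule radial_set_measurable[OF hol_F])
  have A_le: "emeasure circle_measure (A j i) \<le> ennreal (15 * (1 / 2) ^ j)" for j i
  proof -
    have "s j * s j \<le> s j * t j i" using s(1) t(1) by (intro mult_left_mono)
    moreover have "s j * t j i < 1" using s(1,2)[of j] t(2,3)[of j i]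
      by (smt (verit) mult_less_cancel_left2 mult_left_le)
    moreover have "\<sigma> j \<le> t j i"
      using s(3)[of j] t(1)[of j i] s(1,2)[of j] mult_left_le[of "s j" "s j"] by auto
    ultimately have int: "(\<integral>\<zeta>. cmod (F j i \<zeta>) \<partial>circle_measure) \<le> (1 / 4) ^ j"
      unfolding F_def using s(3)[of j] t(3)[of j i] by (intro \<sigma>(3)) auto
    have "emeasure circle_measure (A j i) \<le> ennreal (15 / (1 / 2) ^ j * (\<integral>\<zeta>. cmod (F j i \<zeta>) \<partial>circle_measure))"
      unfolding A_def by (rule radial_maximal_inequality[OF cball_F hol_F]) simp
    also have "\<dots> \<le> ennreal (15 / (1 / 2) ^ j * (1 / 4) ^ j)"
      using int by (intro ennreal_leI mult_left_mono) auto
    also have "15 / (1 / 2) ^ j * (1 / 4) ^ j = 15 * (1 / 2 :: real) ^ j"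
      by (simp add: power_divide power_mult_distrib[symmetric] field_simps)
    finally show ?thesis .
  qed
  define D where "D j = (\<Union>i. A j i)" for j
  have D_sets: "D j \<in> sets circle_measure" for j unfolding D_def using A_sets by auto
  have D_le: "emeasure circle_measure (D j) \<le> ennreal (15 * (1 / 2) ^ j)" for j
  proof -
    have "A j i \<subseteq> A j (Suc i)" for i
    proof
      fix \<zeta> assume "\<zeta> \<in> A j i"
      then obtain r where r: "\<zeta> \<in> sphere 0 1" "0 \<le> r" "r < 1" "(1 / 2) ^ j < cmod (F j i (of_real r * \<zeta>))"
        by (auto simp: A_def)
      define r' where "r' = t j i / t j (Suc i) * r"
      have q: "0 \<le> t j i / t j (Suc i)" "t j i / t j (Suc i) \<le> 1"
        using t(2,4)[of j i] t(2)[of j "Suc i"] by (auto simp: divide_le_eq)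
      have "r' \<le> 1 * r" unfolding r'_def using q r by (intro mult_right_mono) auto
      moreover have "0 \<le> r'" unfolding r'_def by (rule mult_nonneg_nonneg[OF q(1) r(2)])
      ultimately have r': "0 \<le> r'" "r' < 1" using r(3) by linarith+
      have "t j (Suc i) * r' = t j i * r" using t(2)[of j "Suc i"] by (simp add: r'_def)
      then have "F j (Suc i) (of_real r' * \<zeta>) = F j i (of_real r * \<zeta>)"
        unfolding F_def by (metis (no_types, lifting) mult.assoc of_real_mult)
      then show "\<zeta> \<in> A j (Suc i)" using r r' by (auto simp: A_def intro!: bexI[of _ r'])
    qed
    then have "emeasure circle_measure (D j) = (SUP i. emeasure circle_measure (A j i))"
      unfolding D_def using A_sets by (intro SUP_emeasure_incseq[symmetric]) (auto intro: incseq_SucI)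
    also have "\<dots> \<le> ennreal (15 * (1 / 2) ^ j)" by (intro SUP_least A_le)
    finally show ?thesis .
  qed
  have "AE \<zeta> in circle_measure. eventually (\<lambda>j. \<zeta> \<in> space circle_measure - D j) sequentially"
  proof (rule borel_cantelli_AE1[OF D_sets])
    show "emeasure circle_measure (D j) < \<infinity>" for j
      using le_less_trans[OF D_le[of j] ennreal_less_top] by simp
    have le: "measure circle_measure (D j) \<le> 15 * (1 / 2) ^ j" for j
      unfolding measure_def
    proof (rule enn2real_leI)
      show "emeasure circle_measure (D j) \<le> ennreal (15 * (1 / 2) ^ j)" by (rule D_le)
    qed simp
    have "summable (\<lambda>j. 15 * (1 / 2 :: real) ^ j)" by (intro summable_mult summable_geometric) simp
    then show "summable (\<lambda>j. measure circle_measure (D j))"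
      by (rule summable_comparison_test'[where N=0]) (simp add: le)
  qed
  then show ?thesis
  proof (rule AE_mp, intro AE_I2 impI)
    fix \<zeta> assume "\<zeta> \<in> space circle_measure" and ev: "eventually (\<lambda>j. \<zeta> \<in> space circle_measure - D j) sequentially"
    then have \<zeta>: "\<zeta> \<in> sphere 0 1" by simp
    obtain J where J: "\<And>j. J \<le> j \<Longrightarrow> \<zeta> \<notin> D j" using ev by (auto simp: eventually_sequentially)
    have "cmod (f (of_real (s j * r) * \<zeta>) - f (of_real r * \<zeta>)) \<le> (1 / 2) ^ j"
      if j: "J \<le> j" and r: "0 \<le> r" "r < 1" for j r
    proof (rule ccontr)
      assume "\<not> ?thesis"
      then have gt: "(1 / 2) ^ j < cmod (f (of_real (s j * r) * \<zeta>) - f (of_real r * \<zeta>))" by simp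
      obtain i where i: "r < t j i" using tlim[OF r(2)] by blast
      have mem: "r / t j i \<in> {0..<1}" using i r t(2)[of j i] by auto
      have eq: "F j i (of_real (r / t j i) * \<zeta>) = f (of_real (s j * r) * \<zeta>) - f (of_real r * \<zeta>)"
      proof -
        have "of_real (s j * t j i) * (of_real (r / t j i) * \<zeta>) = of_real (s j * r) * \<zeta>"
          "of_real (t j i) * (of_real (r / t j i) * \<zeta>) = of_real r * \<zeta>"
          using t(2)[of j i] by auto
        then show ?thesis unfolding F_def by metis
      qed
      have "\<zeta> \<in> A j i"
        unfolding A_def by (intro CollectI conjI \<zeta> bexI[OF _ mem]) (simp only: eq gt)
      then show False using J[OF j] by (auto simp: D_def)
    qed
    then show "\<exists>l. ((\<lambda>r. f (of_real r * \<zeta>)) \<longlongrightarrow> l) (at_left 1)"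
      using s by (intro uniform_dilates_imp_radial_limit[OF continuous_on_radius[OF f \<zeta>], of s J]) auto
  qed
qed

lemma boundary_values_eq:
  assumes "((\<lambda>r. f (of_real r * \<zeta>)) \<longlongrightarrow> l) (at_left 1)"
  shows "boundary_values f \<zeta> = l"
proof -
  have "Lim (at_left 1) (\<lambda>r. f (of_real r * \<zeta>)) = l" by (rule tendsto_Lim[OF _ assms]) simp
  then show ?thesis using assms by (auto simp: boundary_values_def)
qed

lemma Hardy_space_1_means:
  assumes "f \<in> Hardy_space_1"
  obtains C where "f holomorphic_on ball 0 1"
    "\<And>r. 0 \<le> r \<Longrightarrow> r < 1 \<Longrightarrow> (\<integral>\<zeta>. cmod (f (of_real r * \<zeta>)) \<partial>circle_measure) \<le> C"
proof -
  define S where "S = (SUP r\<in>{0..<1}. \<integral>\<^sup>+ \<zeta>. ennreal (cmod (f (complex_of_real r * \<zeta>))) \<partial>circle_measure)"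
  have f: "f holomorphic_on ball 0 1" and S: "S < \<infinity>"
    using assms by (auto simp: Hardy_space_1_def analytic_on_disc_def S_def analytic_on_open)
  have "(\<integral>\<zeta>. cmod (f (of_real r * \<zeta>)) \<partial>circle_measure) \<le> enn2real S" if r: "0 \<le> r" "r < 1" for r
  proof -
    have "ennreal (\<integral>\<zeta>. cmod (f (of_real r * \<zeta>)) \<partial>circle_measure)
        = (\<integral>\<^sup>+ \<zeta>. ennreal (cmod (f (complex_of_real r * \<zeta>))) \<partial>circle_measure)"
      by (intro nn_integral_circle_continuous[symmetric] continuous_intros continuous_on_dilate f r) auto
    also have "\<dots> \<le> S" unfolding S_def using r by (intro SUP_upper) auto
    also have "S = ennreal (enn2real S)" using S by simp
    finally show ?thesis by (simp add: ennreal_le_iff)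
  qed
  then show thesis using f by (intro that)
qed

lemma boundary_values_tendsto:
  assumes "f \<in> Hardy_space_1"
  shows "AE \<zeta> in circle_measure. ((\<lambda>r. f (of_real r * \<zeta>)) \<longlongrightarrow> boundary_values f \<zeta>) (at_left 1)"
proof -
  obtain C where C: "f holomorphic_on ball 0 1"
    "\<And>r. 0 \<le> r \<Longrightarrow> r < 1 \<Longrightarrow> (\<integral>\<zeta>. cmod (f (of_real r * \<zeta>)) \<partial>circle_measure) \<le> C"
    using Hardy_space_1_means[OF assms] by blast
  have "AE \<zeta> in circle_measure. \<exists>l. ((\<lambda>r. f (of_real r * \<zeta>)) \<longlongrightarrow> l) (at_left 1)"
    by (rule Fatou_radial_limits[OF C(1)]) (rule C(2))
  then show ?thesis by eventually_elim (auto simp: boundary_values_eq)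
qed

text \<open>The dilates are Cauchy in \<open>L\<^sup>1\<close> and converge almost everywhere to the boundary values, hence also
  in \<open>L\<^sup>1\<close> by Fatou's lemma, and the Poisson formula passes from the dilates to \<open>f\<close>.\<close>

lemma Poisson_boundary_values:
  assumes f: "f \<in> Hardy_space_1" and meas: "boundary_values f \<in> borel_measurable circle_measure"
  shows "integrable circle_measure (boundary_values f)"
    and "z \<in> ball 0 1 \<Longrightarrow> (\<integral>\<zeta>. of_real (Poisson_kernel z \<zeta>) * boundary_values f \<zeta> \<partial>circle_measure) = f z"
proof -
  let ?b = "boundary_values f"
  obtain C where hol: "f holomorphic_on ball 0 1"
    and C: "\<And>r. 0 \<le> r \<Longrightarrow> r < 1 \<Longrightarrow> (\<integral>\<zeta>. cmod (f (of_real r * \<zeta>)) \<partial>circle_measure) \<le> C"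
    using Hardy_space_1_means[OF f] by blast
  define t where "t i = 1 - 1 / real (i + 2)" for i
  have t: "0 \<le> t i" "t i < 1" for i by (auto simp: t_def field_simps)
  have tlim: "t \<longlonglongrightarrow> 1" unfolding t_def by real_asymp
  then have tlim': "filterlim t (at_left 1) sequentially"
    using t less_imp_neq[OF t(2)] by (auto simp: filterlim_at)
  have cont: "continuous_on (sphere 0 1) (\<lambda>\<zeta>. f (of_real s * \<zeta>))" if "0 \<le> s" "s < 1" for s
    using that by (intro continuous_on_dilate hol)
  have close: "\<exists>\<sigma>. 0 \<le> \<sigma> \<and> \<sigma> < 1 \<and> (\<forall>s. \<sigma> \<le> s \<and> s < 1 \<longrightarrow>
      (\<integral>\<^sup>+ \<zeta>. ennreal (cmod (f (of_real s * \<zeta>) - ?b \<zeta>)) \<partial>circle_measure) \<le> ennreal e)" if e: "0 < e" for e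
  proof -
    obtain \<sigma> where \<sigma>: "0 \<le> \<sigma>" "\<sigma> < 1"
      "\<And>s t. \<sigma> \<le> s \<Longrightarrow> s < 1 \<Longrightarrow> \<sigma> \<le> t \<Longrightarrow> t < 1 \<Longrightarrow>
        (\<integral>\<zeta>. cmod (f (of_real s * \<zeta>) - f (of_real t * \<zeta>)) \<partial>circle_measure) \<le> e"
      using Hardy_dilates_Cauchy[OF hol C e] by blast
    have "(\<integral>\<^sup>+ \<zeta>. ennreal (cmod (f (of_real s * \<zeta>) - ?b \<zeta>)) \<partial>circle_measure) \<le> ennreal e"
      if s: "\<sigma> \<le> s" "s < 1" for s
    proof -
      have s0: "0 \<le> s" using s \<sigma> by simp
      have "(\<integral>\<^sup>+ \<zeta>. ennreal (cmod (f (of_real s * \<zeta>) - ?b \<zeta>)) \<partial>circle_measure)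
          = (\<integral>\<^sup>+ \<zeta>. liminf (\<lambda>i. ennreal (cmod (f (of_real s * \<zeta>) - f (of_real (t i) * \<zeta>)))) \<partial>circle_measure)"
      proof (rule nn_integral_cong_AE)
        show "AE \<zeta> in circle_measure. ennreal (cmod (f (of_real s * \<zeta>) - ?b \<zeta>))
            = liminf (\<lambda>i. ennreal (cmod (f (of_real s * \<zeta>) - f (of_real (t i) * \<zeta>))))"
          using boundary_values_tendsto[OF f]
        proof eventually_elim
          case (elim \<zeta>)
          have "(\<lambda>i. ennreal (cmod (f (of_real s * \<zeta>) - f (of_real (t i) * \<zeta>))))
              \<longlonglongrightarrow> ennreal (cmod (f (of_real s * \<zeta>) - ?b \<zeta>))"
            by (intro tendsto_ennrealI tendsto_intros filterlim_compose[OF elim tlim'])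
          then show ?case by (intro lim_imp_Liminf[symmetric]) auto
        qed
      qed
      also have "\<dots> \<le> liminf (\<lambda>i. \<integral>\<^sup>+ \<zeta>. ennreal (cmod (f (of_real s * \<zeta>) - f (of_real (t i) * \<zeta>))) \<partial>circle_measure)"
        by (intro nn_integral_liminf measurable_compose[OF _ measurable_ennreal]
            continuous_imp_measurable_circle continuous_intros cont t s s0)
      also have "\<dots> \<le> ennreal e"
      proof (rule Liminf_le)
        have "\<forall>\<^sub>F i in sequentially. \<sigma> < t i" using tlim \<sigma>(2) by (rule order_tendstoD)
        then show "\<forall>\<^sub>F i in sequentially. (\<integral>\<^sup>+ \<zeta>. ennreal (cmod (f (of_real s * \<zeta>) - f (of_real (t i) * \<zeta>))) \<partial>circle_measure) \<le> ennreal e"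
        proof eventually_elim
          case (elim i)
          have "(\<integral>\<^sup>+ \<zeta>. ennreal (cmod (f (of_real s * \<zeta>) - f (of_real (t i) * \<zeta>))) \<partial>circle_measure)
              = ennreal (\<integral>\<zeta>. cmod (f (of_real s * \<zeta>) - f (of_real (t i) * \<zeta>)) \<partial>circle_measure)"
            by (intro nn_integral_circle_continuous continuous_intros cont t s s0) auto
          also have "\<dots> \<le> ennreal e" using s elim t by (intro ennreal_leI \<sigma>(3)) auto
          finally show ?case .
        qed
      qed simp
      finally show ?thesis .
    qed
    then show ?thesis using \<sigma> by blast
  qed
  have int_diff: "integrable circle_measure (\<lambda>\<zeta>. f (of_real s * \<zeta>) - ?b \<zeta>)"
    if "(\<integral>\<^sup>+ \<zeta>. ennreal (cmod (f (of_real s * \<zeta>) - ?b \<zeta>)) \<partial>circle_measure) \<le> ennreal e" "0 \<le> s" "s < 1" for s e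
    using that meas
    by (intro integrableI_bounded borel_measurable_diff continuous_imp_measurable_circle[OF cont])
       (auto intro: le_less_trans)
  show int: "integrable circle_measure ?b"
  proof -
    obtain \<sigma> where \<sigma>: "0 \<le> \<sigma>" "\<sigma> < 1"
      "(\<integral>\<^sup>+ \<zeta>. ennreal (cmod (f (of_real \<sigma> * \<zeta>) - ?b \<zeta>)) \<partial>circle_measure) \<le> ennreal 1"
      using close[of 1] by auto
    have "integrable circle_measure (\<lambda>\<zeta>. f (of_real \<sigma> * \<zeta>) - (f (of_real \<sigma> * \<zeta>) - ?b \<zeta>))"
      using \<sigma> by (intro Bochner_Integration.integrable_diff int_diff integral_circle(1) cont)
    then show ?thesis by simp
  qed
  assume z: "z \<in> ball 0 1"
  note intP = integrable_Poisson_mult[OF z]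
  show "(\<integral>\<zeta>. of_real (Poisson_kernel z \<zeta>) * ?b \<zeta> \<partial>circle_measure) = f z"
  proof (rule LIMSEQ_unique)
    show "(\<lambda>i. f (of_real (t i) * z)) \<longlonglongrightarrow> f z" by (rule dilates_tendsto[OF hol z tlim])
    show "(\<lambda>i. f (of_real (t i) * z)) \<longlonglongrightarrow> (\<integral>\<zeta>. of_real (Poisson_kernel z \<zeta>) * ?b \<zeta> \<partial>circle_measure)"
    proof (rule LIMSEQ_I)
      fix e :: real assume e: "0 < e"
      define \<eta> where "\<eta> = e * (1 - cmod z) / 4"
      have \<eta>: "0 < \<eta>" using e z by (simp add: \<eta>_def)
      obtain \<sigma> where \<sigma>: "0 \<le> \<sigma>" "\<sigma> < 1" and le: "\<And>s. \<sigma> \<le> s \<Longrightarrow> s < 1 \<Longrightarrow>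
          (\<integral>\<^sup>+ \<zeta>. ennreal (cmod (f (of_real s * \<zeta>) - ?b \<zeta>)) \<partial>circle_measure) \<le> ennreal \<eta>"
        using close[OF \<eta>] by blast
      have "\<forall>\<^sub>F i in sequentially. \<sigma> < t i" using tlim \<sigma>(2) by (rule order_tendstoD)
      then obtain N where N: "\<And>i. N \<le> i \<Longrightarrow> \<sigma> < t i" by (auto simp: eventually_sequentially)
      have "cmod (f (of_real (t i) * z) - (\<integral>\<zeta>. of_real (Poisson_kernel z \<zeta>) * ?b \<zeta> \<partial>circle_measure)) < e"
        if i: "N \<le> i" for i
      proof -
        have le': "(\<integral>\<^sup>+ \<zeta>. ennreal (cmod (f (of_real (t i) * \<zeta>) - ?b \<zeta>)) \<partial>circle_measure) \<le> ennreal \<eta>"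
          using N[OF i] t[of i] by (intro le) auto
        have "0 < t i" using N[OF i] \<sigma> by simp
        have dil: "(\<lambda>w. f (of_real (t i) * w)) holomorphic_on ball 0 (1 / t i)"
          using \<open>0 < t i\<close> by (rule holomorphic_on_dilate[OF hol])
        have sub: "cball 0 1 \<subseteq> ball (0::complex) (1 / t i)"
        proof
          fix x :: complex assume "x \<in> cball 0 1"
          then have "cmod x * t i \<le> 1 * t i" using t[of i] by (intro mult_right_mono) auto
          then have "cmod x * t i < 1" using t[of i] by linarith
          then show "x \<in> ball 0 (1 / t i)" using \<open>0 < t i\<close> by (simp add: less_divide_eq)
        qed
        have "(\<integral>\<zeta>. of_real (Poisson_kernel z \<zeta>) * f (of_real (t i) * \<zeta>) \<partial>circle_measure) = f (of_real (t i) * z)"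
        proof (rule Poisson_formula[OF _ _ z])
          show "continuous_on (cball 0 1) (\<lambda>w. f (of_real (t i) * w))"
            using holomorphic_on_imp_continuous_on[OF dil] sub by (rule continuous_on_subset)
          show "(\<lambda>w. f (of_real (t i) * w)) holomorphic_on ball 0 1"
            using dil by (rule holomorphic_on_subset) (use sub in \<open>auto simp: subset_eq\<close>)
        qed
        then have "f (of_real (t i) * z) - (\<integral>\<zeta>. of_real (Poisson_kernel z \<zeta>) * ?b \<zeta> \<partial>circle_measure)
            = (\<integral>\<zeta>. of_real (Poisson_kernel z \<zeta>) * (f (of_real (t i) * \<zeta>) - ?b \<zeta>) \<partial>circle_measure)"
          unfolding right_diff_distrib
          using intP[OF int] intP[OF integral_circle(1)[OF cont[OF t]], of i]
          by (subst Bochner_Integration.integral_diff) auto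
        also have "cmod \<dots> \<le> (\<integral>\<zeta>. cmod (of_real (Poisson_kernel z \<zeta>) * (f (of_real (t i) * \<zeta>) - ?b \<zeta>)) \<partial>circle_measure)"
          by (rule integral_norm_bound)
        also have "\<dots> \<le> (\<integral>\<zeta>. 2 / (1 - cmod z) * cmod (f (of_real (t i) * \<zeta>) - ?b \<zeta>) \<partial>circle_measure)"
        proof (rule integral_mono)
          fix \<zeta> assume "\<zeta> \<in> space circle_measure"
          then show "cmod (of_real (Poisson_kernel z \<zeta>) * (f (of_real (t i) * \<zeta>) - ?b \<zeta>))
              \<le> 2 / (1 - cmod z) * cmod (f (of_real (t i) * \<zeta>) - ?b \<zeta>)"
            unfolding norm_mult norm_of_real using Poisson_kernel_le[OF z, of \<zeta>] Poisson_kernel_nonneg[OF z, of \<zeta>]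
            by (intro mult_right_mono) auto
        qed (use intP[OF int_diff[OF le' t]] int_diff[OF le' t] in auto)
        also have "\<dots> = 2 / (1 - cmod z) * (\<integral>\<zeta>. cmod (f (of_real (t i) * \<zeta>) - ?b \<zeta>) \<partial>circle_measure)"
          by (rule integral_mult_right_zero)
        also have "\<dots> \<le> 2 / (1 - cmod z) * \<eta>"
        proof -
          have "ennreal (\<integral>\<zeta>. cmod (f (of_real (t i) * \<zeta>) - ?b \<zeta>) \<partial>circle_measure) \<le> ennreal \<eta>"
            using le' int_diff[OF le' t] by (subst nn_integral_eq_integral[symmetric]) auto
          then show ?thesis using \<eta> z by (intro mult_left_mono) (auto simp: ennreal_le_iff)
        qed
        also have "\<dots> < e" using e z by (simp add: \<eta>_def)
        finally show ?thesis .
      qed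
      then show "\<exists>N. \<forall>i\<ge>N. norm (f (of_real (t i) * z) - (\<integral>\<zeta>. of_real (Poisson_kernel z \<zeta>) * ?b \<zeta> \<partial>circle_measure)) < e"
        by blast
    qed
  qed
qed

section \<open>Estimates for the Bergman-Orlicz norm\<close>

context orlicz
begin

text \<open>The Poisson kernel is the density of a probability measure on the circle.\<close>

lemma Poisson_Jensen:
  assumes z: "z \<in> ball 0 1" and b: "integrable circle_measure (b :: complex \<Rightarrow> complex)"
  shows "ennreal (\<Psi> (cmod (\<integral>\<zeta>. of_real (Poisson_kernel z \<zeta>) * b \<zeta> \<partial>circle_measure)))
    \<le> (\<integral>\<^sup>+ \<zeta>. ennreal (Poisson_kernel z \<zeta>) * ennreal (\<Psi> (cmod (b \<zeta>))) \<partial>circle_measure)"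
proof (cases "(\<integral>\<^sup>+ \<zeta>. ennreal (Poisson_kernel z \<zeta>) * ennreal (\<Psi> (cmod (b \<zeta>))) \<partial>circle_measure) = \<infinity>")
  case False
  have P[measurable]: "Poisson_kernel z \<in> borel_measurable circle_measure"
    by (rule continuous_imp_measurable_circle[OF continuous_Poisson_kernel[OF z]])
  have P0: "0 \<le> Poisson_kernel z \<zeta>" for \<zeta> by (rule Poisson_kernel_nonneg[OF z])
  have bm[measurable]: "b \<in> borel_measurable circle_measure" using b by simp
  have psi[measurable]: "(\<lambda>\<zeta>. \<Psi> \<bar>cmod (b \<zeta>)\<bar>) \<in> borel_measurable circle_measure"
    by (intro measurable_Psi) auto
  define N where "N = density circle_measure (\<lambda>\<zeta>. ennreal (Poisson_kernel z \<zeta>))"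
  interpret N: prob_space N
  proof (rule prob_spaceI)
    have "emeasure N (space circle_measure)
        = (\<integral>\<^sup>+ \<zeta>. ennreal (Poisson_kernel z \<zeta>) * indicator (space circle_measure) \<zeta> \<partial>circle_measure)"
      unfolding N_def by (rule emeasure_density) measurable
    also have "\<dots> = (\<integral>\<^sup>+ \<zeta>. ennreal (Poisson_kernel z \<zeta>) \<partial>circle_measure)"
      by (intro nn_integral_cong) simp
    finally show "emeasure N (space N) = 1"
      using Poisson_kernel_integral(2)[OF z] by (simp add: N_def)
  qed
  have int1: "integrable circle_measure (\<lambda>\<zeta>. Poisson_kernel z \<zeta> * cmod (b \<zeta>))"
    using integrable_norm[OF integrable_Poisson_mult[OF z b]] P0 by (simp only: norm_mult norm_of_real abs_of_nonneg)
  have int2: "integrable circle_measure (\<lambda>\<zeta>. Poisson_kernel z \<zeta> * \<Psi> \<bar>cmod (b \<zeta>)\<bar>)"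
  proof (rule integrableI_bounded)
    have "(\<integral>\<^sup>+ \<zeta>. ennreal (norm (Poisson_kernel z \<zeta> * \<Psi> \<bar>cmod (b \<zeta>)\<bar>)) \<partial>circle_measure)
        = (\<integral>\<^sup>+ \<zeta>. ennreal (Poisson_kernel z \<zeta>) * ennreal (\<Psi> (cmod (b \<zeta>))) \<partial>circle_measure)"
      by (intro nn_integral_cong) (simp add: abs_mult P0 nonneg ennreal_mult')
    then show "(\<integral>\<^sup>+ \<zeta>. ennreal (norm (Poisson_kernel z \<zeta> * \<Psi> \<bar>cmod (b \<zeta>)\<bar>)) \<partial>circle_measure) < \<infinity>"
      using False by (simp add: less_top)
  qed measurable
  have N_int: "integrable N g \<longleftrightarrow> integrable circle_measure (\<lambda>\<zeta>. Poisson_kernel z \<zeta> * g \<zeta>)"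
    "integral\<^sup>L N g = (\<integral>\<zeta>. Poisson_kernel z \<zeta> * g \<zeta> \<partial>circle_measure)"
    if "g \<in> borel_measurable circle_measure" for g :: "complex \<Rightarrow> real"
    unfolding N_def
    using integrable_density[OF that P, of] integral_density[OF that P] P0 by simp_all
  have nb: "(\<lambda>\<zeta>. cmod (b \<zeta>)) \<in> borel_measurable circle_measure" by measurable
  have "\<Psi> \<bar>N.expectation (\<lambda>\<zeta>. cmod (b \<zeta>))\<bar> \<le> N.expectation (\<lambda>\<zeta>. \<Psi> \<bar>cmod (b \<zeta>)\<bar>)"
  proof (rule N.jensens_inequality[where I=UNIV and q="\<lambda>x. \<Psi> \<bar>x\<bar>"])
    show "integrable N (\<lambda>\<zeta>. cmod (b \<zeta>))" unfolding N_int(1)[OF nb] by (rule int1)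
    show "integrable N (\<lambda>\<zeta>. \<Psi> \<bar>cmod (b \<zeta>)\<bar>)" unfolding N_int(1)[OF psi] by (rule int2)
  qed (simp_all add: convex_abs)
  then have J: "\<Psi> \<bar>\<integral>\<zeta>. Poisson_kernel z \<zeta> * cmod (b \<zeta>) \<partial>circle_measure\<bar>
      \<le> (\<integral>\<zeta>. Poisson_kernel z \<zeta> * \<Psi> \<bar>cmod (b \<zeta>)\<bar> \<partial>circle_measure)"
    unfolding N_int(2)[OF nb] N_int(2)[OF psi] .
  have "cmod (\<integral>\<zeta>. of_real (Poisson_kernel z \<zeta>) * b \<zeta> \<partial>circle_measure)
      \<le> (\<integral>\<zeta>. cmod (of_real (Poisson_kernel z \<zeta>) * b \<zeta>) \<partial>circle_measure)"
    by (rule integral_norm_bound)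
  also have "\<dots> = (\<integral>\<zeta>. Poisson_kernel z \<zeta> * cmod (b \<zeta>) \<partial>circle_measure)"
    using P0 by (simp add: norm_mult)
  finally have "\<Psi> (cmod (\<integral>\<zeta>. of_real (Poisson_kernel z \<zeta>) * b \<zeta> \<partial>circle_measure))
      \<le> \<Psi> \<bar>\<integral>\<zeta>. Poisson_kernel z \<zeta> * cmod (b \<zeta>) \<partial>circle_measure\<bar>"
    by (intro mono) auto
  also note J
  finally have "ennreal (\<Psi> (cmod (\<integral>\<zeta>. of_real (Poisson_kernel z \<zeta>) * b \<zeta> \<partial>circle_measure)))
      \<le> ennreal (\<integral>\<zeta>. Poisson_kernel z \<zeta> * \<Psi> \<bar>cmod (b \<zeta>)\<bar> \<partial>circle_measure)"
    by (rule ennreal_leI)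
  also have "\<dots> = (\<integral>\<^sup>+ \<zeta>. ennreal (Poisson_kernel z \<zeta> * \<Psi> \<bar>cmod (b \<zeta>)\<bar>) \<partial>circle_measure)"
    using int2 P0 nonneg by (intro nn_integral_eq_integral[symmetric]) auto
  also have "\<dots> = (\<integral>\<^sup>+ \<zeta>. ennreal (Poisson_kernel z \<zeta>) * ennreal (\<Psi> (cmod (b \<zeta>))) \<partial>circle_measure)"
    using P0 by (simp add: ennreal_mult')
  finally show ?thesis .
qed simp

text \<open>Jensen's inequality at the centre of every concentric circle, averaged over the disc.\<close>

lemma area_sub_mean_value:
  assumes F: "F holomorphic_on ball 0 1" and C: "0 < C"
  shows "ennreal (\<Psi> (cmod (F 0) / C)) \<le> (\<integral>\<^sup>+ z. ennreal (\<Psi> (cmod (F z) / C)) \<partial>disc_measure)"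
proof -
  have meas: "(\<lambda>z. ennreal (\<Psi> (cmod (F z) / C))) \<in> borel_measurable disc_measure"
    using C by (intro measurable_modular continuous_imp_measurable_disc holomorphic_on_imp_continuous_on F) auto
  have "ennreal (\<Psi> (cmod (F 0) / C)) = (\<integral>\<^sup>+ z. ennreal (\<Psi> (cmod (F 0) / C)) \<partial>disc_measure)"
    using disc.emeasure_space_1 by simp
  also have "\<dots> \<le> (\<integral>\<^sup>+ z. (\<integral>\<^sup>+ \<zeta>. ennreal (\<Psi> (cmod (F (\<zeta> * z)) / C)) \<partial>circle_measure) \<partial>disc_measure)"
  proof (rule nn_integral_mono)
    fix z assume "z \<in> space disc_measure"
    then have z: "cmod z < 1" by simp
    have inb: "w * z \<in> ball 0 1" if "w \<in> cball 0 1" for w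
    proof -
      have "cmod w * cmod z \<le> 1 * cmod z" using that by (intro mult_right_mono) auto
      then show ?thesis using z by (simp add: norm_mult)
    qed
    have cont: "continuous_on (cball 0 1) (\<lambda>w. F (w * z) / of_real C)"
      by (intro continuous_on_divide continuous_on_compose2[OF holomorphic_on_imp_continuous_on[OF F]] continuous_intros)
         (use inb C in auto)
    have hol: "(\<lambda>w. F (w * z) / of_real C) holomorphic_on ball 0 1"
    proof -
      have "(\<lambda>w. F (w * z)) holomorphic_on ball 0 1"
        by (rule holomorphic_on_compose_gen[OF _ F, unfolded o_def]) (use inb in \<open>auto intro!: holomorphic_intros\<close>)
      then show ?thesis using C by (intro holomorphic_intros) auto
    qed
    have "integrable circle_measure (\<lambda>\<zeta>. F (\<zeta> * z) / of_real C)"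
      by (intro integral_circle(1) continuous_on_subset[OF cont]) auto
    from Poisson_Jensen[OF _ this, of 0]
    have "ennreal (\<Psi> (cmod (\<integral>\<zeta>. of_real (Poisson_kernel 0 \<zeta>) * (F (\<zeta> * z) / of_real C) \<partial>circle_measure)))
        \<le> (\<integral>\<^sup>+ \<zeta>. ennreal (Poisson_kernel 0 \<zeta>) * ennreal (\<Psi> (cmod (F (\<zeta> * z) / of_real C))) \<partial>circle_measure)"
      by simp
    also have "(\<integral>\<zeta>. of_real (Poisson_kernel 0 \<zeta>) * (F (\<zeta> * z) / of_real C) \<partial>circle_measure) = F 0 / of_real C"
      using Poisson_formula[OF cont hol, of 0] by simp
    also have "(\<integral>\<^sup>+ \<zeta>. ennreal (Poisson_kernel 0 \<zeta>) * ennreal (\<Psi> (cmod (F (\<zeta> * z) / of_real C))) \<partial>circle_measure)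
        = (\<integral>\<^sup>+ \<zeta>. ennreal (\<Psi> (cmod (F (\<zeta> * z)) / C)) \<partial>circle_measure)"
      using C by (intro nn_integral_cong) (auto simp: Poisson_kernel_def norm_divide)
    finally show "ennreal (\<Psi> (cmod (F 0) / C)) \<le> (\<integral>\<^sup>+ \<zeta>. ennreal (\<Psi> (cmod (F (\<zeta> * z)) / C)) \<partial>circle_measure)"
      using C by (simp add: norm_divide)
  qed
  also have "\<dots> = (\<integral>\<^sup>+ z. ennreal (\<Psi> (cmod (F z) / C)) \<partial>disc_measure)"
    by (rule nn_integral_disc_circle_means[OF meas, symmetric])
  finally show ?thesis .
qed

lemma Bergman_Orlicz_D:
  assumes "h \<in> Bergman_Orlicz \<Psi>"
  shows "h holomorphic_on ball 0 1" "h \<in> Orlicz_space \<Psi> disc_measure" "\<And>z. z \<notin> ball 0 1 \<Longrightarrow> h z = 0"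
  using assms by (auto simp: Bergman_Orlicz_def analytic_on_disc_def analytic_on_open)

text \<open>The sub-mean value property on the disc of radius \<open>\<delta>\<close> around \<open>a\<close>, whose normalized area is
  \<open>\<delta>\<^sup>2\<close>. The bound is stated through any \<open>Y\<close> with \<open>1 / \<delta>\<^sup>2 \<le> \<Psi> Y\<close> in place of an inverse of \<open>\<Psi>\<close>.\<close>

lemma Bergman_Orlicz_evaluation:
  assumes h: "h \<in> Bergman_Orlicz \<Psi>" and \<delta>: "0 < \<delta>" "cmod a + \<delta> \<le> 1" and Y: "0 < Y" "1 / \<delta>\<^sup>2 \<le> \<Psi> Y"
  shows "cmod (h a) \<le> Y * Bergman_Orlicz_norm \<Psi> h"
proof -
  note h' = Bergman_Orlicz_D[OF h]
  have "cmod (h a) / Y \<le> C" if less: "Luxemburg_norm \<Psi> disc_measure h < C" for C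
  proof -
    note C = Luxemburg_less[OF h'(2) less]
    note inb = affine_in_disc[OF \<delta>]
    have "(\<lambda>z. h (a + of_real \<delta> * z)) holomorphic_on ball 0 1"
      by (rule holomorphic_on_compose_gen[OF _ h'(1), unfolded o_def]) (use inb in \<open>auto intro!: holomorphic_intros\<close>)
    from area_sub_mean_value[OF this C(1)]
    have "ennreal (\<Psi> (cmod (h a) / C)) \<le> (\<integral>\<^sup>+ z. ennreal (\<Psi> (cmod (h (a + of_real \<delta> * z)) / C)) \<partial>disc_measure)"
      by simp
    also have "\<dots> \<le> ennreal (1 / \<delta>\<^sup>2) * (\<integral>\<^sup>+ z. ennreal (\<Psi> (cmod (h z) / C)) \<partial>disc_measure)"
      using C(1) \<delta> h'(2) by (intro nn_integral_disc_affine measurable_modular) (auto simp: Orlicz_space_def)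
    also have "\<dots> \<le> ennreal (1 / \<delta>\<^sup>2) * 1" by (intro mult_left_mono C(2)) simp
    finally have "\<Psi> (cmod (h a) / C) \<le> 1 / \<delta>\<^sup>2" using \<delta> by (simp add: ennreal_le_iff)
    moreover have "0 < 1 / \<delta>\<^sup>2" using \<delta> by simp
    ultimately have "\<Psi> (cmod (h a) / C) \<le> \<Psi> Y" "0 < \<Psi> Y" using Y(2) by linarith+
    then have "cmod (h a) / C \<le> Y" by (rule reflects_le[OF _ _ less_imp_le[OF Y(1)]])
    then have "cmod (h a) \<le> C * Y" unfolding pos_divide_le_eq[OF C(1)] mult.commute[of C] .
    then show ?thesis by (rule mult_imp_div_pos_le[OF Y(1)])
  qed
  then have "cmod (h a) / Y \<le> Luxemburg_norm \<Psi> disc_measure h" by (rule dense_ge)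
  then show ?thesis
    unfolding Bergman_Orlicz_norm_def pos_divide_le_eq[OF Y(1)] mult.commute[of Y] .
qed

text \<open>The hypothesis on \<open>\<Psi>\<close> says that \<open>ln (\<Psi> (exp x))\<close> has increasing differences at the scale
  \<open>ln A\<close>, so its linear interpolation on a lattice of step \<open>ln A\<close> is convex. The lines through
  neighbouring lattice points are powers: they stay below \<open>\<Psi>\<close> up to the factor \<open>A\<close> in the
  argument, and at every point one of them is at least \<open>\<Psi> (x / A)\<close>.\<close>

lemma power_minorant:
  assumes A: "1 < A" and t0: "0 < t0" "0 < \<Psi> t0"
    and ratio: "mono_on {t0..} (\<lambda>x. \<Psi> (A * x) / \<Psi> x)" and x: "t0 \<le> x"
  obtains c s where "0 < c" "0 < s" "\<And>y. 0 \<le> y \<Longrightarrow> c * y powr s \<le> \<Psi> (A * max y t0)"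
    "\<Psi> (x / A) \<le> c * x powr s"
proof -
  define t where "t k = t0 * A ^ k" for k
  have t: "0 < t k" "t0 \<le> t k" "t (Suc k) = A * t k" for k
    using A t0 by (auto simp: t_def one_le_power)
  have tmono: "t i \<le> t j" if "i \<le> j" for i j
    using that A t0 by (auto simp: t_def intro: power_increasing)
  have psi: "0 < \<Psi> (t k)" for k using mono[of t0 "t k"] t[of k] t0 by linarith
  define q where "q k = \<Psi> (t (Suc k)) / \<Psi> (t k)" for k
  have q_mono: "q i \<le> q j" if "i \<le> j" for i j
    using ratio tmono[OF that] t(2) unfolding q_def t(3) mono_on_def by auto
  have q_ge: "A \<le> q k" for k
  proof -
    have "\<Psi> (t k) \<le> (1 / A) * \<Psi> (t (Suc k))"
      using scale[of "1 / A" "t (Suc k)"] A t[of k] by (simp add: t(3))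
    then show ?thesis using psi[of k] A by (simp add: q_def field_simps)
  qed
  have q0: "0 < q k" for k using q_ge[of k] A by linarith
  have psi_Suc: "\<Psi> (t (Suc k)) = q k * \<Psi> (t k)" for k using psi[of k] by (simp add: q_def)
  \<comment> \<open>The quotients \<open>q\<close> increase, so the power through the points \<open>t k\<close> and \<open>t (k + 1)\<close> is a minorant
  at all later lattice points, and likewise at all earlier ones.\<close>
  have up: "\<Psi> (t k) * q k ^ m \<le> \<Psi> (t (k + m))" for k m
  proof (induction m)
    case (Suc m)
    have "\<Psi> (t k) * q k ^ Suc m = q k * (\<Psi> (t k) * q k ^ m)" by simp
    also have "\<dots> \<le> q (k + m) * \<Psi> (t (k + m))"
      using Suc q0[of k] q0[of "k + m"] psi[of k] by (intro mult_mono q_mono) (auto intro: less_imp_le)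
    finally show ?case by (simp add: psi_Suc)
  qed simp
  have down: "\<Psi> (t (i + m)) \<le> \<Psi> (t i) * q (i + m) ^ m" for i m
  proof (induction m)
    case (Suc m)
    have "\<Psi> (t (i + Suc m)) = q (i + m) * \<Psi> (t (i + m))" by (simp add: psi_Suc)
    also have "\<dots> \<le> q (i + Suc m) * (\<Psi> (t i) * q (i + Suc m) ^ m)"
    proof (intro mult_mono)
      show "\<Psi> (t (i + m)) \<le> \<Psi> (t i) * q (i + Suc m) ^ m"
        using q0[of "i + m"] psi[of i]
        by (intro order_trans[OF Suc] mult_left_mono power_mono q_mono) (auto intro: less_imp_le)
    qed (use q0 psi in \<open>auto intro: less_imp_le q_mono\<close>)
    finally show ?case by (simp add: mult_ac)
  qed simp
  have bracket: "\<exists>j. t j \<le> y \<and> y < t (Suc j)" if "t0 \<le> y" for y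
  proof -
    obtain n where "y / t0 < A ^ n" using real_arch_pow[OF A] by blast
    then have "y < t n" using t0 by (simp add: t_def field_simps)
    moreover have "\<not> y < t 0" using that by (simp add: t_def)
    ultimately show ?thesis using ex_least_nat_less[of "\<lambda>n. y < t n" n]
      by (metis Suc_eq_plus1 linorder_not_le order_refl)
  qed
  obtain k where k: "t k \<le> x" "x < t (Suc k)" using bracket[OF x] by blast
  define s where "s = log A (q k)"
  define c where "c = \<Psi> (t k) / t k powr s"
  have s: "0 < s" unfolding s_def using A q_ge[of k] by (subst zero_less_log_cancel_iff) auto
  have c: "0 < c" using psi[of k] t(1)[of k] by (simp add: c_def)
  have As: "A powr s = q k" using A q0[of k] by (simp add: s_def)
  have Am: "(A ^ m) powr s = q k ^ m" for m
  proof -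
    have "(A ^ m) powr s = (A powr real m) powr s" using A by (simp add: powr_realpow)
    also have "\<dots> = (A powr s) powr real m" by (simp add: powr_powr mult.commute)
    also have "\<dots> = q k ^ m" unfolding As using q0[of k] by (simp add: powr_realpow)
    finally show ?thesis .
  qed
  have lattice: "c * t i powr s \<le> \<Psi> (t i)" for i
  proof (cases "k \<le> i")
    case True
    define m where "m = i - k"
    have i: "i = k + m" using True by (simp add: m_def)
    have "t i = t k * A ^ m" by (simp add: i t_def power_add)
    then have "t i powr s = t k powr s * q k ^ m"
      using t(1)[of k] A by (simp add: powr_mult Am)
    then have "c * t i powr s = \<Psi> (t k) * q k ^ m"
      using t(1)[of k] by (simp add: c_def)
    also have "\<dots> \<le> \<Psi> (t i)" unfolding i by (rule up)
    finally show ?thesis .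
  next
    case False
    define m where "m = k - i"
    have m: "k = i + m" using False by (simp add: m_def)
    have "t k = t i * A ^ m" by (simp add: m t_def power_add)
    then have tk: "t k powr s = t i powr s * q k ^ m"
      using t(1)[of i] A by (simp add: powr_mult Am)
    have "c * t i powr s = \<Psi> (t k) / q k ^ m"
      using t(1)[of i] q0[of k] by (simp add: c_def tk)
    also have "\<dots> \<le> \<Psi> (t i)" using down[of i m] q0[of k] by (simp add: m[symmetric] divide_le_eq)
    finally show ?thesis .
  qed
  have "c * y powr s \<le> \<Psi> (A * max y t0)" if y: "0 \<le> y" for y
  proof -
    obtain j where j: "t j \<le> max y t0" "max y t0 < t (Suc j)" using bracket[of "max y t0"] by auto
    have "c * y powr s \<le> c * t (Suc j) powr s"
      using j c s y by (intro mult_left_mono powr_mono2) auto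
    also have "\<dots> \<le> \<Psi> (t (Suc j))" by (rule lattice)
    also have "\<dots> \<le> \<Psi> (A * max y t0)"
      using j A t[of j] by (intro mono) (auto simp: t(3) intro!: mult_left_mono)
    finally show ?thesis .
  qed
  moreover have "\<Psi> (x / A) \<le> c * x powr s"
  proof -
    have "\<Psi> (x / A) \<le> \<Psi> (t k)" using k A t(1)[of k] x t0 by (intro mono) (auto simp: t(3) field_simps)
    also have "\<dots> = c * t k powr s" using t(1)[of k] by (simp add: c_def)
    also have "\<dots> \<le> c * x powr s" using k c s t(1)[of k] by (intro mult_left_mono powr_mono2) auto
    finally show ?thesis .
  qed
  ultimately show thesis using c s by (intro that)
qed

text \<open>An outer function \<open>exp p\<close> that dominates \<open>\<Psi> (A max \<bar>h\<bar> t0)\<close> on the circle dominates each of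
  the powers of \<open>\<bar>h\<bar>\<close> there, hence in the disc by the maximum principle. So \<open>\<Psi> (\<bar>h\<bar> / A)\<close> is
  dominated in the disc by the modulus of a holomorphic function, to whose square root Carleman's
  inequality applies. A harmonic majorant would not do: the Poisson integral of an integrable
  function need not be square integrable over the disc.\<close>

lemma square_modular_le:
  assumes A: "1 < A" and t0: "0 < t0" "0 < \<Psi> t0"
    and ratio: "mono_on {t0..} (\<lambda>x. \<Psi> (A * x) / \<Psi> x)"
    and h: "h holomorphic_on ball 0 R" "1 < R"
  shows "(\<integral>\<^sup>+ z. ennreal ((\<Psi> (cmod (h z) / A))\<^sup>2) * indicator {z. t0 \<le> cmod (h z)} z \<partial>disc_measure)
    \<le> ennreal ((exp 2 * (\<integral>\<zeta>. \<Psi> (A * max (cmod (h \<zeta>)) t0) \<partial>circle_measure))\<^sup>2)"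
proof -
  have cont: "continuous_on (cball 0 1) h"
    using holomorphic_on_imp_continuous_on[OF h(1)] by (rule continuous_on_subset) (use h in auto)
  have cont': "continuous_on (sphere 0 1) h" using cont by (rule continuous_on_subset) auto
  define m where "m \<zeta> = \<Psi> (A * max (cmod (h \<zeta>)) t0)" for \<zeta>
  have mpos: "0 < m \<zeta>" for \<zeta>
  proof -
    have "1 * max (cmod (h \<zeta>)) t0 \<le> A * max (cmod (h \<zeta>)) t0"
      using A t0 by (intro mult_right_mono) auto
    then have "t0 \<le> A * max (cmod (h \<zeta>)) t0" by simp
    then have "\<Psi> t0 \<le> m \<zeta>" unfolding m_def using t0 by (intro mono) auto
    then show ?thesis using t0 by linarith
  qed
  have mcont: "continuous_on (sphere 0 1) m"
    unfolding m_def using A t0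
    by (intro continuous_Psi continuous_intros cont') (auto simp: le_max_iff_disj)
  have "continuous_on (sphere 0 1) (\<lambda>\<zeta>. ln (m \<zeta>))"
    using mcont mpos by (intro continuous_on_ln) (auto simp: less_le)
  then obtain p where p: "p holomorphic_on UNIV" "\<And>\<zeta>. \<zeta> \<in> sphere 0 1 \<Longrightarrow> \<bar>Re (p \<zeta>) - ln (m \<zeta>)\<bar> < 1"
    using Re_holomorphic_approximation[of "\<lambda>\<zeta>. ln (m \<zeta>)" 1] by (metis zero_less_one)
  define P where "P z = p z + 1" for z
  have Phol: "P holomorphic_on S" for S
    unfolding P_def using p(1) by (intro holomorphic_intros) (auto elim: holomorphic_on_subset)
  have Ple: "ln (m \<zeta>) \<le> Re (P \<zeta>)" "Re (P \<zeta>) \<le> 2 + ln (m \<zeta>)" if "\<zeta> \<in> sphere 0 1" for \<zeta>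
    using p(2)[OF that] by (auto simp: P_def)
  define g where "g z = exp (P z / 2)" for z
  have ghol: "g holomorphic_on S" for S unfolding g_def by (intro holomorphic_intros Phol) auto
  have gsq: "(cmod (g z))\<^sup>2 = exp (Re (P z))" for z
    by (simp add: g_def power2_eq_square exp_add[symmetric])
  have dom: "\<Psi> (cmod (h z) / A) \<le> (cmod (g z))\<^sup>2" if z: "z \<in> ball 0 1" and ge: "t0 \<le> cmod (h z)" for z
  proof -
    obtain c s where c: "0 < c" and s: "0 < s"
      and le: "\<And>y. 0 \<le> y \<Longrightarrow> c * y powr s \<le> \<Psi> (A * max y t0)"
      and x: "\<Psi> (cmod (h z) / A) \<le> c * cmod (h z) powr s"
      using power_minorant[OF A t0 ratio ge] by blast
    \<comment> \<open>\<open>\<bar>h E\<bar> \<le> 1\<close> is the inequality \<open>c \<bar>h\<bar>\<^sup>s \<le> \<bar>exp P\<bar>\<close>, solved for \<open>\<bar>h\<bar>\<close> so that the maximum principle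
  applies although \<open>s\<close> is not an integer.\<close>
    define E where "E w = exp (- (P w - of_real (ln c)) / of_real s)" for w
    have Ehol: "E holomorphic_on S" for S unfolding E_def using s by (intro holomorphic_intros Phol) auto
    have Emod: "cmod (E w) = exp ((ln c - Re (P w)) / s)" for w
      by (simp add: E_def)
    have key: "c * cmod (h w) powr s \<le> exp (Re (P w)) \<longleftrightarrow> cmod (h w * E w) \<le> 1" for w
    proof (cases "h w = 0")
      case False
      have "c * cmod (h w) powr s = exp (ln c + s * ln (cmod (h w)))"
        using c False by (simp add: powr_def exp_add)
      moreover have "cmod (h w * E w) = exp (ln (cmod (h w)) + (ln c - Re (P w)) / s)"
        using False by (simp add: norm_mult Emod exp_add)
      ultimately show ?thesis using s by (simp add: field_simps)
    qed (use s in auto)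
    have "cmod (h z * E z) \<le> 1"
    proof (rule maximum_modulus_frontier[of "\<lambda>w. h w * E w" "ball 0 1"])
      show "(\<lambda>w. h w * E w) holomorphic_on interior (ball 0 1)"
        using h by (intro holomorphic_intros Ehol) (auto elim: holomorphic_on_subset)
      show "continuous_on (closure (ball 0 1)) (\<lambda>w. h w * E w)"
        using cont by (intro continuous_intros holomorphic_on_imp_continuous_on[OF Ehol]) auto
      fix w :: complex assume "w \<in> frontier (ball 0 1)"
      then have w: "w \<in> sphere 0 1" by simp
      have "c * cmod (h w) powr s \<le> m w" unfolding m_def by (rule le) simp
      also have "\<dots> \<le> exp (Re (P w))" using Ple(1)[OF w] mpos[of w] by (metis exp_le_cancel_iff exp_ln)
      finally show "cmod (h w * E w) \<le> 1" by (simp only: key)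
    qed (use z in auto)
    then have "c * cmod (h z) powr s \<le> exp (Re (P z))" by (simp only: key)
    then show ?thesis using x gsq by simp
  qed
  have gcont: "continuous_on (sphere 0 1) g" using ghol by (rule holomorphic_on_imp_continuous_on)
  have "(\<integral>\<^sup>+ z. ennreal ((\<Psi> (cmod (h z) / A))\<^sup>2) * indicator {z. t0 \<le> cmod (h z)} z \<partial>disc_measure)
      \<le> (\<integral>\<^sup>+ z. ennreal (cmod (g z) ^ 4) \<partial>disc_measure)"
  proof (rule nn_integral_mono)
    fix z assume "z \<in> space disc_measure"
    then have z: "z \<in> ball 0 1" by simp
    show "ennreal ((\<Psi> (cmod (h z) / A))\<^sup>2) * indicator {z. t0 \<le> cmod (h z)} z \<le> ennreal (cmod (g z) ^ 4)"
    proof (cases "t0 \<le> cmod (h z)")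
      case True
      have "(\<Psi> (cmod (h z) / A))\<^sup>2 \<le> ((cmod (g z))\<^sup>2)\<^sup>2"
        using dom[OF z True] A nonneg by (intro power_mono) auto
      then show ?thesis using True by (simp add: ennreal_leI power_mult[symmetric])
    qed simp
  qed
  also have "\<dots> \<le> ennreal ((\<integral>\<zeta>. (cmod (g \<zeta>))\<^sup>2 \<partial>circle_measure)\<^sup>2)"
    using Carleman_inequality[OF ghol, of 2] by simp
  also have "\<dots> \<le> ennreal ((exp 2 * (\<integral>\<zeta>. m \<zeta> \<partial>circle_measure))\<^sup>2)"
  proof (intro ennreal_leI power_mono)
    have "(\<integral>\<zeta>. (cmod (g \<zeta>))\<^sup>2 \<partial>circle_measure) \<le> (\<integral>\<zeta>. exp 2 * m \<zeta> \<partial>circle_measure)"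
    proof (rule integral_mono)
      show "integrable circle_measure (\<lambda>\<zeta>. (cmod (g \<zeta>))\<^sup>2)"
        by (intro integral_circle(1) continuous_on_power continuous_on_norm gcont)
      show "integrable circle_measure (\<lambda>\<zeta>. exp 2 * m \<zeta>)"
        by (intro integral_circle(1) continuous_on_mult_left mcont)
      fix \<zeta> assume "\<zeta> \<in> space circle_measure"
      then have "exp (Re (P \<zeta>)) \<le> exp (2 + ln (m \<zeta>))" using Ple(2)[of \<zeta>] by simp
      then show "(cmod (g \<zeta>))\<^sup>2 \<le> exp 2 * m \<zeta>" using mpos[of \<zeta>] by (simp add: gsq exp_add)
    qed
    then show "(\<integral>\<zeta>. (cmod (g \<zeta>))\<^sup>2 \<partial>circle_measure) \<le> exp 2 * (\<integral>\<zeta>. m \<zeta> \<partial>circle_measure)" by simp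
  qed simp
  finally show ?thesis by (simp add: m_def)
qed

end

section \<open>Compactness under the growth condition\<close>

text \<open>The boundary values of a difference agree with the difference of the boundary values only almost
  everywhere, since radial limits are set to 0 where they do not exist. Differences of elements of
  the Hardy-Orlicz space are therefore handled with an explicit boundary function \<open>b\<close>.\<close>

definition Poisson_integral_of :: "(complex \<Rightarrow> complex) \<Rightarrow> (complex \<Rightarrow> complex) \<Rightarrow> bool"
  where "Poisson_integral_of b h \<longleftrightarrow> h holomorphic_on ball 0 1 \<and> integrable circle_measure b \<and>
    (\<forall>z\<in>ball 0 1. (\<integral>\<zeta>. of_real (Poisson_kernel z \<zeta>) * b \<zeta> \<partial>circle_measure) = h z)"

lemma Poisson_integral_of_cmult:
  assumes "Poisson_integral_of b h"
  shows "Poisson_integral_of (\<lambda>\<zeta>. c * b \<zeta>) (\<lambda>z. c * h z)"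
proof -
  have "(\<integral>\<zeta>. of_real (Poisson_kernel z \<zeta>) * (c * b \<zeta>) \<partial>circle_measure) = c * h z" if "z \<in> ball 0 1" for z
  proof -
    have "(\<integral>\<zeta>. of_real (Poisson_kernel z \<zeta>) * (c * b \<zeta>) \<partial>circle_measure)
        = (\<integral>\<zeta>. c * (of_real (Poisson_kernel z \<zeta>) * b \<zeta>) \<partial>circle_measure)"
      by (simp only: mult.left_commute)
    also have "\<dots> = c * (\<integral>\<zeta>. of_real (Poisson_kernel z \<zeta>) * b \<zeta> \<partial>circle_measure)"
      by (rule integral_mult_right_zero)
    also have "(\<integral>\<zeta>. of_real (Poisson_kernel z \<zeta>) * b \<zeta> \<partial>circle_measure) = h z"
      using assms that unfolding Poisson_integral_of_def by blast
    finally show ?thesis .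
  qed
  then show ?thesis
    using assms unfolding Poisson_integral_of_def by (intro conjI ballI holomorphic_intros integrable_mult_right) auto
qed

lemma Poisson_integral_of_diff:
  assumes "Poisson_integral_of b h" "Poisson_integral_of c k"
  shows "Poisson_integral_of (\<lambda>\<zeta>. b \<zeta> - c \<zeta>) (\<lambda>z. h z - k z)"
proof -
  have "(\<integral>\<zeta>. of_real (Poisson_kernel z \<zeta>) * (b \<zeta> - c \<zeta>) \<partial>circle_measure) = h z - k z" if "z \<in> ball 0 1" for z
    using assms that unfolding Poisson_integral_of_def right_diff_distrib
    by (subst Bochner_Integration.integral_diff) (auto intro: integrable_Poisson_mult)
  then show ?thesis
    using assms unfolding Poisson_integral_of_def
    by (intro conjI ballI holomorphic_on_diff Bochner_Integration.integrable_diff) auto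
qed

context orlicz
begin

lemma unit_ball_boundary_values:
  assumes "f \<in> closed_unit_ball (Hardy_Orlicz \<Psi>) (Hardy_Orlicz_norm \<Psi>)"
  shows "Poisson_integral_of (boundary_values f) f"
    and "(\<integral>\<^sup>+ \<zeta>. ennreal (\<Psi> (cmod (boundary_values f \<zeta>) / 2)) \<partial>circle_measure) \<le> 1"
proof -
  have f: "f \<in> Hardy_space_1" "boundary_values f \<in> Orlicz_space \<Psi> circle_measure"
    "Luxemburg_norm \<Psi> circle_measure (boundary_values f) \<le> 1"
    using assms by (auto simp: closed_unit_ball_def Hardy_Orlicz_def Hardy_Orlicz_norm_def)
  have meas: "boundary_values f \<in> borel_measurable circle_measure" using f(2) by (simp add: Orlicz_space_def)
  have "f holomorphic_on ball 0 1"
    using f(1) by (simp add: Hardy_space_1_def analytic_on_disc_def analytic_on_open)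
  then show "Poisson_integral_of (boundary_values f) f"
    unfolding Poisson_integral_of_def using Poisson_boundary_values[OF f(1) meas] by blast
  show "(\<integral>\<^sup>+ \<zeta>. ennreal (\<Psi> (cmod (boundary_values f \<zeta>) / 2)) \<partial>circle_measure) \<le> 1"
    using f(3) by (intro Luxemburg_less(2)[OF f(2)]) simp
qed

text \<open>Jensen's inequality with the bound \<open>2 / (1 - \<bar>z\<bar>)\<close> for the Poisson kernel. It is locally uniform
  in \<open>z\<close> and thus makes the unit ball a normal family.\<close>

lemma Poisson_integral_bound:
  assumes P: "Poisson_integral_of b h" and b: "(\<integral>\<^sup>+ \<zeta>. ennreal (\<Psi> (cmod (b \<zeta>) / 2)) \<partial>circle_measure) \<le> 1"
    and Y: "0 < Y" "2 / (1 - cmod z) \<le> \<Psi> Y" and z: "z \<in> ball 0 1"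
  shows "cmod (h z) \<le> 2 * Y"
proof -
  have P': "Poisson_integral_of (\<lambda>\<zeta>. 1 / 2 * b \<zeta>) (\<lambda>z. 1 / 2 * h z)"
    by (rule Poisson_integral_of_cmult[OF P])
  then have int: "integrable circle_measure (\<lambda>\<zeta>. 1 / 2 * b \<zeta>)" by (simp add: Poisson_integral_of_def)
  have eq: "(\<integral>\<zeta>. of_real (Poisson_kernel z \<zeta>) * (1 / 2 * b \<zeta>) \<partial>circle_measure) = 1 / 2 * h z"
    using P' z unfolding Poisson_integral_of_def by blast
  have bm: "(\<lambda>\<zeta>. ennreal (\<Psi> (cmod (b \<zeta>) / 2))) \<in> borel_measurable circle_measure"
    using P unfolding Poisson_integral_of_def by (intro measurable_modular borel_measurable_integrable) auto
  have "ennreal (\<Psi> (cmod (1 / 2 * h z)))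
      \<le> (\<integral>\<^sup>+ \<zeta>. ennreal (Poisson_kernel z \<zeta>) * ennreal (\<Psi> (cmod (1 / 2 * b \<zeta>))) \<partial>circle_measure)"
    using Poisson_Jensen[OF z int] unfolding eq .
  also have "\<dots> \<le> (\<integral>\<^sup>+ \<zeta>. ennreal (2 / (1 - cmod z)) * ennreal (\<Psi> (cmod (b \<zeta>) / 2)) \<partial>circle_measure)"
    using Poisson_kernel_le[OF z] by (intro nn_integral_mono mult_mono ennreal_leI) (auto simp: norm_divide)
  also have "\<dots> = ennreal (2 / (1 - cmod z)) * (\<integral>\<^sup>+ \<zeta>. ennreal (\<Psi> (cmod (b \<zeta>) / 2)) \<partial>circle_measure)"
    by (rule nn_integral_cmult[OF bm])
  also have "\<dots> \<le> ennreal (2 / (1 - cmod z)) * 1" by (intro mult_left_mono b) simp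
  finally have "ennreal (\<Psi> (cmod (1 / 2 * h z))) \<le> ennreal (2 / (1 - cmod z))" by simp
  moreover have pos: "0 < 2 / (1 - cmod z)" using z by simp
  ultimately have "\<Psi> (cmod (1 / 2 * h z)) \<le> 2 / (1 - cmod z)" by (simp only: ennreal_le_iff less_imp_le)
  then have "\<Psi> (cmod (1 / 2 * h z)) \<le> \<Psi> Y" "0 < \<Psi> Y" using Y(2) pos by linarith+
  then have "cmod (1 / 2 * h z) \<le> Y" by (rule reflects_le[OF _ _ less_imp_le[OF Y(1)]])
  then show ?thesis by (simp add: norm_divide)
qed

text \<open>Jensen's inequality for the Poisson kernel, integrated over the circle of radius \<open>r\<close>; the
  kernel is symmetric, so it integrates to 1 in the other variable as well.\<close>

lemma dilate_modular_le:
  assumes P: "Poisson_integral_of b h" and r: "0 \<le> r" "r < 1" and a: "0 \<le> a"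
  shows "(\<integral>\<^sup>+ \<zeta>. ennreal (\<Psi> (a * cmod (h (of_real r * \<zeta>)))) \<partial>circle_measure)
    \<le> (\<integral>\<^sup>+ \<zeta>. ennreal (\<Psi> (a * cmod (b \<zeta>))) \<partial>circle_measure)"
proof -
  interpret pair_sigma_finite circle_measure circle_measure by unfold_locales
  have P': "Poisson_integral_of (\<lambda>\<zeta>. of_real a * b \<zeta>) (\<lambda>z. of_real a * h z)"
    by (rule Poisson_integral_of_cmult[OF P])
  then have int: "integrable circle_measure (\<lambda>\<zeta>. of_real a * b \<zeta>)" by (simp add: Poisson_integral_of_def)
  have bm: "(\<lambda>\<zeta>. ennreal (\<Psi> (a * cmod (b \<zeta>)))) \<in> borel_measurable circle_measure"
  proof -
    have "(\<lambda>\<zeta>. a * cmod (b \<zeta>)) \<in> borel_measurable circle_measure"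
      using P unfolding Poisson_integral_of_def by (intro borel_measurable_times borel_measurable_norm) auto
    then show ?thesis using a by (intro measurable_compose[OF _ measurable_ennreal] measurable_Psi) auto
  qed
  have id: "(\<lambda>x. x) \<in> borel_measurable circle_measure"
    by (intro continuous_imp_measurable_circle continuous_on_id)
  have kernel: "(\<lambda>p. ennreal (Poisson_kernel (of_real r * fst p) (snd p))) \<in> borel_measurable (circle_measure \<Otimes>\<^sub>M circle_measure)"
  proof -
    have [measurable]: "fst \<in> borel_measurable (circle_measure \<Otimes>\<^sub>M circle_measure)"
      by (rule measurable_compose[OF measurable_fst id])
    have [measurable]: "snd \<in> borel_measurable (circle_measure \<Otimes>\<^sub>M circle_measure)"
      by (rule measurable_compose[OF measurable_snd id])
    show ?thesis unfolding Poisson_kernel_def by measurable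
  qed
  have "(\<integral>\<^sup>+ \<zeta>. ennreal (\<Psi> (a * cmod (h (of_real r * \<zeta>)))) \<partial>circle_measure)
      \<le> (\<integral>\<^sup>+ \<zeta>. \<integral>\<^sup>+ \<xi>. ennreal (Poisson_kernel (of_real r * \<zeta>) \<xi>) * ennreal (\<Psi> (a * cmod (b \<xi>))) \<partial>circle_measure \<partial>circle_measure)"
  proof (rule nn_integral_mono)
    fix \<zeta> assume "\<zeta> \<in> space circle_measure"
    then have z: "of_real r * \<zeta> \<in> ball 0 1" using r by (simp add: norm_mult)
    have eq: "(\<integral>\<xi>. of_real (Poisson_kernel (of_real r * \<zeta>) \<xi>) * (of_real a * b \<xi>) \<partial>circle_measure) = of_real a * h (of_real r * \<zeta>)"
      using P' z unfolding Poisson_integral_of_def by blast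
    show "ennreal (\<Psi> (a * cmod (h (of_real r * \<zeta>))))
        \<le> (\<integral>\<^sup>+ \<xi>. ennreal (Poisson_kernel (of_real r * \<zeta>) \<xi>) * ennreal (\<Psi> (a * cmod (b \<xi>))) \<partial>circle_measure)"
      using Poisson_Jensen[OF z int] a unfolding eq by (simp add: norm_mult)
  qed
  also have "\<dots> = (\<integral>\<^sup>+ \<xi>. \<integral>\<^sup>+ \<zeta>. ennreal (Poisson_kernel (of_real r * \<zeta>) \<xi>) * ennreal (\<Psi> (a * cmod (b \<xi>))) \<partial>circle_measure \<partial>circle_measure)"
  proof (rule Fubini'[symmetric])
    show "(\<lambda>(\<zeta>, \<xi>). ennreal (Poisson_kernel (of_real r * \<zeta>) \<xi>) * ennreal (\<Psi> (a * cmod (b \<xi>))))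
        \<in> borel_measurable (circle_measure \<Otimes>\<^sub>M circle_measure)"
      unfolding case_prod_beta
      by (intro borel_measurable_times_ennreal kernel measurable_compose[OF measurable_snd bm])
  qed
  also have "\<dots> = (\<integral>\<^sup>+ \<xi>. ennreal (\<Psi> (a * cmod (b \<xi>))) \<partial>circle_measure)"
  proof (rule nn_integral_cong)
    fix \<xi> assume \<xi>: "\<xi> \<in> space circle_measure"
    then have z: "of_real r * \<xi> \<in> ball 0 1" using r by (simp add: norm_mult)
    have "(\<integral>\<^sup>+ \<zeta>. ennreal (Poisson_kernel (of_real r * \<zeta>) \<xi>) * ennreal (\<Psi> (a * cmod (b \<xi>))) \<partial>circle_measure)
        = (\<integral>\<^sup>+ \<zeta>. ennreal (Poisson_kernel (of_real r * \<xi>) \<zeta>) * ennreal (\<Psi> (a * cmod (b \<xi>))) \<partial>circle_measure)"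
      using \<xi> Poisson_kernel_commute[of _ \<xi> r] by (intro nn_integral_cong) auto
    also have "\<dots> = (\<integral>\<^sup>+ \<zeta>. ennreal (Poisson_kernel (of_real r * \<xi>) \<zeta>) \<partial>circle_measure) * ennreal (\<Psi> (a * cmod (b \<xi>)))"
      by (intro nn_integral_multc measurable_compose[OF _ measurable_ennreal] continuous_imp_measurable_circle
          continuous_Poisson_kernel z)
    finally show "(\<integral>\<^sup>+ \<zeta>. ennreal (Poisson_kernel (of_real r * \<zeta>) \<xi>) * ennreal (\<Psi> (a * cmod (b \<xi>))) \<partial>circle_measure)
        = ennreal (\<Psi> (a * cmod (b \<xi>)))"
      by (simp only: Poisson_kernel_integral(2)[OF z] mult_1)
  qed
  finally show ?thesis .
qed

text \<open>The estimate for functions holomorphic beyond the circle applies to the dilates of \<open>h\<close>, and Fatou's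
  lemma passes it to \<open>h\<close>: where \<open>t0 < \<bar>h z\<bar>\<close>, the dilates eventually have modulus at least \<open>t0\<close>.\<close>

lemma square_modular_boundary_le:
  assumes A: "1 < A" and t0: "0 < t0" "0 < \<Psi> t0"
    and ratio: "mono_on {t0..} (\<lambda>x. \<Psi> (A * x) / \<Psi> x)"
    and P: "Poisson_integral_of b h"
    and b: "(\<integral>\<^sup>+ \<zeta>. ennreal (\<Psi> (A * cmod (b \<zeta>))) \<partial>circle_measure) \<le> 1"
  shows "(\<integral>\<^sup>+ z. ennreal ((\<Psi> (cmod (h z) / A))\<^sup>2) * indicator {z. t0 < cmod (h z)} z \<partial>disc_measure)
    \<le> ennreal ((exp 2 * (1 + \<Psi> (A * t0)))\<^sup>2)"
proof -
  have hol: "h holomorphic_on ball 0 1" using P by (simp add: Poisson_integral_of_def)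
  have hcont: "continuous_on (ball 0 1) h" using hol by (rule holomorphic_on_imp_continuous_on)
  define K where "K = (exp 2 * (1 + \<Psi> (A * t0)))\<^sup>2"
  define r where "r i = 1 - 1 / real (i + 2)" for i
  have r: "0 < r i" "r i < 1" for i by (auto simp: r_def field_simps)
  have rlim: "r \<longlonglongrightarrow> 1" unfolding r_def by real_asymp
  define H where "H i z = h (of_real (r i) * z)" for i z
  define q where "q i z = ennreal ((\<Psi> (cmod (H i z) / A))\<^sup>2) * indicator {z. t0 \<le> cmod (H i z)} z" for i z
  have Hhol: "H i holomorphic_on ball 0 (1 / r i)" for i
    unfolding H_def by (rule holomorphic_on_dilate[OF hol r(1)])
  have R: "1 < 1 / r i" for i using r[of i] by simp
  have Hcont: "continuous_on (sphere 0 1) (H i)" for i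
    unfolding H_def using r[of i] by (intro continuous_on_dilate[OF hol]) auto
  have q_le: "(\<integral>\<^sup>+ z. q i z \<partial>disc_measure) \<le> ennreal K" for i
  proof -
    have c1: "continuous_on (sphere 0 1) (\<lambda>\<zeta>. \<Psi> (A * cmod (H i \<zeta>)))"
      using A by (intro continuous_Psi continuous_intros Hcont) auto
    have c2: "continuous_on (sphere 0 1) (\<lambda>\<zeta>. \<Psi> (A * max (cmod (H i \<zeta>)) t0))"
      using A t0 by (intro continuous_Psi continuous_intros Hcont) (auto simp: le_max_iff_disj)
    have "ennreal (\<integral>\<zeta>. \<Psi> (A * cmod (H i \<zeta>)) \<partial>circle_measure) = (\<integral>\<^sup>+ \<zeta>. ennreal (\<Psi> (A * cmod (H i \<zeta>))) \<partial>circle_measure)"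
      using A nonneg by (intro nn_integral_circle_continuous[symmetric] c1) auto
    also have "\<dots> \<le> 1"
      unfolding H_def using r[of i] A by (intro order_trans[OF dilate_modular_le[OF P] b]) auto
    finally have le1: "(\<integral>\<zeta>. \<Psi> (A * cmod (H i \<zeta>)) \<partial>circle_measure) \<le> 1" by (simp add: ennreal_le_1)
    have "(\<integral>\<zeta>. \<Psi> (A * max (cmod (H i \<zeta>)) t0) \<partial>circle_measure) \<le> (\<integral>\<zeta>. \<Psi> (A * cmod (H i \<zeta>)) + \<Psi> (A * t0) \<partial>circle_measure)"
    proof (rule integral_mono)
      show "integrable circle_measure (\<lambda>\<zeta>. \<Psi> (A * max (cmod (H i \<zeta>)) t0))"
        by (rule integral_circle(1)[OF c2])
      show "integrable circle_measure (\<lambda>\<zeta>. \<Psi> (A * cmod (H i \<zeta>)) + \<Psi> (A * t0))"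
        by (intro integral_circle(1) continuous_on_add continuous_on_const c1)
      show "\<Psi> (A * max (cmod (H i \<zeta>)) t0) \<le> \<Psi> (A * cmod (H i \<zeta>)) + \<Psi> (A * t0)" for \<zeta>
        using nonneg[of "A * cmod (H i \<zeta>)"] nonneg[of "A * t0"] A t0 by (simp add: max_def)
    qed
    also have "\<dots> = (\<integral>\<zeta>. \<Psi> (A * cmod (H i \<zeta>)) \<partial>circle_measure) + \<Psi> (A * t0)"
      using integral_circle(1)[OF c1] circle.prob_space by (subst Bochner_Integration.integral_add) auto
    also have "\<dots> \<le> 1 + \<Psi> (A * t0)" using le1 by simp
    finally have "(\<integral>\<zeta>. \<Psi> (A * max (cmod (H i \<zeta>)) t0) \<partial>circle_measure) \<le> 1 + \<Psi> (A * t0)" .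
    moreover have "0 \<le> (\<integral>\<zeta>. \<Psi> (A * max (cmod (H i \<zeta>)) t0) \<partial>circle_measure)"
      using A t0 nonneg by (intro Bochner_Integration.integral_nonneg) (auto simp: le_max_iff_disj)
    ultimately have "(exp 2 * (\<integral>\<zeta>. \<Psi> (A * max (cmod (H i \<zeta>)) t0) \<partial>circle_measure))\<^sup>2 \<le> K"
      unfolding K_def by (intro power_mono mult_left_mono) auto
    then show ?thesis
      unfolding q_def by (intro order_trans[OF square_modular_le[OF A t0 ratio Hhol R]] ennreal_leI)
  qed
  have lim: "(\<lambda>i. H i z) \<longlonglongrightarrow> h z" if "z \<in> ball 0 1" for z
    unfolding H_def by (rule dilates_tendsto[OF hol that rlim])
  have "(\<integral>\<^sup>+ z. ennreal ((\<Psi> (cmod (h z) / A))\<^sup>2) * indicator {z. t0 < cmod (h z)} z \<partial>disc_measure)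
      \<le> (\<integral>\<^sup>+ z. liminf (\<lambda>i. q i z) \<partial>disc_measure)"
  proof (rule nn_integral_mono)
    fix z assume "z \<in> space disc_measure"
    then have z: "z \<in> ball 0 1" by simp
    show "ennreal ((\<Psi> (cmod (h z) / A))\<^sup>2) * indicator {z. t0 < cmod (h z)} z \<le> liminf (\<lambda>i. q i z)"
    proof (cases "t0 < cmod (h z)")
      case True
      have "(\<lambda>i. cmod (H i z) / A) \<longlonglongrightarrow> cmod (h z) / A"
        using A by (intro tendsto_divide tendsto_norm tendsto_const lim z) simp
      then have "(\<lambda>i. \<Psi> \<bar>cmod (H i z) / A\<bar>) \<longlonglongrightarrow> \<Psi> \<bar>cmod (h z) / A\<bar>"
        by (rule continuous_on_tendsto_compose[OF continuous_abs]) simp_all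
      then have "(\<lambda>i. \<Psi> (cmod (H i z) / A)) \<longlonglongrightarrow> \<Psi> (cmod (h z) / A)" using A by simp
      then have "(\<lambda>i. ennreal ((\<Psi> (cmod (H i z) / A))\<^sup>2)) \<longlonglongrightarrow> ennreal ((\<Psi> (cmod (h z) / A))\<^sup>2)"
        by (intro tendsto_ennrealI tendsto_power)
      moreover have "\<forall>\<^sub>F i in sequentially. ennreal ((\<Psi> (cmod (H i z) / A))\<^sup>2) = q i z"
        using order_tendstoD(1)[OF tendsto_norm[OF lim[OF z]] True] by eventually_elim (simp add: q_def)
      ultimately have "(\<lambda>i. q i z) \<longlonglongrightarrow> ennreal ((\<Psi> (cmod (h z) / A))\<^sup>2)"
        by (rule Lim_transform_eventually)
      then have "liminf (\<lambda>i. q i z) = ennreal ((\<Psi> (cmod (h z) / A))\<^sup>2)" by (intro lim_imp_Liminf) auto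
      then show ?thesis using True by simp
    qed simp
  qed
  also have "\<dots> \<le> liminf (\<lambda>i. \<integral>\<^sup>+ z. q i z \<partial>disc_measure)"
  proof (rule nn_integral_liminf)
    fix i
    have "continuous_on (ball 0 1) (H i)"
      using holomorphic_on_imp_continuous_on[OF Hhol] by (rule continuous_on_subset) (use R[of i] in auto)
    then have Hm: "H i \<in> borel_measurable disc_measure" by (rule continuous_imp_measurable_disc)
    have "(\<lambda>z. (\<Psi> (cmod (H i z) / A))\<^sup>2) \<in> borel_measurable disc_measure"
      using A Hm by (intro borel_measurable_power measurable_Psi) auto
    moreover have "(\<lambda>z. indicator {z. t0 \<le> cmod (H i z)} z :: ennreal) \<in> borel_measurable disc_measure"
      using Hm by (intro borel_measurable_indicator') measurable
    ultimately show "q i \<in> borel_measurable disc_measure"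
      unfolding q_def by (intro borel_measurable_times_ennreal measurable_compose[OF _ measurable_ennreal])
  qed
  also have "\<dots> \<le> ennreal K" by (intro Liminf_le always_eventually allI q_le) simp
  finally show ?thesis by (simp only: K_def)
qed

text \<open>The growth condition makes \<open>\<Psi> (\<bar>h\<bar> / \<epsilon>)\<close> negligible against \<open>\<Psi> (\<bar>h\<bar> / A)\<^sup>2\<close> where \<open>\<bar>h\<bar>\<close> is
  large.\<close>

lemma uniformly_integrable_modular:
  assumes A: "1 < A" and x0: "0 < x0" and ratio: "mono_on {x0..} (\<lambda>x. \<Psi> (A * x) / \<Psi> x)"
    and growth: "\<And>B. 1 < B \<Longrightarrow> ((\<lambda>x. \<Psi> (B * x) / (\<Psi> x)\<^sup>2) \<longlongrightarrow> 0) at_top" and \<epsilon>: "0 < \<epsilon>"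
  obtains M where "0 < M"
    "\<And>b h. Poisson_integral_of b h \<Longrightarrow> (\<integral>\<^sup>+ \<zeta>. ennreal (\<Psi> (A * cmod (b \<zeta>))) \<partial>circle_measure) \<le> 1 \<Longrightarrow>
      (\<integral>\<^sup>+ z. ennreal (\<Psi> (cmod (h z) / \<epsilon>)) * indicator {z. M < cmod (h z)} z \<partial>disc_measure) \<le> ennreal (1 / 2)"
proof -
  obtain t0 where t0: "x0 < t0" "1 \<le> \<Psi> t0" using ex_ge by blast
  then have t0': "0 < t0" "0 < \<Psi> t0" using x0 by auto
  have ratio': "mono_on {t0..} (\<lambda>x. \<Psi> (A * x) / \<Psi> x)"
    using ratio by (rule mono_on_subset) (use t0 in auto)
  define K where "K = (exp 2 * (1 + \<Psi> (A * t0)))\<^sup>2"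
  have K: "0 < K" unfolding K_def using nonneg[of "A * t0"] A t0' by (simp add: add_pos_nonneg)
  define B where "B = max 2 (A / \<epsilon>)"
  have B: "1 < B" "A / \<epsilon> \<le> B" by (auto simp: B_def)
  have "\<forall>\<^sub>F x in at_top. \<Psi> (B * x) / (\<Psi> x)\<^sup>2 < 1 / (2 * K)"
    using order_tendstoD(2)[OF growth[OF B(1)], of "1 / (2 * K)"] K by simp
  then obtain x1 where x1: "\<And>x. x1 \<le> x \<Longrightarrow> \<Psi> (B * x) / (\<Psi> x)\<^sup>2 < 1 / (2 * K)"
    by (auto simp: eventually_at_top_linorder)
  define M where "M = A * max t0 x1"
  have M: "0 < M" "t0 \<le> M / A" "x1 \<le> M / A" "t0 \<le> M"
  proof -
    have "1 * max t0 x1 \<le> A * max t0 x1" using A t0' by (intro mult_right_mono) auto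
    then show "0 < M" "t0 \<le> M / A" "x1 \<le> M / A" "t0 \<le> M" using A t0' unfolding M_def by auto
  qed
  have le: "\<Psi> (y / \<epsilon>) \<le> 1 / (2 * K) * (\<Psi> (y / A))\<^sup>2" if y: "M < y" for y
  proof -
    have yA: "M / A \<le> y / A" using y A by (intro divide_right_mono) auto
    then have x: "t0 \<le> y / A" "x1 \<le> y / A" using M by linarith+
    have pos: "0 < \<Psi> (y / A)" using mono[of t0 "y / A"] x t0' by linarith
    have "y / \<epsilon> = (A / \<epsilon>) * (y / A)" using A by simp
    also have "\<dots> \<le> B * (y / A)" using B x t0' by (intro mult_right_mono) auto
    finally have "\<Psi> (y / \<epsilon>) \<le> \<Psi> (B * (y / A))" using y M \<epsilon> by (intro mono) auto
    also have "\<dots> \<le> 1 / (2 * K) * (\<Psi> (y / A))\<^sup>2"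
      using less_imp_le[OF x1[OF x(2)]] pos by (subst (asm) pos_divide_le_eq) auto
    finally show ?thesis .
  qed
  show thesis
  proof (rule that[OF M(1)])
    fix b h assume P: "Poisson_integral_of b h" and b: "(\<integral>\<^sup>+ \<zeta>. ennreal (\<Psi> (A * cmod (b \<zeta>))) \<partial>circle_measure) \<le> 1"
    have hm: "h \<in> borel_measurable disc_measure"
      using P unfolding Poisson_integral_of_def
      by (intro continuous_imp_measurable_disc holomorphic_on_imp_continuous_on) auto
    have qm: "(\<lambda>z. ennreal ((\<Psi> (cmod (h z) / A))\<^sup>2) * indicator {z. t0 < cmod (h z)} z) \<in> borel_measurable disc_measure"
    proof -
      have "(\<lambda>z. (\<Psi> (cmod (h z) / A))\<^sup>2) \<in> borel_measurable disc_measure"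
        using A hm by (intro borel_measurable_power measurable_Psi) auto
      moreover have "(\<lambda>z. indicator {z. t0 < cmod (h z)} z :: ennreal) \<in> borel_measurable disc_measure"
        using hm by (intro borel_measurable_indicator') measurable
      ultimately show ?thesis by (intro borel_measurable_times_ennreal measurable_compose[OF _ measurable_ennreal])
    qed
    have "(\<integral>\<^sup>+ z. ennreal (\<Psi> (cmod (h z) / \<epsilon>)) * indicator {z. M < cmod (h z)} z \<partial>disc_measure)
        \<le> (\<integral>\<^sup>+ z. ennreal (1 / (2 * K)) * (ennreal ((\<Psi> (cmod (h z) / A))\<^sup>2) * indicator {z. t0 < cmod (h z)} z) \<partial>disc_measure)"
    proof (rule nn_integral_mono)
      fix z
      show "ennreal (\<Psi> (cmod (h z) / \<epsilon>)) * indicator {z. M < cmod (h z)} z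
          \<le> ennreal (1 / (2 * K)) * (ennreal ((\<Psi> (cmod (h z) / A))\<^sup>2) * indicator {z. t0 < cmod (h z)} z)"
      proof (cases "M < cmod (h z)")
        case True
        then have "t0 < cmod (h z)" using M(4) by simp
        moreover have "ennreal (\<Psi> (cmod (h z) / \<epsilon>)) \<le> ennreal (1 / (2 * K)) * ennreal ((\<Psi> (cmod (h z) / A))\<^sup>2)"
          using ennreal_leI[OF le[OF True]] K by (subst ennreal_mult'[symmetric]) auto
        ultimately show ?thesis using True by simp
      qed simp
    qed
    also have "\<dots> = ennreal (1 / (2 * K)) * (\<integral>\<^sup>+ z. ennreal ((\<Psi> (cmod (h z) / A))\<^sup>2) * indicator {z. t0 < cmod (h z)} z \<partial>disc_measure)"
      by (rule nn_integral_cmult[OF qm])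
    also have "\<dots> \<le> ennreal (1 / (2 * K)) * ennreal K"
      unfolding K_def by (intro mult_left_mono square_modular_boundary_le[OF A t0' ratio' P b]) simp
    also have "\<dots> = ennreal (1 / 2)" using K by (subst ennreal_mult'[symmetric]) auto
    finally show "(\<integral>\<^sup>+ z. ennreal (\<Psi> (cmod (h z) / \<epsilon>)) * indicator {z. M < cmod (h z)} z \<partial>disc_measure) \<le> ennreal (1 / 2)" .
  qed
qed

text \<open>The disc is divided into three parts: where the difference exceeds \<open>M\<close> its modular is small by
  uniform integrability, in a smaller disc \<open>\<bar>z\<bar> < \<rho>\<close> by uniform convergence, and over the remaining
  annulus because the area is small. The three bounds \<open>1 / 2\<close>, \<open>1 / 4\<close> and \<open>1 / 4\<close> add up to 1.\<close>

lemma unit_ball_modular_Cauchy: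
  assumes A: "1 < A" and x0: "0 < x0" and ratio: "mono_on {x0..} (\<lambda>x. \<Psi> (A * x) / \<Psi> x)"
    and growth: "\<And>B. 1 < B \<Longrightarrow> ((\<lambda>x. \<Psi> (B * x) / (\<Psi> x)\<^sup>2) \<longlongrightarrow> 0) at_top"
    and f: "\<And>n. f n \<in> closed_unit_ball (Hardy_Orlicz \<Psi>) (Hardy_Orlicz_norm \<Psi>)"
    and unif: "\<And>\<rho>. 0 \<le> \<rho> \<Longrightarrow> \<rho> < 1 \<Longrightarrow> uniform_limit (cball 0 \<rho>) f k sequentially" and e: "0 < e"
  shows "\<exists>N. \<forall>n\<ge>N. \<forall>m\<ge>N. (\<integral>\<^sup>+ z. ennreal (\<Psi> (cmod (f n z - f m z) / e)) \<partial>disc_measure) \<le> 1"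
proof -
  note P = unit_ball_boundary_values(1)[OF f] and b = unit_ball_boundary_values(2)[OF f]
  have meas: "f n \<in> borel_measurable disc_measure" for n
    using P[of n] unfolding Poisson_integral_of_def
    by (intro continuous_imp_measurable_disc holomorphic_on_imp_continuous_on) auto
  \<comment> \<open>The difference of two elements of the unit ball is divided by \<open>4 A\<close>: a factor 4 to make its
  boundary modular at most 1, and a factor \<open>A\<close> as uniform integrability requires.\<close>
  define \<epsilon> where "\<epsilon> = e / (4 * A)"
  have \<epsilon>: "0 < \<epsilon>" using e A by (simp add: \<epsilon>_def)
  obtain M where M: "0 < M" and tail: "\<And>b h. Poisson_integral_of b h \<Longrightarrow>
      (\<integral>\<^sup>+ \<zeta>. ennreal (\<Psi> (A * cmod (b \<zeta>))) \<partial>circle_measure) \<le> 1 \<Longrightarrow>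
      (\<integral>\<^sup>+ z. ennreal (\<Psi> (cmod (h z) / \<epsilon>)) * indicator {z. M < cmod (h z)} z \<partial>disc_measure) \<le> ennreal (1 / 2)"
    using uniformly_integrable_modular[OF A x0 ratio growth \<epsilon>] by blast
  define c where "c = \<Psi> (M / \<epsilon>) + 1"
  have c: "1 \<le> c" "\<Psi> (M / \<epsilon>) \<le> c" using nonneg[of "M / \<epsilon>"] M \<epsilon> by (auto simp: c_def)
  define \<rho> where "\<rho> = sqrt (1 - 1 / (4 * c))"
  have \<rho>2: "\<rho>\<^sup>2 = 1 - 1 / (4 * c)" using c by (simp add: \<rho>_def field_simps)
  have \<rho>: "0 \<le> \<rho>" "\<rho> < 1" using c by (auto simp: \<rho>_def field_simps)
  define \<eta> where "\<eta> = 1 / (4 * c)"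
  have \<eta>: "0 < \<eta>" "\<eta> \<le> 1" using c by (auto simp: \<eta>_def field_simps)
  have small: "\<Psi> (\<eta> * M / \<epsilon>) \<le> 1 / 4"
  proof -
    have "\<Psi> (\<eta> * (M / \<epsilon>)) \<le> \<eta> * \<Psi> (M / \<epsilon>)" using \<eta> M \<epsilon> by (intro scale) auto
    also have "\<dots> \<le> \<eta> * c" using \<eta> c by (intro mult_left_mono) auto
    also have "\<dots> = 1 / 4" using c by (simp add: \<eta>_def)
    finally show ?thesis by simp
  qed
  have "uniform_limit (cball 0 \<rho>) f k sequentially" using \<rho> by (intro unif) auto
  moreover have "0 < 2 * A * (\<eta> * M)" using A \<eta> M by simp
  ultimately have "\<forall>\<^sub>F n in sequentially. \<forall>z\<in>cball 0 \<rho>. dist (f n z) (k z) < 2 * A * (\<eta> * M)"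
    by (rule uniform_limitD)
  then obtain N where N: "\<And>n z. N \<le> n \<Longrightarrow> z \<in> cball 0 \<rho> \<Longrightarrow> cmod (f n z - k z) < 2 * A * (\<eta> * M)"
    unfolding eventually_sequentially dist_norm by blast
  have "(\<integral>\<^sup>+ z. ennreal (\<Psi> (cmod (f n z - f m z) / e)) \<partial>disc_measure) \<le> 1" if nm: "N \<le> n" "N \<le> m" for n m
  proof -
    define q where "q = complex_of_real (1 / (4 * A))"
    define h where "h z = q * (f n z - f m z)" for z
    define \<beta> where "\<beta> \<zeta> = q * (boundary_values (f n) \<zeta> - boundary_values (f m) \<zeta>)" for \<zeta>
    have hP: "Poisson_integral_of \<beta> h"
      unfolding \<beta>_def h_def by (intro Poisson_integral_of_cmult Poisson_integral_of_diff P)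
    have qn: "cmod (q * w) = cmod w / (4 * A)" for w
      unfolding q_def norm_mult norm_of_real using A by simp
    have bm: "boundary_values (f n) \<in> borel_measurable circle_measure" for n
      using P[of n] unfolding Poisson_integral_of_def by (intro borel_measurable_integrable) auto
    have "(\<integral>\<^sup>+ \<zeta>. ennreal (\<Psi> (cmod (boundary_values (f n) \<zeta> - boundary_values (f m) \<zeta>) / (2 + 2))) \<partial>circle_measure) \<le> 1"
      by (intro modular_diff bm b) auto
    then have \<beta>: "(\<integral>\<^sup>+ \<zeta>. ennreal (\<Psi> (A * cmod (\<beta> \<zeta>))) \<partial>circle_measure) \<le> 1"
      unfolding \<beta>_def qn using A by simp
    have hm: "h \<in> borel_measurable disc_measure"
      unfolding h_def using meas by (intro borel_measurable_times borel_measurable_diff) auto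
    have m1: "(\<lambda>z. ennreal (\<Psi> (cmod (h z) / \<epsilon>)) * indicator {z. M < cmod (h z)} z) \<in> borel_measurable disc_measure"
    proof -
      have "(\<lambda>z. indicator {z. M < cmod (h z)} z :: ennreal) \<in> borel_measurable disc_measure"
        using hm by (intro borel_measurable_indicator') measurable
      then show ?thesis using \<epsilon> hm by (intro borel_measurable_times_ennreal measurable_modular) auto
    qed
    have sets\<rho>: "ball 0 \<rho> \<in> sets disc_measure"
    proof -
      have "ball 0 1 \<inter> ball (0::complex) \<rho> \<in> sets (restrict_space borel (ball 0 1))"
        unfolding sets_restrict_space by (rule imageI) simp
      moreover have "ball 0 1 \<inter> ball (0::complex) \<rho> = ball 0 \<rho>"
        using subset_ball[of \<rho> 1 "0::complex"] \<rho> by (intro Int_absorb1) simp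
      ultimately show ?thesis by (simp only: sets_disc_measure)
    qed
    have sets: "ball 0 1 - ball 0 \<rho> \<in> sets disc_measure"
      using sets.compl_sets[OF sets\<rho>] by (simp only: space_disc_measure)
    have he: "cmod (f n z - f m z) / e = cmod (h z) / \<epsilon>" for z
      unfolding h_def qn \<epsilon>_def using A by simp
    have "(\<integral>\<^sup>+ z. ennreal (\<Psi> (cmod (f n z - f m z) / e)) \<partial>disc_measure)
        \<le> (\<integral>\<^sup>+ z. (ennreal (\<Psi> (cmod (h z) / \<epsilon>)) * indicator {z. M < cmod (h z)} z + ennreal (1 / 4))
            + ennreal c * indicator (ball 0 1 - ball 0 \<rho>) z \<partial>disc_measure)"
      unfolding he
    proof (rule nn_integral_mono)
      fix z assume "z \<in> space disc_measure"
      then have z: "z \<in> ball 0 1" by simp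
      show "ennreal (\<Psi> (cmod (h z) / \<epsilon>)) \<le> (ennreal (\<Psi> (cmod (h z) / \<epsilon>)) * indicator {z. M < cmod (h z)} z + ennreal (1 / 4))
            + ennreal c * indicator (ball 0 1 - ball 0 \<rho>) z"
      proof (cases "M < cmod (h z)")
        case True
        then show ?thesis by (simp add: add_increasing2)
      next
        case hM: False
        show ?thesis
        proof (cases "z \<in> ball 0 \<rho>")
          case True
          then have "cmod (f n z - k z) < 2 * A * (\<eta> * M)" "cmod (f m z - k z) < 2 * A * (\<eta> * M)"
            using nm by (auto intro!: N)
          then have "cmod (f n z - f m z) \<le> 4 * A * (\<eta> * M)"
            using norm_triangle_ineq4[of "f n z - k z" "f m z - k z"] by simp
          then have "cmod (h z) \<le> \<eta> * M"
            unfolding h_def qn using A by (simp add: pos_divide_le_eq mult.commute mult.left_commute)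
          then have "\<Psi> (cmod (h z) / \<epsilon>) \<le> \<Psi> (\<eta> * M / \<epsilon>)" using \<epsilon> by (intro mono divide_right_mono) auto
          then have "ennreal (\<Psi> (cmod (h z) / \<epsilon>)) \<le> ennreal (1 / 4)" using small by (intro ennreal_leI) linarith
          then show ?thesis by (rule add_increasing2[OF zero_le add_increasing[OF zero_le]])
        next
          case False
          have "\<Psi> (cmod (h z) / \<epsilon>) \<le> \<Psi> (M / \<epsilon>)" using hM \<epsilon> by (intro mono divide_right_mono) auto
          then have "ennreal (\<Psi> (cmod (h z) / \<epsilon>)) \<le> ennreal c" using c by (intro ennreal_leI) linarith
          then show ?thesis using False z by (intro add_increasing) auto
        qed
      qed
    qed
    also have "\<dots> = ((\<integral>\<^sup>+ z. ennreal (\<Psi> (cmod (h z) / \<epsilon>)) * indicator {z. M < cmod (h z)} z \<partial>disc_measure) + ennreal (1 / 4))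
        + ennreal c * emeasure disc_measure (ball 0 1 - ball 0 \<rho>)"
    proof -
      have "(\<lambda>z. ennreal (\<Psi> (cmod (h z) / \<epsilon>)) * indicator {z. M < cmod (h z)} z + ennreal (1 / 4)) \<in> borel_measurable disc_measure"
        using m1 by (intro borel_measurable_add borel_measurable_const)
      moreover have "(\<lambda>z. ennreal c * indicator (ball 0 1 - ball 0 \<rho>) z) \<in> borel_measurable disc_measure"
        using sets by (intro borel_measurable_times_ennreal borel_measurable_const borel_measurable_indicator)
      ultimately have "(\<integral>\<^sup>+ z. (ennreal (\<Psi> (cmod (h z) / \<epsilon>)) * indicator {z. M < cmod (h z)} z + ennreal (1 / 4))
            + ennreal c * indicator (ball 0 1 - ball 0 \<rho>) z \<partial>disc_measure)
          = (\<integral>\<^sup>+ z. ennreal (\<Psi> (cmod (h z) / \<epsilon>)) * indicator {z. M < cmod (h z)} z + ennreal (1 / 4) \<partial>disc_measure)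
            + (\<integral>\<^sup>+ z. ennreal c * indicator (ball 0 1 - ball 0 \<rho>) z \<partial>disc_measure)"
        by (rule nn_integral_add)
      also have "(\<integral>\<^sup>+ z. ennreal (\<Psi> (cmod (h z) / \<epsilon>)) * indicator {z. M < cmod (h z)} z + ennreal (1 / 4) \<partial>disc_measure)
          = (\<integral>\<^sup>+ z. ennreal (\<Psi> (cmod (h z) / \<epsilon>)) * indicator {z. M < cmod (h z)} z \<partial>disc_measure) + (\<integral>\<^sup>+ z. ennreal (1 / 4) \<partial>disc_measure)"
        by (rule nn_integral_add[OF m1 borel_measurable_const])
      also have "(\<integral>\<^sup>+ z. ennreal (1 / 4) \<partial>disc_measure) = ennreal (1 / 4)"
        using disc.emeasure_space_1 by simp
      also have "(\<integral>\<^sup>+ z. ennreal c * indicator (ball 0 1 - ball 0 \<rho>) z \<partial>disc_measure) = ennreal c * emeasure disc_measure (ball 0 1 - ball 0 \<rho>)"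
        by (rule nn_integral_cmult_indicator[OF sets])
      finally show ?thesis .
    qed
    also have "emeasure disc_measure (ball 0 1 - ball 0 \<rho>) = ennreal (1 / (4 * c))"
    proof -
      have "emeasure disc_measure (ball 0 1 - ball 0 \<rho>) = emeasure disc_measure (ball 0 1) - emeasure disc_measure (ball 0 \<rho>)"
        using emeasure_compl[OF sets\<rho>] disc.emeasure_finite by simp
      also have "\<dots> = ennreal 1 - ennreal (1 - 1 / (4 * c))"
        using \<rho> emeasure_disc[of \<rho>] emeasure_disc[of 1] by (simp add: \<rho>2)
      also have "\<dots> = ennreal (1 - (1 - 1 / (4 * c)))" using c by (intro ennreal_minus) (simp add: field_simps)
      finally show ?thesis by simp
    qed
    also have "((\<integral>\<^sup>+ z. ennreal (\<Psi> (cmod (h z) / \<epsilon>)) * indicator {z. M < cmod (h z)} z \<partial>disc_measure) + ennreal (1 / 4))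
        + ennreal c * ennreal (1 / (4 * c)) \<le> (ennreal (1 / 2) + ennreal (1 / 4)) + ennreal c * ennreal (1 / (4 * c))"
      by (intro add_mono tail[OF hP \<beta>] order_refl)
    also have "\<dots> = ennreal ((1 / 2 + 1 / 4) + c * (1 / (4 * c)))"
      using c by (simp only: ennreal_mult'[symmetric] ennreal_plus[symmetric])
        (subst ennreal_plus[symmetric]; simp)
    also have "(1 / 2 + 1 / 4) + c * (1 / (4 * c)) = 1" using c by (simp add: field_simps)
    finally show ?thesis by simp
  qed
  then show ?thesis by blast
qed

text \<open>Montel's theorem gives a locally uniformly convergent subsequence. Its differences have small
  modular by the preceding lemma, and Fatou's lemma compares it with its limit.\<close>

lemma unit_ball_subsequence:
  assumes A: "1 < A" and x0: "0 < x0" and ratio: "mono_on {x0..} (\<lambda>x. \<Psi> (A * x) / \<Psi> x)"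
    and growth: "\<And>B. 1 < B \<Longrightarrow> ((\<lambda>x. \<Psi> (B * x) / (\<Psi> x)\<^sup>2) \<longlongrightarrow> 0) at_top"
    and f: "\<And>n. f n \<in> closed_unit_ball (Hardy_Orlicz \<Psi>) (Hardy_Orlicz_norm \<Psi>)"
    and B: "\<And>n. f n \<in> Bergman_Orlicz \<Psi>"
  obtains l r where "l \<in> Bergman_Orlicz \<Psi>" "strict_mono (r :: nat \<Rightarrow> nat)"
    "(\<lambda>n. Bergman_Orlicz_norm \<Psi> (\<lambda>z. f (r n) z - l z)) \<longlonglongrightarrow> 0"
proof -
  note P = unit_ball_boundary_values(1)[OF f] and b = unit_ball_boundary_values(2)[OF f]
  have hol: "f n holomorphic_on ball 0 1" for n using B by (rule Bergman_Orlicz_D)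
  have bd: "\<exists>C. \<forall>h\<in>range f. \<forall>z\<in>K. cmod (h z) \<le> C" if K: "compact K" "K \<subseteq> ball 0 1" for K
  proof -
    obtain \<rho> where \<rho>: "\<rho> < 1" "\<And>z. z \<in> K \<Longrightarrow> cmod z \<le> \<rho>" using compact_subset_disc[OF K] by blast
    obtain Y where Y: "0 < Y" "2 / (1 - \<rho>) \<le> \<Psi> Y" using ex_ge by blast
    have "cmod (f n z) \<le> 2 * Y" if "z \<in> K" for n z
    proof -
      have zr: "cmod z \<le> \<rho>" "z \<in> ball 0 1" using K \<rho> that by auto
      then have "2 / (1 - cmod z) \<le> 2 / (1 - \<rho>)" using \<rho>(1) by (intro divide_left_mono) auto
      then show ?thesis using Y by (intro Poisson_integral_bound[OF P b _ _ zr(2)]) auto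
    qed
    then show ?thesis by blast
  qed
  obtain k r where k: "k holomorphic_on ball 0 1" and r: "strict_mono (r :: nat \<Rightarrow> nat)"
    and lim: "\<And>z. z \<in> ball 0 1 \<Longrightarrow> (\<lambda>n. f (r n) z) \<longlonglongrightarrow> k z"
    and unif: "\<And>K. compact K \<Longrightarrow> K \<subseteq> ball 0 1 \<Longrightarrow> uniform_limit K (f \<circ> r) k sequentially"
  proof (rule Montel[of "ball 0 1" "range f" f, OF open_ball _ bd order_refl])
    show "h holomorphic_on ball 0 1" if "h \<in> range f" for h using that hol by auto
  qed (blast intro: that)+
  define l where "l z = (if z \<in> ball 0 1 then k z else 0)" for z
  have lhol: "l holomorphic_on ball 0 1"
    using k by (rule holomorphic_transform) (simp add: l_def)
  have meas: "f n \<in> borel_measurable disc_measure" "l \<in> borel_measurable disc_measure" for n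
    using holomorphic_on_imp_continuous_on[OF hol] holomorphic_on_imp_continuous_on[OF lhol]
    by (auto intro: continuous_imp_measurable_disc)
  have Cauchy: "\<exists>N. \<forall>n\<ge>N. \<forall>m\<ge>N. (\<integral>\<^sup>+ z. ennreal (\<Psi> (cmod (f (r n) z - f (r m) z) / e)) \<partial>disc_measure) \<le> 1"
    if e: "0 < e" for e
  proof (rule unit_ball_modular_Cauchy[where k = k, OF A x0 ratio growth f _ e])
    fix \<rho> :: real assume "0 \<le> \<rho>" "\<rho> < 1"
    then have "uniform_limit (cball 0 \<rho>) (f \<circ> r) k sequentially" by (intro unif) auto
    then show "uniform_limit (cball 0 \<rho>) (\<lambda>n. f (r n)) k sequentially" by (simp only: o_def)
  qed
  have close: "\<exists>N. \<forall>n\<ge>N. (\<integral>\<^sup>+ z. ennreal (\<Psi> (cmod (f (r n) z - l z) / e)) \<partial>disc_measure) \<le> 1" if e: "0 < e" for e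
  proof -
    obtain N where N: "\<And>n m. N \<le> n \<Longrightarrow> N \<le> m \<Longrightarrow>
        (\<integral>\<^sup>+ z. ennreal (\<Psi> (cmod (f (r n) z - f (r m) z) / e)) \<partial>disc_measure) \<le> 1"
      using Cauchy[OF e] by blast
    have "(\<integral>\<^sup>+ z. ennreal (\<Psi> (cmod (f (r n) z - l z) / e)) \<partial>disc_measure) \<le> 1" if n: "N \<le> n" for n
    proof -
      have "(\<integral>\<^sup>+ z. ennreal (\<Psi> (cmod (f (r n) z - l z) / e)) \<partial>disc_measure)
          = (\<integral>\<^sup>+ z. liminf (\<lambda>m. ennreal (\<Psi> (cmod (f (r n) z - f (r m) z) / e))) \<partial>disc_measure)"
      proof (rule nn_integral_cong)
        fix z assume "z \<in> space disc_measure"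
        then have z: "z \<in> ball 0 1" by simp
        then have "(\<lambda>m. f (r m) z) \<longlonglongrightarrow> l z" using lim[OF z] by (simp add: l_def)
        then have "(\<lambda>m. cmod (f (r n) z - f (r m) z) / e) \<longlonglongrightarrow> cmod (f (r n) z - l z) / e"
          using e by (intro tendsto_intros) auto
        then have "(\<lambda>m. \<Psi> \<bar>cmod (f (r n) z - f (r m) z) / e\<bar>) \<longlonglongrightarrow> \<Psi> \<bar>cmod (f (r n) z - l z) / e\<bar>"
          by (rule continuous_on_tendsto_compose[OF continuous_abs]) simp_all
        then have "(\<lambda>m. ennreal (\<Psi> (cmod (f (r n) z - f (r m) z) / e))) \<longlonglongrightarrow> ennreal (\<Psi> (cmod (f (r n) z - l z) / e))"
          using e by (intro tendsto_ennrealI) simp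
        then show "ennreal (\<Psi> (cmod (f (r n) z - l z) / e)) = liminf (\<lambda>m. ennreal (\<Psi> (cmod (f (r n) z - f (r m) z) / e)))"
          by (intro lim_imp_Liminf[symmetric]) auto
      qed
      also have "\<dots> \<le> liminf (\<lambda>m. \<integral>\<^sup>+ z. ennreal (\<Psi> (cmod (f (r n) z - f (r m) z) / e)) \<partial>disc_measure)"
        using e by (intro nn_integral_liminf measurable_modular borel_measurable_diff meas) auto
      also have "\<dots> \<le> 1"
        using N[OF n] by (intro Liminf_le) (auto simp: eventually_sequentially)
      finally show ?thesis .
    qed
    then show ?thesis by blast
  qed
  have B': "f n \<in> Orlicz_space \<Psi> disc_measure" for n using B by (rule Bergman_Orlicz_D)
  have lO: "l \<in> Orlicz_space \<Psi> disc_measure"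
  proof -
    obtain N where N: "(\<integral>\<^sup>+ z. ennreal (\<Psi> (cmod (f (r N) z - l z) / 1)) \<partial>disc_measure) \<le> 1"
      using close[of 1] by auto
    have "(\<lambda>z. f (r N) z - l z) \<in> Orlicz_space \<Psi> disc_measure"
      using le_less_trans[OF N ennreal_one_less_top]
      by (intro Orlicz_spaceI[of _ _ 1] borel_measurable_diff meas) auto
    from Luxemburg_diff(1)[OF B'[of "r N"] this] show ?thesis by simp
  qed
  have "l \<in> Bergman_Orlicz \<Psi>"
    using lO lhol by (auto simp: Bergman_Orlicz_def analytic_on_disc_def analytic_on_open l_def)
  moreover have "(\<lambda>n. Bergman_Orlicz_norm \<Psi> (\<lambda>z. f (r n) z - l z)) \<longlonglongrightarrow> 0"
  proof (rule LIMSEQ_I)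
    fix e :: real assume e: "0 < e"
    obtain N where N: "\<And>n. N \<le> n \<Longrightarrow> (\<integral>\<^sup>+ z. ennreal (\<Psi> (cmod (f (r n) z - l z) / (e / 2))) \<partial>disc_measure) \<le> 1"
      using close[of "e / 2"] e by auto
    have "norm (Bergman_Orlicz_norm \<Psi> (\<lambda>z. f (r n) z - l z) - 0) < e" if "N \<le> n" for n
    proof -
      have "Bergman_Orlicz_norm \<Psi> (\<lambda>z. f (r n) z - l z) \<le> e / 2"
        unfolding Bergman_Orlicz_norm_def using e by (intro Luxemburg_le N that) auto
      moreover have "0 \<le> Bergman_Orlicz_norm \<Psi> (\<lambda>z. f (r n) z - l z)"
        unfolding Bergman_Orlicz_norm_def by (intro Luxemburg_nonneg Luxemburg_diff(1) B' lO)
      ultimately show ?thesis using e by simp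
    qed
    then show "\<exists>N. \<forall>n\<ge>N. norm (Bergman_Orlicz_norm \<Psi> (\<lambda>z. f (r n) z - l z) - 0) < e" by blast
  qed
  ultimately show thesis using r by (intro that)
qed

end

section \<open>The norm and the weak topology\<close>

lemma compactin_sequence_cluster:
  assumes "compactin X K" "\<And>n. s n \<in> K"
  shows "\<exists>x\<in>K. \<forall>U. openin X U \<and> x \<in> U \<longrightarrow> (\<exists>\<^sub>F n in sequentially. s n \<in> U)"
proof (rule ccontr)
  assume "\<not> ?thesis"
  then have "\<forall>x\<in>K. \<exists>U. openin X U \<and> x \<in> U \<and> (\<forall>\<^sub>F n in sequentially. s n \<notin> U)"
    unfolding not_frequently[symmetric] by blast
  then obtain U where U: "\<forall>x\<in>K. openin X (U x) \<and> x \<in> U x \<and> (\<forall>\<^sub>F n in sequentially. s n \<notin> U x)"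
    by (rule bchoice[THEN exE])
  have "\<exists>F. finite F \<and> F \<subseteq> U ` K \<and> K \<subseteq> \<Union>F"
    using U by (intro compactinD[OF assms(1)]) blast+
  then obtain F where F: "finite F" "F \<subseteq> U ` K" "K \<subseteq> \<Union>F" by blast
  have "\<forall>\<^sub>F n in sequentially. \<forall>V\<in>F. s n \<notin> V"
    using F(1) by (rule eventually_ball_finite) (use F(2) U in blast)
  then obtain n where "\<forall>V\<in>F. s n \<notin> V" using eventually_happens'[OF sequentially_bot] by blast
  then show False using assms(2)[of n] F(3) by blast
qed

lemma topspace_weak_topology: "topspace (weak_topology V N) = V"
proof -
  have "(\<lambda>f. 0) \<in> dual_space V N" by (auto simp: dual_space_def intro: exI[of _ 0])
  then have "V \<in> {{f \<in> V. \<phi> f \<in> U} |\<phi> U. \<phi> \<in> dual_space V N \<and> open U}"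
    by (auto intro!: exI[of _ "\<lambda>f. 0"] exI[of _ UNIV])
  then show ?thesis unfolding weak_topology_def topology_generated_by_topspace by blast
qed

lemma openin_weak_topology:
  assumes "\<phi> \<in> dual_space V N" "open U"
  shows "openin (weak_topology V N) {f \<in> V. \<phi> f \<in> U}"
  unfolding weak_topology_def by (rule topology_generated_by_Basis) (use assms in blast)

context orlicz
begin

abbreviation "Bergman \<equiv> Bergman_Orlicz \<Psi>"
abbreviation "Bergman_norm \<equiv> Bergman_Orlicz_norm \<Psi>"

lemma Bergman_Orlicz_I:
  assumes "f holomorphic_on ball 0 1" "f \<in> Orlicz_space \<Psi> disc_measure" "\<And>z. z \<notin> ball 0 1 \<Longrightarrow> f z = 0"
  shows "f \<in> Bergman"
  using assms by (simp add: Bergman_Orlicz_def analytic_on_disc_def analytic_on_open)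

lemma Bergman_Orlicz_diff: "f \<in> Bergman \<Longrightarrow> g \<in> Bergman \<Longrightarrow> (\<lambda>z. f z - g z) \<in> Bergman"
proof (intro Bergman_Orlicz_I holomorphic_on_diff Luxemburg_diff(1))
  fix z :: complex assume "f \<in> Bergman" "g \<in> Bergman" "z \<notin> ball 0 1"
  then have "f z = 0" "g z = 0" by (blast intro: Bergman_Orlicz_D(3))+
  then show "f z - g z = 0" by simp
qed (blast intro: Bergman_Orlicz_D)+

lemma Bergman_Orlicz_cmult: "f \<in> Bergman \<Longrightarrow> (\<lambda>z. c * f z) \<in> Bergman"
proof (intro Bergman_Orlicz_I holomorphic_on_mult holomorphic_on_const Orlicz_space_cmult)
  fix z :: complex assume "f \<in> Bergman" "z \<notin> ball 0 1"
  then have "f z = 0" by (rule Bergman_Orlicz_D(3))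
  then show "c * f z = 0" by simp
qed (blast intro: Bergman_Orlicz_D)+

lemma Bergman_Orlicz_add: "f \<in> Bergman \<Longrightarrow> g \<in> Bergman \<Longrightarrow> (\<lambda>z. f z + g z) \<in> Bergman"
  using Bergman_Orlicz_diff[OF _ Bergman_Orlicz_cmult[of g "-1"], of f] by simp

lemma Bergman_Orlicz_norm_nonneg: "f \<in> Bergman \<Longrightarrow> 0 \<le> Bergman_norm f"
  unfolding Bergman_Orlicz_norm_def by (intro Luxemburg_nonneg Bergman_Orlicz_D)

lemma evaluation_bounded: "\<exists>K. \<forall>h\<in>Bergman. cmod (h z) \<le> K * Bergman_norm h"
proof (cases "z \<in> ball 0 1")
  case True
  obtain Y where "0 < Y" "1 / (1 - cmod z)\<^sup>2 \<le> \<Psi> Y" using ex_ge by blast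
  then show ?thesis
    using True by (intro exI[of _ Y] ballI Bergman_Orlicz_evaluation[where \<delta>="1 - cmod z"]) auto
next
  case False
  then show ?thesis by (intro exI[of _ 0]) (auto dest: Bergman_Orlicz_D(3))
qed

lemma evaluation_dual: "(\<lambda>h. h z) \<in> dual_space Bergman Bergman_norm"
  unfolding dual_space_def using evaluation_bounded[of z] by simp

lemma Metric_space_Bergman: "Metric_space Bergman (norm_dist Bergman Bergman_norm)"
proof
  fix f g h
  show "0 \<le> norm_dist Bergman Bergman_norm f g"
    unfolding norm_dist_def using Bergman_Orlicz_norm_nonneg[OF Bergman_Orlicz_diff] by auto
  show "norm_dist Bergman Bergman_norm f g = norm_dist Bergman Bergman_norm g f"
    unfolding norm_dist_def Bergman_Orlicz_norm_def Luxemburg_norm_def by (simp add: norm_minus_commute conj_commute)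
  assume f: "f \<in> Bergman" and g: "g \<in> Bergman"
  show "norm_dist Bergman Bergman_norm f g = 0 \<longleftrightarrow> f = g"
  proof
    assume eq: "norm_dist Bergman Bergman_norm f g = 0"
    show "f = g"
    proof
      fix z
      obtain K where K: "\<And>h. h \<in> Bergman \<Longrightarrow> cmod (h z) \<le> K * Bergman_norm h" using evaluation_bounded by blast
      have "cmod (f z - g z) \<le> K * Bergman_norm (\<lambda>z. f z - g z)" by (rule K[OF Bergman_Orlicz_diff[OF f g]])
      also have "Bergman_norm (\<lambda>z. f z - g z) = 0" using eq f g by (simp add: norm_dist_def)
      finally show "f z = g z" by simp
    qed
  next
    assume "f = g"
    have "Bergman_norm (\<lambda>z. 0) \<le> c" if "0 < c" for c
      unfolding Bergman_Orlicz_norm_def using that by (intro Luxemburg_le) auto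
    then have "Bergman_norm (\<lambda>z. 0) \<le> 0" by (rule dense_ge)
    moreover have "0 \<le> Bergman_norm (\<lambda>z. 0)" using Bergman_Orlicz_norm_nonneg[OF Bergman_Orlicz_diff[OF f f]] by simp
    ultimately show "norm_dist Bergman Bergman_norm f g = 0" using \<open>f = g\<close> by (simp add: norm_dist_def)
  qed
  assume h: "h \<in> Bergman"
  have "Luxemburg_norm \<Psi> disc_measure (\<lambda>z. (f z - g z) - (h z - g z))
      \<le> Luxemburg_norm \<Psi> disc_measure (\<lambda>z. f z - g z) + Luxemburg_norm \<Psi> disc_measure (\<lambda>z. h z - g z)"
    by (intro Luxemburg_diff Bergman_Orlicz_D f g h)
  moreover have "Luxemburg_norm \<Psi> disc_measure (\<lambda>z. h z - g z) = Luxemburg_norm \<Psi> disc_measure (\<lambda>z. g z - h z)"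
    unfolding Luxemburg_norm_def by (simp add: norm_minus_commute)
  ultimately show "norm_dist Bergman Bergman_norm f h \<le> norm_dist Bergman Bergman_norm f g + norm_dist Bergman Bergman_norm g h"
    using f g h by (simp add: norm_dist_def Bergman_Orlicz_norm_def)
qed

interpretation B: Metric_space Bergman "norm_dist Bergman Bergman_norm"
  by (rule Metric_space_Bergman)

lemma norm_topology_Bergman: "norm_topology Bergman Bergman_norm = B.mtopology"
  by (simp add: norm_topology_def)

lemma Hausdorff_weak_topology: "Hausdorff_space (weak_topology Bergman Bergman_norm)"
  unfolding Hausdorff_space_def topspace_weak_topology
proof (intro allI impI, elim conjE)
  fix f g assume f: "f \<in> Bergman" and g: "g \<in> Bergman" and "f \<noteq> g"
  then obtain z where "f z \<noteq> g z" by auto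
  from hausdorff[OF this] obtain U W where UW: "open U" "open W" "f z \<in> U" "g z \<in> W" "U \<inter> W = {}"
    by (elim exE conjE)
  show "\<exists>U W. openin (weak_topology Bergman Bergman_norm) U \<and> openin (weak_topology Bergman Bergman_norm) W \<and> f \<in> U \<and> g \<in> W \<and> disjnt U W"
  proof (intro exI conjI)
    show "openin (weak_topology Bergman Bergman_norm) {h \<in> Bergman. h z \<in> U}"
      by (rule openin_weak_topology[OF evaluation_dual UW(1)])
    show "openin (weak_topology Bergman Bergman_norm) {h \<in> Bergman. h z \<in> W}"
      by (rule openin_weak_topology[OF evaluation_dual UW(2)])
    show "disjnt {h \<in> Bergman. h z \<in> U} {h \<in> Bergman. h z \<in> W}" using UW(5) unfolding disjnt_def by blast
  qed (use UW(3,4) f g in blast)+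
qed

lemma continuous_map_norm_weak: "continuous_map (norm_topology Bergman Bergman_norm) (weak_topology Bergman Bergman_norm) (\<lambda>f. f)"
  unfolding weak_topology_def
proof (rule continuous_on_generated_topo)
  fix S assume "S \<in> {{f \<in> Bergman. \<phi> f \<in> U} |\<phi> U. \<phi> \<in> dual_space Bergman Bergman_norm \<and> open U}"
  then obtain \<phi> U where S: "S = {f \<in> Bergman. \<phi> f \<in> U}" and \<phi>: "\<phi> \<in> dual_space Bergman Bergman_norm" and U: "open U" by blast
  obtain K where K: "\<And>f. f \<in> Bergman \<Longrightarrow> cmod (\<phi> f) \<le> K * Bergman_norm f" using \<phi> unfolding dual_space_def by blast
  have add: "\<phi> (\<lambda>z. f z + g z) = \<phi> f + \<phi> g" if "f \<in> Bergman" "g \<in> Bergman" for f g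
    using \<phi> that unfolding dual_space_def by blast
  have diff: "\<phi> (\<lambda>z. g z - f z) = \<phi> g - \<phi> f" if f: "f \<in> Bergman" and g: "g \<in> Bergman" for f g
  proof -
    have "\<phi> g = \<phi> (\<lambda>z. (g z - f z) + f z)" by simp
    also have "\<dots> = \<phi> (\<lambda>z. g z - f z) + \<phi> f"
      by (rule add[OF Bergman_Orlicz_diff[OF g f] f])
    finally show ?thesis by simp
  qed
  have "openin B.mtopology S"
    unfolding B.openin_mtopology
  proof (intro conjI allI impI)
    show "S \<subseteq> Bergman" unfolding S by blast
    fix f assume "f \<in> S"
    then have f: "f \<in> Bergman" "\<phi> f \<in> U" unfolding S by blast+
    obtain e where e: "0 < e" "ball (\<phi> f) e \<subseteq> U" using U f(2) by (meson openE)
    define r where "r = e / (\<bar>K\<bar> + 1)"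
    have r: "0 < r" using e by (simp add: r_def)
    have "B.mball f r \<subseteq> S"
    proof
      fix g assume "g \<in> B.mball f r"
      then have g: "g \<in> Bergman" "Bergman_norm (\<lambda>z. f z - g z) < r" using f(1) by (auto simp: norm_dist_def)
      have nn: "0 \<le> Bergman_norm (\<lambda>z. f z - g z)" by (rule Bergman_Orlicz_norm_nonneg[OF Bergman_Orlicz_diff[OF f(1) g(1)]])
      have "cmod (\<phi> f - \<phi> g) \<le> K * Bergman_norm (\<lambda>z. f z - g z)"
        using K[OF Bergman_Orlicz_diff[OF f(1) g(1)]] unfolding diff[OF g(1) f(1)] .
      also have "\<dots> \<le> (\<bar>K\<bar> + 1) * Bergman_norm (\<lambda>z. f z - g z)" using nn by (intro mult_right_mono) auto
      also have "\<dots> < (\<bar>K\<bar> + 1) * r" using g(2) by (intro mult_strict_left_mono) auto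
      also have "\<dots> = e" by (simp add: r_def)
      finally have "\<phi> g \<in> U" using e(2) by (auto simp: dist_norm)
      then show "g \<in> S" using g(1) by (simp add: S)
    qed
    then show "\<exists>r>0. B.mball f r \<subseteq> S" using r by blast
  qed
  moreover have "(\<lambda>f. f) -` S \<inter> topspace (norm_topology Bergman Bergman_norm) = S"
    by (auto simp: norm_topology_Bergman S)
  ultimately show "openin (norm_topology Bergman Bergman_norm) ((\<lambda>f. f) -` S \<inter> topspace (norm_topology Bergman Bergman_norm))"
    by (simp add: norm_topology_Bergman)
next
  show "(\<lambda>f. f) ` topspace (norm_topology Bergman Bergman_norm) \<subseteq> \<Union>{{f \<in> Bergman. \<phi> f \<in> U} |\<phi> U. \<phi> \<in> dual_space Bergman Bergman_norm \<and> open U}"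
  proof -
    have *: "topspace (weak_topology Bergman Bergman_norm) = \<Union>{{f \<in> Bergman. \<phi> f \<in> U} |\<phi> U. \<phi> \<in> dual_space Bergman Bergman_norm \<and> open U}"
      by (simp only: weak_topology_def topology_generated_by_topspace)
    show ?thesis
      unfolding *[symmetric] topspace_weak_topology norm_topology_Bergman B.topspace_mtopology image_ident
      by (rule order_refl)
  qed
qed

text \<open>The norm closure, being norm compact, is weakly compact and hence weakly closed, so it contains the
  weak closure.\<close>

lemma relatively_compact_norm_imp_weak:
  assumes "relatively_compact_in (norm_topology Bergman Bergman_norm) S"
  shows "relatively_compact_in (weak_topology Bergman Bergman_norm) S"
proof -
  let ?K = "norm_topology Bergman Bergman_norm closure_of S"
  have S: "S \<subseteq> topspace (norm_topology Bergman Bergman_norm)" and K: "compactin (norm_topology Bergman Bergman_norm) ?K"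
    using assms by (auto simp: relatively_compact_in_def)
  have K': "compactin (weak_topology Bergman Bergman_norm) ?K"
    using image_compactin[OF K continuous_map_norm_weak] by simp
  then have "closedin (weak_topology Bergman Bergman_norm) ?K"
    by (rule compactin_imp_closedin[OF Hausdorff_weak_topology])
  then have "weak_topology Bergman Bergman_norm closure_of S \<subseteq> ?K"
    by (intro closure_of_minimal closure_of_subset S)
  then have "compactin (weak_topology Bergman Bergman_norm) (weak_topology Bergman Bergman_norm closure_of S)"
    by (rule closed_compactin[OF K' _ closedin_closure_of])
  moreover have "S \<subseteq> topspace (weak_topology Bergman Bergman_norm)"
    using S unfolding topspace_weak_topology norm_topology_Bergman B.topspace_mtopology .
  ultimately show ?thesis unfolding relatively_compact_in_def by (rule conjI[rotated])
qed

lemma relatively_compact_normI: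
  assumes S: "S \<subseteq> Bergman"
    and seq: "\<And>f :: nat \<Rightarrow> complex \<Rightarrow> complex. range f \<subseteq> S \<Longrightarrow>
      \<exists>l r. l \<in> Bergman \<and> strict_mono (r :: nat \<Rightarrow> nat) \<and> (\<lambda>n. Bergman_norm (\<lambda>z. f (r n) z - l z)) \<longlonglongrightarrow> 0"
  shows "relatively_compact_in (norm_topology Bergman Bergman_norm) S"
proof -
  have "compactin B.mtopology (B.mtopology closure_of S)"
    unfolding B.compact_closure_of_eq_Bolzano_Weierstrass
  proof (intro allI impI, elim conjE)
    fix T assume "infinite T" and T: "T \<subseteq> S"
    then obtain f :: "nat \<Rightarrow> complex \<Rightarrow> complex" where f: "inj f" "range f \<subseteq> T"
      using infinite_countable_subset by blast
    obtain l r where l: "l \<in> Bergman" and r: "strict_mono (r :: nat \<Rightarrow> nat)" and lim: "(\<lambda>n. Bergman_norm (\<lambda>z. f (r n) z - l z)) \<longlonglongrightarrow> 0"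
      using seq[of f] f T by blast
    have "l \<in> B.mtopology derived_set_of T"
      unfolding B.metric_derived_set_of
    proof (intro CollectI conjI allI impI l)
      fix e :: real assume "0 < e"
      then obtain N where N: "\<And>n. N \<le> n \<Longrightarrow> Bergman_norm (\<lambda>z. f (r n) z - l z) < e"
        using order_tendstoD(2)[OF lim] by (auto simp: eventually_sequentially)
      have "f (r N) \<noteq> f (r (Suc N))" using f(1) r by (simp add: inj_eq strict_mono_eq)
      then obtain n where n: "N \<le> n" "f (r n) \<noteq> l" by (metis le_Suc_eq order_refl)
      have "f (r n) \<in> T" using f(2) by auto
      moreover have "f (r n) \<in> B.mball l e"
        using N[OF n(1)] l T S \<open>f (r n) \<in> T\<close> B.commute[of l "f (r n)"] by (auto simp: norm_dist_def)
      ultimately show "\<exists>y\<in>T. y \<noteq> l \<and> y \<in> B.mball l e" using n(2) by blast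
    qed
    then show "B.mtopology derived_set_of T \<noteq> {}" by blast
  qed
  with S show ?thesis
    unfolding relatively_compact_in_def norm_topology_Bergman B.topspace_mtopology by (rule conjI)
qed

end

section \<open>Test functions and the failure of weak compactness\<close>

text \<open>A bump of height about 1 and width \<open>\<delta>\<close> at the boundary point 1. Its modulus is \<open>w\<^sup>4\<close> with
  \<open>w = \<delta> / \<bar>1 - (1 - \<delta>) z\<bar>\<close>; the Poisson kernel at \<open>1 - \<delta>\<close> is a multiple of \<open>w\<^sup>2\<close>, so that \<open>w\<^sup>2\<close> has
  mean at most \<open>\<delta>\<close> over the circle, and the exponent 4 leaves a further factor \<open>w\<^sup>2\<close> to spare.\<close>

definition bump :: "real \<Rightarrow> complex \<Rightarrow> complex"
  where "bump \<delta> z = (of_real \<delta> / (1 - of_real (1 - \<delta>) * z)) ^ 4"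

definition bump_width :: "real \<Rightarrow> complex \<Rightarrow> real"
  where "bump_width \<delta> z = \<delta> / cmod (1 - of_real (1 - \<delta>) * z)"

lemma bump_denominator:
  assumes "0 < \<delta>" "\<delta> < 1" "cmod z \<le> 1"
  shows "\<delta> \<le> cmod (1 - of_real (1 - \<delta>) * z)"
proof -
  have "cmod (of_real (1 - \<delta>) * z) = (1 - \<delta>) * cmod z" unfolding norm_mult norm_of_real using assms by simp
  also have "\<dots> \<le> (1 - \<delta>) * 1" using assms by (intro mult_left_mono) auto
  finally show ?thesis using norm_triangle_ineq2[of 1 "of_real (1 - \<delta>) * z"] by simp
qed

lemma bump_width:
  assumes "0 < \<delta>" "\<delta> < 1" "cmod z \<le> 1"
  shows "0 \<le> bump_width \<delta> z" "bump_width \<delta> z \<le> 1" "cmod (bump \<delta> z) = bump_width \<delta> z ^ 4"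
  using bump_denominator[OF assms] assms
  by (auto simp: bump_width_def bump_def norm_power norm_divide divide_le_eq)

lemma bump_holomorphic:
  assumes "0 < \<delta>" "\<delta> < 1"
  shows "bump \<delta> holomorphic_on ball 0 (1 / (1 - \<delta>))"
proof -
  have "1 - of_real (1 - \<delta>) * z \<noteq> 0" if "z \<in> ball 0 (1 / (1 - \<delta>))" for z :: complex
  proof
    assume "1 - of_real (1 - \<delta>) * z = 0"
    then have "cmod (of_real (1 - \<delta>) * z) = 1" by (metis eq_iff_diff_eq_0 norm_one)
    then have "(1 - \<delta>) * cmod z = 1" unfolding norm_mult norm_of_real using assms by simp
    moreover have "cmod z < 1 / (1 - \<delta>)" using that by simp
    ultimately show False using assms by (simp add: field_simps)
  qed
  then show ?thesis unfolding bump_def by (intro holomorphic_intros)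
qed

lemma bump_width_mean:
  assumes "0 < \<delta>" "\<delta> < 1"
  shows "continuous_on (sphere 0 1) (bump_width \<delta>)"
    and "(\<integral>\<zeta>. (bump_width \<delta> \<zeta>)\<^sup>2 \<partial>circle_measure) \<le> \<delta>"
proof -
  have r: "of_real (1 - \<delta>) \<in> ball (0::complex) 1" using assms by (simp del: of_real_diff)
  have "cmod (1 - of_real (1 - \<delta>) * \<zeta>) \<noteq> 0" if "\<zeta> \<in> sphere 0 1" for \<zeta> :: complex
    using bump_denominator[OF assms, of \<zeta>] that assms by auto
  then show "continuous_on (sphere 0 1) (bump_width \<delta>)"
    unfolding bump_width_def by (intro continuous_intros) auto
  have eq: "(bump_width \<delta> \<zeta>)\<^sup>2 = \<delta> / (2 - \<delta>) * Poisson_kernel (of_real (1 - \<delta>)) \<zeta>"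
    if "\<zeta> \<in> space circle_measure" for \<zeta>
  proof -
    have one: "cmod \<zeta> = 1" using that by simp
    then have "\<zeta> * cnj \<zeta> = 1" by (simp add: complex_norm_square[symmetric])
    then have "\<zeta> - of_real (1 - \<delta>) = \<zeta> * cnj (1 - of_real (1 - \<delta>) * \<zeta>)" by (simp add: algebra_simps)
    then have c: "cmod (\<zeta> - of_real (1 - \<delta>)) = cmod (1 - of_real (1 - \<delta>) * \<zeta>)"
      by (metis complex_mod_cnj mult_1 norm_mult one)
    have cr: "cmod (of_real (1 - \<delta>)) = 1 - \<delta>" using assms by (simp del: of_real_diff)
    have sq: "1 - (1 - \<delta>)\<^sup>2 = \<delta> * (2 - \<delta>)" by (simp add: power2_eq_square algebra_simps)
    have "Poisson_kernel (of_real (1 - \<delta>)) \<zeta> = (\<delta> * (2 - \<delta>)) / (cmod (1 - of_real (1 - \<delta>) * \<zeta>))\<^sup>2"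
      unfolding Poisson_kernel_def c cr sq ..
    then show ?thesis using assms by (simp add: bump_width_def power_divide power2_eq_square)
  qed
  have "(\<integral>\<zeta>. (bump_width \<delta> \<zeta>)\<^sup>2 \<partial>circle_measure) = (\<integral>\<zeta>. \<delta> / (2 - \<delta>) * Poisson_kernel (of_real (1 - \<delta>)) \<zeta> \<partial>circle_measure)"
    by (intro Bochner_Integration.integral_cong refl eq)
  also have "\<dots> = \<delta> / (2 - \<delta>)" by (simp only: integral_mult_right_zero Poisson_kernel_integral(1)[OF r] mult_1_right)
  also have "\<dots> \<le> \<delta>" using assms by (simp add: divide_le_eq)
  finally show "(\<integral>\<zeta>. (bump_width \<delta> \<zeta>)\<^sup>2 \<partial>circle_measure) \<le> \<delta>" .
qed

lemma bump_of_real: "bump \<delta> (of_real t) = of_real ((\<delta> / (1 - (1 - \<delta>) * t)) ^ 4)"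
  by (simp add: bump_def)

lemma bump_tip:
  fixes \<delta> :: real
  assumes "0 < \<delta>" "\<delta> < 1"
  shows "1 / 16 \<le> (\<delta> / (1 - (1 - \<delta>) * (1 - \<delta>))) ^ 4"
proof -
  have "1 - (1 - \<delta>) * (1 - \<delta>) = \<delta> * (2 - \<delta>)" by (simp add: algebra_simps)
  then have "\<delta> / (1 - (1 - \<delta>) * (1 - \<delta>)) = 1 / (2 - \<delta>)" using assms by simp
  moreover have "1 / 2 \<le> 1 / (2 - \<delta>)" using assms by (intro divide_left_mono) auto
  then have "(1 / 2) ^ 4 \<le> (1 / (2 - \<delta>)) ^ 4" by (intro power_mono) auto
  ultimately show ?thesis by (simp add: power_divide)
qed

context orlicz
begin

lemma extension_in_unit_ball:
  assumes g: "g holomorphic_on ball 0 R" "1 < R" and C: "0 < C"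
    and int: "(\<integral>\<zeta>. \<Psi> (cmod (g \<zeta>) / C) \<partial>circle_measure) \<le> 1"
  shows "(\<lambda>z. if z \<in> ball 0 1 then g z / of_real C else 0)
    \<in> closed_unit_ball (Hardy_Orlicz \<Psi>) (Hardy_Orlicz_norm \<Psi>)" (is "?h \<in> _")
proof -
  have cont: "continuous_on (cball 0 1) g"
    using holomorphic_on_imp_continuous_on[OF g(1)] by (rule continuous_on_subset) (use g in auto)
  have cont': "continuous_on (sphere 0 1) g" using cont by (rule continuous_on_subset) auto
  have "(\<lambda>z. g z / of_real C) holomorphic_on ball 0 1"
    using g C by (intro holomorphic_intros) (auto elim: holomorphic_on_subset)
  then have hol: "?h holomorphic_on ball 0 1" by (rule holomorphic_transform) simp
  have bv: "boundary_values ?h \<zeta> = g \<zeta> / of_real C" if \<zeta>: "\<zeta> \<in> sphere 0 1" for \<zeta>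
  proof (rule boundary_values_eq)
    have "isCont g \<zeta>"
      using holomorphic_on_imp_continuous_on[OF g(1)] g(2) \<zeta> by (simp add: continuous_on_eq_continuous_at)
    moreover have "((\<lambda>r. of_real r * \<zeta>) \<longlongrightarrow> of_real 1 * \<zeta>) (at_left 1)" by (intro tendsto_intros)
    ultimately have "((\<lambda>r. g (of_real r * \<zeta>)) \<longlongrightarrow> g \<zeta>) (at_left 1)"
      by (intro isCont_tendsto_compose[of _ g]) auto
    then have lim: "((\<lambda>r. g (of_real r * \<zeta>) / of_real C) \<longlongrightarrow> g \<zeta> / of_real C) (at_left 1)"
      using C by (intro tendsto_divide tendsto_const) auto
    have "\<forall>\<^sub>F r in at_left 1. g (of_real r * \<zeta>) / of_real C = ?h (of_real r * \<zeta>)"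
      using eventually_at_left_real[of 0 "1::real"] by (rule eventually_mono) (use \<zeta> in \<open>auto simp: norm_mult\<close>)
    with lim show "((\<lambda>r. ?h (of_real r * \<zeta>)) \<longlongrightarrow> g \<zeta> / of_real C) (at_left 1)"
      by (rule Lim_transform_eventually)
  qed
  have "bounded (g ` cball 0 1)" using cont by (intro compact_imp_bounded compact_continuous_image) auto
  then obtain S where S: "\<And>z. z \<in> cball 0 1 \<Longrightarrow> cmod (g z) \<le> S" unfolding bounded_iff by blast
  have "(SUP r\<in>{0..<1}. \<integral>\<^sup>+ \<zeta>. ennreal (cmod (?h (complex_of_real r * \<zeta>))) \<partial>circle_measure) \<le> ennreal (S / C)"
  proof (rule SUP_least)
    fix r :: real assume "r \<in> {0..<1}"
    have "(\<integral>\<^sup>+ \<zeta>. ennreal (cmod (?h (complex_of_real r * \<zeta>))) \<partial>circle_measure) \<le> (\<integral>\<^sup>+ \<zeta>. ennreal (S / C) \<partial>circle_measure)"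
    proof (rule nn_integral_mono)
      fix \<zeta>
      have "0 \<le> S" by (rule order_trans[OF norm_ge_zero S[of 0]]) simp
      then have "cmod (?h w) \<le> S / C" for w using S[of w] C by (auto simp: norm_divide divide_right_mono)
      then show "ennreal (cmod (?h (complex_of_real r * \<zeta>))) \<le> ennreal (S / C)" by (rule ennreal_leI)
    qed
    also have "\<dots> = ennreal (S / C)" using circle.emeasure_space_1 by simp
    finally show "(\<integral>\<^sup>+ \<zeta>. ennreal (cmod (?h (complex_of_real r * \<zeta>))) \<partial>circle_measure) \<le> ennreal (S / C)" .
  qed
  also have "\<dots> < \<infinity>" by simp
  finally have H1: "?h \<in> Hardy_space_1"
    unfolding Hardy_space_1_def analytic_on_disc_def using hol by (simp add: analytic_on_open)
  have "boundary_values ?h \<in> borel_measurable circle_measure"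
  proof (subst measurable_cong)
    show "boundary_values ?h \<zeta> = g \<zeta> / of_real C" if "\<zeta> \<in> space circle_measure" for \<zeta>
      using bv that by simp
    show "(\<lambda>\<zeta>. g \<zeta> / of_real C) \<in> borel_measurable circle_measure"
      using C by (intro continuous_imp_measurable_circle continuous_on_divide cont' continuous_on_const) auto
  qed
  moreover have "(\<integral>\<^sup>+ \<zeta>. ennreal (\<Psi> (cmod (boundary_values ?h \<zeta>) / 1)) \<partial>circle_measure) \<le> 1"
  proof -
    have "(\<integral>\<^sup>+ \<zeta>. ennreal (\<Psi> (cmod (boundary_values ?h \<zeta>) / 1)) \<partial>circle_measure)
        = (\<integral>\<^sup>+ \<zeta>. ennreal (\<Psi> (cmod (g \<zeta>) / C)) \<partial>circle_measure)"
    proof (rule nn_integral_cong)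
      fix \<zeta> assume "\<zeta> \<in> space circle_measure"
      then have "boundary_values ?h \<zeta> = g \<zeta> / of_real C" by (intro bv) simp
      then show "ennreal (\<Psi> (cmod (boundary_values ?h \<zeta>) / 1)) = ennreal (\<Psi> (cmod (g \<zeta>) / C))"
        using C by (simp only: norm_divide norm_of_real div_by_1 abs_of_pos)
    qed
    also have "\<dots> = ennreal (\<integral>\<zeta>. \<Psi> (cmod (g \<zeta>) / C) \<partial>circle_measure)"
      using C nonneg by (intro nn_integral_circle_continuous continuous_Psi continuous_intros cont') auto
    finally show ?thesis using int by (simp only: ennreal_le_1)
  qed
  ultimately have "boundary_values ?h \<in> Orlicz_space \<Psi> circle_measure" "Hardy_Orlicz_norm \<Psi> ?h \<le> 1"
    unfolding Hardy_Orlicz_norm_def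
    using le_less_trans[OF _ ennreal_one_less_top] by (auto intro!: Orlicz_spaceI[of _ _ 1] Luxemburg_le)
  then show ?thesis using H1 by (simp add: closed_unit_ball_def Hardy_Orlicz_def)
qed

text \<open>Adding a high and narrow bump to a bounded function hardly changes its modular when
  \<open>\<Psi> (A x) / \<Psi> x\<close> tends to infinity. Where the bump is small it is negligible by uniform continuity.
  Elsewhere convexity separates it from the bounded function, which contributes only over a set of
  small measure, while the bump contributes about \<open>\<Psi> (x / A)\<close> over a set of measure \<open>1 / \<Psi> x\<close>.\<close>

lemma add_bump_modular:
  assumes A: "1 < A" and ratio: "filterlim (\<lambda>x. \<Psi> (A * x) / \<Psi> x) at_top at_top"
    and g: "continuous_on (sphere 0 1) g" and \<kappa>: "0 < \<kappa>"
  shows "\<forall>\<^sub>F x in at_top. (\<integral>\<zeta>. \<Psi> (cmod (g \<zeta> + of_real x * bump (1 / \<Psi> x) \<zeta>) / (2 * A)) \<partial>circle_measure)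
    \<le> (\<integral>\<zeta>. \<Psi> (cmod (g \<zeta>) / (2 * A)) \<partial>circle_measure) + \<kappa>"
proof -
  let ?C = "2 * A"
  have "bounded (g ` sphere 0 1)" using g by (intro compact_imp_bounded compact_continuous_image) auto
  then obtain S0 where S0: "\<forall>z\<in>sphere 0 1. cmod (g z) \<le> S0" unfolding bounded_iff ball_simps by blast
  define S where "S = max S0 0"
  have S: "0 \<le> S" "\<And>\<zeta>. \<zeta> \<in> sphere 0 1 \<Longrightarrow> cmod (g \<zeta>) \<le> S" using S0 by (auto simp: S_def le_max_iff_disj)
  have "uniformly_continuous_on {0..S + 1} (\<lambda>x. \<Psi> (x / ?C))"
    using A by (intro compact_uniformly_continuous continuous_Psi continuous_intros) auto
  then obtain d where d: "0 < d" "\<And>x y. x \<in> {0..S + 1} \<Longrightarrow> y \<in> {0..S + 1} \<Longrightarrow> dist y x < d \<Longrightarrow>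
      dist (\<Psi> (y / ?C)) (\<Psi> (x / ?C)) < \<kappa> / 2"
    unfolding uniformly_continuous_on_def using \<kappa> by (metis half_gt_zero)
  define \<eta> where "\<eta> = min 1 (d / 2)"
  have \<eta>: "0 < \<eta>" "\<eta> \<le> 1" "\<eta> < d" using d(1) by (auto simp: \<eta>_def)
  have shift: "\<Psi> ((y + \<eta>) / ?C) \<le> \<Psi> (y / ?C) + \<kappa> / 2" if "0 \<le> y" "y \<le> S" for y
  proof -
    have "dist (\<Psi> ((y + \<eta>) / ?C)) (\<Psi> (y / ?C)) < \<kappa> / 2"
      by (rule d(2)) (use that \<eta> in \<open>auto simp: dist_real_def\<close>)
    then show ?thesis unfolding dist_real_def by linarith
  qed
  obtain c where c: "0 < c" "\<And>x. 0 \<le> x \<Longrightarrow> x \<le> c * (1 + \<Psi> x)" using linear_bound by blast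
  define a where "a x = \<Psi> (2 * S / ?C) * sqrt (x / \<eta>) + \<Psi> (x / A)" for x
  have small: "\<forall>\<^sub>F x in at_top. a x / \<Psi> x \<le> \<kappa> / 2"
  proof -
    have 1: "((\<lambda>x. \<Psi> (x / A) / \<Psi> x) \<longlongrightarrow> 0) at_top"
    proof -
      have "filterlim (\<lambda>x. x / A) at_top at_top" using A by real_asymp
      from filterlim_compose[OF ratio this]
      have "filterlim (\<lambda>x. \<Psi> x / \<Psi> (x / A)) at_top at_top" using A by simp
      from tendsto_inverse_0_at_top[OF this] show ?thesis by (simp add: inverse_eq_divide)
    qed
    have 2: "((\<lambda>x. \<Psi> (2 * S / ?C) * sqrt (x / \<eta>) / \<Psi> x) \<longlongrightarrow> 0) at_top"
    proof (rule tendsto_sandwich[OF _ _ tendsto_const])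
      show "((\<lambda>x. \<Psi> (2 * S / ?C) * (sqrt (x / \<eta>) * (2 * c) / x)) \<longlongrightarrow> 0) at_top"
        using \<eta>(1) by real_asymp
      show "\<forall>\<^sub>F x in at_top. 0 \<le> \<Psi> (2 * S / ?C) * sqrt (x / \<eta>) / \<Psi> x"
        using eventually_gt_at_top[of 0]
        by eventually_elim (use nonneg S A \<eta> in auto)
      show "\<forall>\<^sub>F x in at_top. \<Psi> (2 * S / ?C) * sqrt (x / \<eta>) / \<Psi> x \<le> \<Psi> (2 * S / ?C) * (sqrt (x / \<eta>) * (2 * c) / x)"
        using eventually_gt_at_top[of 0] eventually_ge[of 1]
      proof eventually_elim
        case (elim x)
        have "x \<le> c * (1 + \<Psi> x)" using elim by (intro c) auto
        also have "\<dots> \<le> c * (2 * \<Psi> x)" using elim c by (intro mult_left_mono) auto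
        finally have "1 / \<Psi> x \<le> 2 * c / x" using elim by (simp add: field_simps)
        then have "(\<Psi> (2 * S / ?C) * sqrt (x / \<eta>)) * (1 / \<Psi> x) \<le> (\<Psi> (2 * S / ?C) * sqrt (x / \<eta>)) * (2 * c / x)"
          using nonneg S A \<eta> elim by (intro mult_left_mono) auto
        then show ?case by simp
      qed
    qed
    have "((\<lambda>x. \<Psi> (2 * S / ?C) * sqrt (x / \<eta>) / \<Psi> x + \<Psi> (x / A) / \<Psi> x) \<longlongrightarrow> 0 + 0) at_top"
      by (rule tendsto_add[OF 2 1])
    then have "((\<lambda>x. a x / \<Psi> x) \<longlongrightarrow> 0) at_top" by (simp add: a_def add_divide_distrib)
    then have "\<forall>\<^sub>F x in at_top. a x / \<Psi> x < \<kappa> / 2" using \<kappa> by (intro order_tendstoD) auto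
    then show ?thesis by (rule eventually_mono) simp
  qed
  show ?thesis
    using small eventually_gt_at_top[of 0] eventually_ge[of 2]
  proof eventually_elim
    case (elim x)
    define \<delta> where "\<delta> = 1 / \<Psi> x"
    have \<delta>: "0 < \<delta>" "\<delta> < 1" using elim by (auto simp: \<delta>_def)
    have a0: "0 \<le> a x" unfolding a_def using nonneg S A \<eta> elim by simp
    have wcont: "continuous_on (sphere 0 1) (bump_width \<delta>)" by (rule bump_width_mean(1)[OF \<delta>])
    have bcont: "continuous_on (sphere 0 1) (bump \<delta>)"
      using holomorphic_on_imp_continuous_on[OF bump_holomorphic[OF \<delta>]] by (rule continuous_on_subset) (use \<delta> in auto)
    have pt: "\<Psi> (cmod (g \<zeta> + of_real x * bump \<delta> \<zeta>) / ?C) \<le> (\<Psi> (cmod (g \<zeta>) / ?C) + \<kappa> / 2) + a x * (bump_width \<delta> \<zeta>)\<^sup>2"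
      if \<zeta>: "\<zeta> \<in> space circle_measure" for \<zeta>
    proof -
      have \<zeta>1: "\<zeta> \<in> sphere 0 1" "cmod \<zeta> \<le> 1" using \<zeta> by auto
      define w where "w = bump_width \<delta> \<zeta>"
      have w: "0 \<le> w" "w \<le> 1" "cmod (bump \<delta> \<zeta>) = w ^ 4" using bump_width[OF \<delta> \<zeta>1(2)] by (auto simp: w_def)
      have w4: "w ^ 4 \<le> w\<^sup>2" using w by (intro power_decreasing) auto
      have tri: "cmod (g \<zeta> + of_real x * bump \<delta> \<zeta>) \<le> cmod (g \<zeta>) + x * w ^ 4"
        using norm_triangle_ineq[of "g \<zeta>" "of_real x * bump \<delta> \<zeta>"] elim w(3) by (simp add: norm_mult)
      have gS: "0 \<le> cmod (g \<zeta>)" "cmod (g \<zeta>) \<le> S" using S(2)[OF \<zeta>1(1)] by auto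
      show ?thesis
      proof (cases "x * w ^ 4 \<le> \<eta>")
        case True
        have "\<Psi> (cmod (g \<zeta> + of_real x * bump \<delta> \<zeta>) / ?C) \<le> \<Psi> ((cmod (g \<zeta>) + \<eta>) / ?C)"
          using tri True A by (intro mono divide_right_mono) auto
        also have "\<dots> \<le> \<Psi> (cmod (g \<zeta>) / ?C) + \<kappa> / 2" by (rule shift[OF gS])
        also have "\<dots> \<le> \<dots> + a x * (bump_width \<delta> \<zeta>)\<^sup>2" using a0 by simp
        finally show ?thesis .
      next
        case False
        have "\<Psi> (cmod (g \<zeta> + of_real x * bump \<delta> \<zeta>) / ?C) \<le> \<Psi> (1 / 2 * (2 * S / ?C) + 1 / 2 * (w ^ 4 * (x / A)))"
          using tri gS A by (intro mono) (auto simp: field_simps)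
        also have "\<dots> \<le> 1 / 2 * \<Psi> (2 * S / ?C) + 1 / 2 * \<Psi> (w ^ 4 * (x / A))"
          using S(1) A w elim by (intro convex) auto
        also have "\<dots> \<le> \<Psi> (2 * S / ?C) * (sqrt (x / \<eta>) * w\<^sup>2) + w\<^sup>2 * \<Psi> (x / A)"
        proof (rule add_mono)
          have "\<Psi> (w ^ 4 * (x / A)) \<le> w ^ 4 * \<Psi> (x / A)" using w A elim by (intro scale power_le_one) auto
          also have "\<dots> \<le> w\<^sup>2 * \<Psi> (x / A)" using w4 nonneg A elim by (intro mult_right_mono) auto
          finally show "1 / 2 * \<Psi> (w ^ 4 * (x / A)) \<le> w\<^sup>2 * \<Psi> (x / A)"
            using nonneg[of "w ^ 4 * (x / A)"] w A elim by simp
          \<comment> \<open>Chebyshev: the constant 1 is bounded by an integrable function on the set where \<open>x w\<^sup>4 > \<eta>\<close>.\<close>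
          have "1 \<le> (x / \<eta>) * (w\<^sup>2)\<^sup>2" using False \<eta> by (simp add: field_simps power_mult[symmetric])
          then have "sqrt 1 \<le> sqrt ((x / \<eta>) * (w\<^sup>2)\<^sup>2)" by (rule real_sqrt_le_mono)
          then have "1 \<le> sqrt (x / \<eta>) * w\<^sup>2" by (simp only: real_sqrt_mult real_sqrt_abs real_sqrt_one abs_power2)
          then have "\<Psi> (2 * S / ?C) * (1 / 2) \<le> \<Psi> (2 * S / ?C) * (sqrt (x / \<eta>) * w\<^sup>2)"
            using nonneg S A by (intro mult_left_mono) auto
          then show "1 / 2 * \<Psi> (2 * S / ?C) \<le> \<Psi> (2 * S / ?C) * (sqrt (x / \<eta>) * w\<^sup>2)" by simp
        qed
        also have "\<dots> = a x * (bump_width \<delta> \<zeta>)\<^sup>2" by (simp add: a_def w_def algebra_simps)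
        also have "\<dots> \<le> (\<Psi> (cmod (g \<zeta>) / ?C) + \<kappa> / 2) + a x * (bump_width \<delta> \<zeta>)\<^sup>2"
          using nonneg[of "cmod (g \<zeta>) / ?C"] A \<kappa> by simp
        finally show ?thesis .
      qed
    qed
    have gC: "continuous_on (sphere 0 1) (\<lambda>\<zeta>. \<Psi> (cmod (g \<zeta>) / ?C))"
      using A by (intro continuous_Psi continuous_intros g) auto
    have i1: "integrable circle_measure (\<lambda>\<zeta>. \<Psi> (cmod (g \<zeta>) / ?C) + \<kappa> / 2)"
      by (intro integral_circle(1) continuous_on_add gC continuous_on_const)
    have i2: "integrable circle_measure (\<lambda>\<zeta>. a x * (bump_width \<delta> \<zeta>)\<^sup>2)"
      by (intro integral_circle(1) continuous_on_mult_left continuous_on_power wcont)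
    have "(\<integral>\<zeta>. \<Psi> (cmod (g \<zeta> + of_real x * bump \<delta> \<zeta>) / ?C) \<partial>circle_measure)
        \<le> (\<integral>\<zeta>. (\<Psi> (cmod (g \<zeta>) / ?C) + \<kappa> / 2) + a x * (bump_width \<delta> \<zeta>)\<^sup>2 \<partial>circle_measure)"
    proof (rule integral_mono[OF _ _ pt])
      show "integrable circle_measure (\<lambda>\<zeta>. \<Psi> (cmod (g \<zeta> + of_real x * bump \<delta> \<zeta>) / ?C))"
        using A by (intro integral_circle(1) continuous_Psi continuous_intros g bcont) auto
      show "integrable circle_measure (\<lambda>\<zeta>. (\<Psi> (cmod (g \<zeta>) / ?C) + \<kappa> / 2) + a x * (bump_width \<delta> \<zeta>)\<^sup>2)"
        by (rule Bochner_Integration.integrable_add[OF i1 i2])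
    qed
    also have "\<dots> = (\<integral>\<zeta>. \<Psi> (cmod (g \<zeta>) / ?C) + \<kappa> / 2 \<partial>circle_measure) + (\<integral>\<zeta>. a x * (bump_width \<delta> \<zeta>)\<^sup>2 \<partial>circle_measure)"
      by (rule Bochner_Integration.integral_add[OF i1 i2])
    also have "(\<integral>\<zeta>. \<Psi> (cmod (g \<zeta>) / ?C) + \<kappa> / 2 \<partial>circle_measure) = (\<integral>\<zeta>. \<Psi> (cmod (g \<zeta>) / ?C) \<partial>circle_measure) + \<kappa> / 2"
      using integral_circle(1)[OF gC] circle.prob_space by (subst Bochner_Integration.integral_add) auto
    also have "(\<integral>\<zeta>. a x * (bump_width \<delta> \<zeta>)\<^sup>2 \<partial>circle_measure) = a x * (\<integral>\<zeta>. (bump_width \<delta> \<zeta>)\<^sup>2 \<partial>circle_measure)"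
      by (rule integral_mult_right_zero)
    also have "\<dots> \<le> a x * \<delta>" by (intro mult_left_mono bump_width_mean(2)[OF \<delta>] a0)
    also have "\<dots> \<le> \<kappa> / 2" using elim(1) by (simp add: \<delta>_def)
    finally show ?case by (simp add: \<delta>_def)
  qed
qed

text \<open>The heights are chosen one after the other, each so large that the new bump adds at most
  \<open>(1 / 2) ^ (n + 1)\<close> to the modular of the partial sum. Bumps, and with them the partial sums, have
  nonnegative real part on the radius \<open>[0, 1)\<close>, so later bumps cannot cancel the value at the tip of an earlier one.\<close>

lemma bump_partial_sums:
  assumes A: "1 < A" and ratio: "filterlim (\<lambda>x. \<Psi> (A * x) / \<Psi> x) at_top at_top"
    and large: "\<exists>\<^sub>F x in at_top. \<epsilon> * (\<Psi> x)\<^sup>2 \<le> \<Psi> (B * x)"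
  obtains x :: "nat \<Rightarrow> real" and g :: "nat \<Rightarrow> complex \<Rightarrow> complex"
  where "\<And>n. real n \<le> x n" "\<And>n. 1 < x n" "\<And>n. 2 \<le> \<Psi> (x n)" "\<And>n. \<epsilon> * (\<Psi> (x n))\<^sup>2 \<le> \<Psi> (B * x n)"
    "\<And>n. \<exists>R>1. g n holomorphic_on ball 0 R"
    "\<And>n. (\<integral>\<zeta>. \<Psi> (cmod (g n \<zeta>) / (2 * A)) \<partial>circle_measure) \<le> 1"
    "\<And>n t. t \<in> {0..<1} \<Longrightarrow> 0 \<le> Re (g n (of_real t))"
    "\<And>n z. g (Suc n) z = g n z + of_real (x (Suc n)) * bump (1 / \<Psi> (x (Suc n))) z"
proof -
  let ?C = "2 * A"
  let ?M = "\<lambda>g. \<integral>\<zeta>. \<Psi> (cmod (g \<zeta>) / ?C) \<partial>circle_measure"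
  define P where "P n p \<longleftrightarrow> real n \<le> fst p \<and> 1 < fst p \<and> 2 \<le> \<Psi> (fst p) \<and> \<epsilon> * (\<Psi> (fst p))\<^sup>2 \<le> \<Psi> (B * fst p)
      \<and> (\<exists>R>1. snd p holomorphic_on ball 0 R) \<and> ?M (snd p) \<le> 1 - (1 / 2) ^ n
      \<and> (\<forall>t\<in>{0..<1}. 0 \<le> Re (snd p (of_real t)))"
    for n :: nat and p :: "real \<times> (complex \<Rightarrow> complex)"
  define Q where "Q p q \<longleftrightarrow> snd q = (\<lambda>z. snd p z + of_real (fst q) * bump (1 / \<Psi> (fst q)) z)"
    for p q :: "real \<times> (complex \<Rightarrow> complex)"
  have pick: "\<exists>x. real n \<le> x \<and> 1 < x \<and> 2 \<le> \<Psi> x \<and> \<epsilon> * (\<Psi> x)\<^sup>2 \<le> \<Psi> (B * x) \<and> E x"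
    if E: "\<forall>\<^sub>F x in at_top. E x" for n E
  proof -
    have ev: "\<forall>\<^sub>F x in at_top. real n \<le> x \<and> 1 < x \<and> 2 \<le> \<Psi> x \<and> E x"
      using E eventually_ge[of 2] eventually_ge_at_top[of "real n"] eventually_gt_at_top[of 1]
      by eventually_elim blast
    have "\<exists>\<^sub>F x in at_top. \<epsilon> * (\<Psi> x)\<^sup>2 \<le> \<Psi> (B * x) \<and> (real n \<le> x \<and> 1 < x \<and> 2 \<le> \<Psi> x \<and> E x)"
      by (rule frequently_rev_mp[OF large]) (use ev in eventually_elim, simp)
    then show ?thesis by (auto dest!: frequently_ex)
  qed
  have "\<exists>p. \<forall>n. P n (p n) \<and> Q (p n) (p (Suc n))"
  proof (rule dependent_nat_choice)
    obtain x where "1 < x" "2 \<le> \<Psi> x" "\<epsilon> * (\<Psi> x)\<^sup>2 \<le> \<Psi> (B * x)"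
      using pick[of "\<lambda>x. True" 0] by auto
    then have "P 0 (x, \<lambda>z. 0)" by (auto simp: P_def intro!: exI[of _ 2])
    then show "\<exists>p. P 0 p" by blast
  next
    fix p n assume p: "P n p"
    then obtain R where R: "1 < R" "snd p holomorphic_on ball 0 R" by (auto simp: P_def)
    have gcont: "continuous_on (sphere 0 1) (snd p)"
      using holomorphic_on_imp_continuous_on[OF R(2)] by (rule continuous_on_subset) (use R in auto)
    have \<kappa>: "0 < (1 / 2 :: real) ^ Suc n" by simp
    obtain x where x: "real (Suc n) \<le> x" "1 < x" "2 \<le> \<Psi> x" "\<epsilon> * (\<Psi> x)\<^sup>2 \<le> \<Psi> (B * x)"
      and M: "?M (\<lambda>\<zeta>. snd p \<zeta> + of_real x * bump (1 / \<Psi> x) \<zeta>) \<le> ?M (snd p) + (1 / 2) ^ Suc n"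
      using pick[OF add_bump_modular[OF A ratio gcont \<kappa>], of "Suc n"] by blast
    define \<delta> where "\<delta> = 1 / \<Psi> x"
    have \<delta>: "0 < \<delta>" "\<delta> < 1" using x by (auto simp: \<delta>_def)
    define q where "q = (x, \<lambda>z. snd p z + of_real x * bump \<delta> z)"
    have "\<exists>R>1. snd q holomorphic_on ball 0 R"
    proof (intro exI conjI)
      show "1 < min R (1 / (1 - \<delta>))" using R \<delta> by simp
      have "snd p holomorphic_on ball 0 (min R (1 / (1 - \<delta>)))" using R(2)
        by (rule holomorphic_on_subset[OF _ subset_ball]) simp
      moreover have "bump \<delta> holomorphic_on ball 0 (min R (1 / (1 - \<delta>)))"
        using bump_holomorphic[OF \<delta>] by (rule holomorphic_on_subset[OF _ subset_ball]) simp
      ultimately show "snd q holomorphic_on ball 0 (min R (1 / (1 - \<delta>)))"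
        unfolding q_def snd_conv by (intro holomorphic_intros)
    qed
    moreover have "?M (snd q) \<le> 1 - (1 / 2) ^ Suc n"
      using M p by (simp add: q_def \<delta>_def P_def)
    moreover have "0 \<le> Re (snd q (of_real t))" if t: "t \<in> {0..<1}" for t
    proof -
      have "0 \<le> (\<delta> / (1 - (1 - \<delta>) * t)) ^ 4" by simp
      then have "0 \<le> Re (of_real x * bump \<delta> (of_real t))" using bump_of_real[of \<delta> t] t x by simp
      moreover have "0 \<le> Re (snd p (of_real t))" using p t by (simp add: P_def)
      ultimately show ?thesis by (simp add: q_def)
    qed
    ultimately have "P (Suc n) q" using x unfolding P_def by (auto simp: q_def)
    moreover have "Q p q" by (simp add: Q_def q_def \<delta>_def)
    ultimately show "\<exists>q. P (Suc n) q \<and> Q p q" by blast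
  qed
  then obtain p where p: "\<And>n. P n (p n)" "\<And>n. Q (p n) (p (Suc n))" by blast
  show thesis
  proof (rule that[of "\<lambda>n. fst (p n)" "\<lambda>n. snd (p n)"])
    show "?M (snd (p n)) \<le> 1" for n
    proof -
      have "?M (snd (p n)) \<le> 1 - (1 / 2) ^ n" using p(1)[of n] by (simp add: P_def)
      also have "\<dots> \<le> 1" by simp
      finally show ?thesis .
    qed
    show "snd (p (Suc n)) z = snd (p n) z + of_real (fst (p (Suc n))) * bump (1 / \<Psi> (fst (p (Suc n)))) z" for n z
      using p(2)[of n] by (simp add: Q_def)
  qed (use p(1) in \<open>auto simp: P_def\<close>)
qed

text \<open>Evaluation at the tip of the \<open>n\<close>-th bump, divided by its height, is a bounded functional: this is
  what \<open>\<epsilon> (\<Psi> x)\<^sup>2 \<le> \<Psi> (B x)\<close> means, as the tip has distance \<open>1 / \<Psi> x\<close> to the circle. By Tychonoff's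
  theorem the sequence of these functionals has a cluster point \<open>\<psi>\<close>. Every partial sum is a bounded
  function, so \<open>\<psi>\<close> vanishes on it, because the heights tend to infinity. A weak cluster point of the
  partial sums, however, is at the tip of each bump at least a fixed fraction of its height, so \<open>\<psi>\<close>
  does not vanish there.\<close>

lemma not_weakly_compact:
  assumes A: "1 < A" and ratio: "filterlim (\<lambda>x. \<Psi> (A * x) / \<Psi> x) at_top at_top"
    and B: "0 < B" and \<epsilon>: "0 < \<epsilon>" "\<epsilon> \<le> 1" and large: "\<exists>\<^sub>F x in at_top. \<epsilon> * (\<Psi> x)\<^sup>2 \<le> \<Psi> (B * x)"
  shows "\<not> relatively_compact_in (weak_topology Bergman Bergman_norm) (closed_unit_ball (Hardy_Orlicz \<Psi>) (Hardy_Orlicz_norm \<Psi>))"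
proof
  let ?S = "closed_unit_ball (Hardy_Orlicz \<Psi>) (Hardy_Orlicz_norm \<Psi>)"
  let ?W = "weak_topology Bergman Bergman_norm"
  let ?C = "2 * A"
  assume "relatively_compact_in ?W ?S"
  then have SV: "?S \<subseteq> Bergman" and K: "compactin ?W (?W closure_of ?S)"
    by (auto simp: relatively_compact_in_def topspace_weak_topology)
  obtain x g where x: "\<And>n. real n \<le> x n" "\<And>n. 1 < x n" "\<And>n. 2 \<le> \<Psi> (x n)" "\<And>n. \<epsilon> * (\<Psi> (x n))\<^sup>2 \<le> \<Psi> (B * x n)"
    and ghol: "\<And>n. \<exists>R>1. g n holomorphic_on ball 0 R"
    and gM: "\<And>n. (\<integral>\<zeta>. \<Psi> (cmod (g n \<zeta>) / ?C) \<partial>circle_measure) \<le> 1"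
    and gpos: "\<And>n t. t \<in> {0..<1} \<Longrightarrow> 0 \<le> Re (g n (of_real t))"
    and gbump: "\<And>n z. g (Suc n) z = g n z + of_real (x (Suc n)) * bump (1 / \<Psi> (x (Suc n))) z"
    by (rule bump_partial_sums[OF A ratio large]) (rule that)
  define \<delta> where "\<delta> n = 1 / \<Psi> (x n)" for n
  define a where "a n = 1 - \<delta> n" for n
  note gSuc = gbump[folded \<delta>_def]
  have \<delta>: "0 < \<delta> n" "\<delta> n < 1" for n using x(3)[of n] by (auto simp: \<delta>_def)
  have a: "0 \<le> a n" "a n < 1" for n using \<delta>[of n] by (auto simp: a_def)
  have g_step: "Re (g n (of_real t)) \<le> Re (g (Suc n) (of_real t))" if t: "t \<in> {0..<1}" for n t
  proof -
    have "0 \<le> (\<delta> (Suc n) / (1 - (1 - \<delta> (Suc n)) * t)) ^ 4" by simp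
    then have "0 \<le> Re (of_real (x (Suc n)) * bump (\<delta> (Suc n)) (of_real t))"
      using bump_of_real[of "\<delta> (Suc n)" t] t x(2)[of "Suc n"] by simp
    then show ?thesis by (simp add: gSuc)
  qed
  have g_mono: "Re (g m (of_real t)) \<le> Re (g n (of_real t))" if "m \<le> n" "t \<in> {0..<1}" for m n t
    using that(1) by (rule lift_Suc_mono_le[rotated]) (rule g_step[OF that(2)])
  have g_tip: "x (Suc n) / 16 \<le> Re (g N (of_real (a (Suc n))))" if "Suc n \<le> N" for n N
  proof -
    have an: "a (Suc n) \<in> {0..<1}" using a by simp
    have "x (Suc n) * (1 / 16) \<le> x (Suc n) * (\<delta> (Suc n) / (1 - (1 - \<delta> (Suc n)) * (1 - \<delta> (Suc n)))) ^ 4"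
      using bump_tip[OF \<delta>, of "Suc n"] x(2)[of "Suc n"] by (intro mult_left_mono) auto
    also have "\<dots> = Re (of_real (x (Suc n)) * bump (\<delta> (Suc n)) (of_real (a (Suc n))))"
      using bump_of_real[of "\<delta> (Suc n)" "a (Suc n)"] by (simp add: a_def)
    also have "\<dots> \<le> Re (g (Suc n) (of_real (a (Suc n))))"
      using gpos[OF an, of n] by (simp add: gSuc)
    also have "\<dots> \<le> Re (g N (of_real (a (Suc n))))" by (rule g_mono[OF that an])
    finally show ?thesis by simp
  qed
  define h where "h n z = (if z \<in> ball 0 1 then g n z / of_real ?C else 0)" for n z
  have hS: "h n \<in> ?S" for n
  proof -
    obtain R where R: "1 < R" "g n holomorphic_on ball 0 R" using ghol by blast
    show ?thesis unfolding h_def using A gM by (intro extension_in_unit_ball[OF R(2,1)]) auto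
  qed
  have hV: "h n \<in> Bergman" for n using hS SV by blast
  have hK: "h n \<in> ?W closure_of ?S" for n
  proof -
    have "?S \<subseteq> ?W closure_of ?S" using SV by (intro closure_of_subset) (simp only: topspace_weak_topology)
    then show ?thesis using hS by blast
  qed
  obtain l where l: "l \<in> ?W closure_of ?S"
    and clusters: "\<forall>U. openin ?W U \<and> l \<in> U \<longrightarrow> (\<exists>\<^sub>F n in sequentially. h n \<in> U)"
    using compactin_sequence_cluster[OF K hK] by (rule bexE)
  have cluster: "\<exists>\<^sub>F n in sequentially. h n \<in> U" if "openin ?W U" "l \<in> U" for U
    using clusters[rule_format, OF conjI[OF that]] .
  have lV: "l \<in> Bergman"
    using l closure_of_subset_topspace[of ?W ?S] unfolding topspace_weak_topology by blast
  have cluster_dual: "\<exists>\<^sub>F n in sequentially. \<phi> (h n) \<in> U" if "\<phi> \<in> dual_space Bergman Bergman_norm" "open U" "\<phi> l \<in> U" for \<phi> U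
  proof -
    have "\<exists>\<^sub>F n in sequentially. h n \<in> {f \<in> Bergman. \<phi> f \<in> U}"
      using that lV by (intro cluster openin_weak_topology) auto
    then show ?thesis by (rule frequently_elim1) simp
  qed
  have l_tip: "x (Suc n) / (16 * ?C) \<le> Re (l (of_real (a (Suc n))))" for n
  proof (rule ccontr)
    assume "\<not> ?thesis"
    then have "\<exists>\<^sub>F N in sequentially. h N (of_real (a (Suc n))) \<in> {w. Re w < x (Suc n) / (16 * ?C)}"
      by (intro cluster_dual[OF evaluation_dual] open_halfspace_Re_lt) simp
    moreover have "\<forall>\<^sub>F N in sequentially. x (Suc n) / (16 * ?C) \<le> Re (h N (of_real (a (Suc n))))"
      using eventually_ge_at_top[of "Suc n"]
    proof eventually_elim
      case (elim N)
      have "x (Suc n) / 16 / ?C \<le> Re (g N (of_real (a (Suc n)))) / ?C"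
        using A by (intro divide_right_mono g_tip elim) auto
      moreover have "Re (h N (of_real (a (Suc n)))) = Re (g N (of_real (a (Suc n)))) / ?C"
        using a[of "Suc n"] unfolding h_def by (simp add: Re_divide_of_real del: of_real_mult of_real_numeral)
      ultimately show ?case by simp
    qed
    ultimately have "\<exists>\<^sub>F N in sequentially. False"
      by (rule frequently_rev_mp[OF _ eventually_mono]) auto
    then show False by simp
  qed
  define \<phi> where "\<phi> n f = (if f \<in> Bergman then f (of_real (a n)) / of_real (x n) else 0)" for n f
  have \<phi>_bound: "cmod (\<phi> n f) \<le> (B / \<epsilon>) * \<bar>Bergman_norm f\<bar>" for n f
  proof (cases "f \<in> Bergman")
    case True
    have "cmod (f (of_real (a n))) \<le> (B * x n / \<epsilon>) * Bergman_norm f"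
    proof (rule Bergman_Orlicz_evaluation[OF True \<delta>(1)[of n]])
      show "cmod (of_real (a n)) + \<delta> n \<le> 1" using a[of n] by (simp add: a_def del: of_real_diff)
      show "0 < B * x n / \<epsilon>" using B \<epsilon> x(2)[of n] by simp
      have "1 / (\<delta> n)\<^sup>2 = (\<Psi> (x n))\<^sup>2" by (simp add: \<delta>_def power_one_over)
      also have "\<dots> \<le> 1 / \<epsilon> * \<Psi> (B * x n)" using x(4)[of n] \<epsilon> by (simp add: field_simps)
      also have "\<dots> \<le> \<Psi> (B * x n / \<epsilon>)"
        using scale[of \<epsilon> "B * x n / \<epsilon>"] B \<epsilon> x(2)[of n] by (simp add: field_simps)
      finally show "1 / (\<delta> n)\<^sup>2 \<le> \<Psi> (B * x n / \<epsilon>)" .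
    qed
    then have "cmod (f (of_real (a n))) / x n \<le> (B * x n / \<epsilon>) * Bergman_norm f / x n"
      using x(2)[of n] by (intro divide_right_mono) auto
    also have "\<dots> = (B / \<epsilon>) * Bergman_norm f" using x(2)[of n] by simp
    finally show ?thesis using True x(2)[of n] Bergman_Orlicz_norm_nonneg[OF True] by (simp add: \<phi>_def norm_divide)
  qed (use B \<epsilon> in \<open>simp add: \<phi>_def\<close>)
  \<comment> \<open>Off the Bergman-Orlicz space the functionals are 0, which keeps them in a product of compact
  discs indexed by all functions; \<open>\<bar>Bergman_norm f\<bar>\<close> keeps the radii nonnegative there.\<close>
  define Z where "Z = (\<Pi>\<^sub>E f\<in>(UNIV :: (complex \<Rightarrow> complex) set). cball (0::complex) ((B / \<epsilon>) * \<bar>Bergman_norm f\<bar>))"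
  have "compactin (product_topology (\<lambda>_. euclidean) UNIV) Z"
    unfolding Z_def by (subst compactin_PiE) auto
  then have Zc: "compactin euclidean Z" unfolding euclidean_product_topology .
  have \<phi>Z: "\<phi> n \<in> Z" for n unfolding Z_def using \<phi>_bound by auto
  obtain \<psi> where \<psi>: "\<psi> \<in> Z" "\<forall>U. openin euclidean U \<and> \<psi> \<in> U \<longrightarrow> (\<exists>\<^sub>F n in sequentially. \<phi> n \<in> U)"
    using compactin_sequence_cluster[OF Zc \<phi>Z] by (rule bexE)
  have \<psi>_closed: "\<psi> \<in> D" if "closed D" "\<forall>\<^sub>F n in sequentially. \<phi> n \<in> D" for D
  proof (rule ccontr)
    assume "\<psi> \<notin> D"
    then have "\<exists>\<^sub>F n in sequentially. \<phi> n \<in> - D" using that(1) by (intro \<psi>(2)[rule_format]) (simp add: open_Compl)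
    then have "\<exists>\<^sub>F n in sequentially. False"
      by (rule frequently_rev_mp) (use that(2) in eventually_elim, simp)
    then show False by simp
  qed
  have coord: "continuous_on UNIV (\<lambda>\<theta>::(complex \<Rightarrow> complex) \<Rightarrow> complex. \<theta> f)" for f
    by (rule continuous_on_product_coordinates)
  have \<psi>_dual: "\<psi> \<in> dual_space Bergman Bergman_norm"
    unfolding dual_space_def
  proof (intro CollectI conjI ballI allI)
    fix f k assume f: "f \<in> Bergman" and k: "k \<in> Bergman"
    have fk: "(\<lambda>z. f z + k z) \<in> Bergman" by (rule Bergman_Orlicz_add[OF f k])
    have "\<psi> \<in> {\<theta>. \<theta> (\<lambda>z. f z + k z) = \<theta> f + \<theta> k}"
      by (intro \<psi>_closed closed_Collect_eq continuous_on_add coord always_eventually allI CollectI)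
        (simp add: \<phi>_def f k fk add_divide_distrib)
    then show "\<psi> (\<lambda>z. f z + k z) = \<psi> f + \<psi> k" by simp
  next
    fix c f assume f: "f \<in> Bergman"
    have cf: "(\<lambda>z. c * f z) \<in> Bergman" by (rule Bergman_Orlicz_cmult[OF f])
    have "\<psi> \<in> {\<theta>. \<theta> (\<lambda>z. c * f z) = c * \<theta> f}"
      by (intro \<psi>_closed closed_Collect_eq continuous_on_mult continuous_on_const coord always_eventually allI CollectI)
        (simp add: \<phi>_def f cf)
    then show "\<psi> (\<lambda>z. c * f z) = c * \<psi> f" by simp
  next
    have "cmod (\<psi> f) \<le> (B / \<epsilon>) * Bergman_norm f" if f: "f \<in> Bergman" for f
      using \<psi>(1) Bergman_Orlicz_norm_nonneg[OF f] unfolding Z_def by (auto dest!: PiE_mem[of _ _ _ f])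
    then show "\<exists>K. \<forall>f\<in>Bergman. cmod (\<psi> f) \<le> K * Bergman_norm f" by blast
  qed
  have \<psi>_h: "\<psi> (h N) = 0" for N
  proof -
    obtain R where R: "1 < R" "g N holomorphic_on ball 0 R" using ghol by blast
    have "continuous_on (cball 0 1) (g N)"
      using holomorphic_on_imp_continuous_on[OF R(2)] by (rule continuous_on_subset) (use R in auto)
    then have "bounded (g N ` cball 0 1)" by (intro compact_imp_bounded compact_continuous_image) auto
    then obtain S where S: "\<forall>z\<in>cball 0 1. cmod (g N z) \<le> S" unfolding bounded_iff ball_simps by blast
    have S0: "0 \<le> S" using S[THEN bspec, of 0] by (rule order_trans[OF norm_ge_zero]) simp
    have "cmod (\<psi> (h N)) \<le> e" if e: "0 < e" for e
    proof -
      have "\<psi> \<in> {\<theta>. cmod (\<theta> (h N)) \<le> e}"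
      proof (rule \<psi>_closed)
        show "closed {\<theta>. cmod (\<theta> (h N)) \<le> e}"
          by (intro closed_Collect_le continuous_on_norm coord continuous_on_const)
        obtain n0 where n0: "S / ?C / e < real n0" using reals_Archimedean2 by blast
        show "\<forall>\<^sub>F n in sequentially. \<phi> n \<in> {\<theta>. cmod (\<theta> (h N)) \<le> e}"
          using eventually_ge_at_top[of n0]
        proof eventually_elim
          case (elim n)
          have "of_real (a n) \<in> ball (0::complex) 1" "of_real (a n) \<in> cball (0::complex) 1" using a[of n] by auto
          then have "cmod (h N (of_real (a n))) \<le> S / ?C"
            using S A unfolding h_def by (auto simp: norm_divide intro!: divide_right_mono)
          moreover have "S / ?C \<le> e * x n"
          proof -
            have "S / ?C / e \<le> x n" using n0 elim x(1)[of n] by simp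
            then show ?thesis by (simp only: pos_divide_le_eq[OF e] mult.commute)
          qed
          ultimately have "cmod (h N (of_real (a n))) / x n \<le> e"
            using x(2)[of n] by (simp add: pos_divide_le_eq)
          then show ?case using hV[of N] x(2)[of n] by (simp add: \<phi>_def norm_divide)
        qed
      qed
      then show ?thesis by simp
    qed
    then have "cmod (\<psi> (h N)) \<le> 0" by (rule dense_ge)
    then show ?thesis by simp
  qed
  have \<psi>_l: "1 / (16 * ?C) \<le> Re (\<psi> l)"
  proof -
    have "\<psi> \<in> {\<theta>. 1 / (16 * ?C) \<le> Re (\<theta> l)}"
    proof (rule \<psi>_closed)
      show "closed {\<theta>. 1 / (16 * ?C) \<le> Re (\<theta> l)}"
        by (intro closed_Collect_le continuous_on_Re coord continuous_on_const)
      show "\<forall>\<^sub>F n in sequentially. \<phi> n \<in> {\<theta>. 1 / (16 * ?C) \<le> Re (\<theta> l)}"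
        using eventually_gt_at_top[of 0]
      proof eventually_elim
        case (elim n)
        then obtain m where n: "n = Suc m" using gr0_implies_Suc by blast
        have "x n / (16 * ?C) / x n \<le> Re (l (of_real (a n))) / x n"
          unfolding n using x(2)[of "Suc m"] by (intro divide_right_mono l_tip) auto
        then show ?case using lV x(2)[of n] by (simp add: \<phi>_def Re_divide_of_real)
      qed
    qed
    then show ?thesis by simp
  qed
  have "0 < 1 / (16 * ?C)" using A by simp
  then have pos: "0 < Re (\<psi> l)" using \<psi>_l by (rule less_le_trans)
  have "\<exists>\<^sub>F n in sequentially. \<psi> (h n) \<in> {w. 0 < Re w}"
    using pos by (intro cluster_dual[OF \<psi>_dual] open_halfspace_Re_gt) auto
  then show False by (simp add: \<psi>_h)
qed

end

section \<open>Weak compactness and compactness\<close>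

context orlicz
begin

text \<open>A monotone ratio \<open>\<Psi> (A x) / \<Psi> x\<close> is either bounded or tends to infinity. In the first case
  \<open>\<Psi> (B x)\<close> is \<open>O(\<Psi> x)\<close> for every \<open>B\<close>; in the second, a failure of the growth condition would
  contradict weak compactness.\<close>

lemma growth_condition:
  assumes A: "1 < A" and x0: "0 < x0" and ratio: "mono_on {x0..} (\<lambda>x. \<Psi> (A * x) / \<Psi> x)"
    and weak: "relatively_compact_in (weak_topology Bergman Bergman_norm) (closed_unit_ball (Hardy_Orlicz \<Psi>) (Hardy_Orlicz_norm \<Psi>))"
    and B: "1 < B"
  shows "((\<lambda>x. \<Psi> (B * x) / (\<Psi> x)\<^sup>2) \<longlongrightarrow> 0) at_top"
proof (rule tendstoI, rule ccontr)
  fix e :: real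
  assume e: "0 < e" and "\<not> (\<forall>\<^sub>F x in at_top. dist (\<Psi> (B * x) / (\<Psi> x)\<^sup>2) 0 < e)"
  then have "\<exists>\<^sub>F x in at_top. \<not> dist (\<Psi> (B * x) / (\<Psi> x)\<^sup>2) 0 < e" by (simp add: not_eventually)
  define \<epsilon> where "\<epsilon> = min e 1"
  have \<epsilon>: "0 < \<epsilon>" "\<epsilon> \<le> 1" "\<epsilon> \<le> e" using e by (auto simp: \<epsilon>_def)
  have "\<forall>\<^sub>F x in at_top. \<not> dist (\<Psi> (B * x) / (\<Psi> x)\<^sup>2) 0 < e \<longrightarrow> \<epsilon> * (\<Psi> x)\<^sup>2 \<le> \<Psi> (B * x)"
    using eventually_ge[of 1] eventually_gt_at_top[of 0]
  proof eventually_elim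
    case (elim x)
    show ?case
    proof
      assume "\<not> dist (\<Psi> (B * x) / (\<Psi> x)\<^sup>2) 0 < e"
      moreover have "0 \<le> \<Psi> (B * x)" using B elim by (intro nonneg) auto
      ultimately have "e \<le> \<Psi> (B * x) / (\<Psi> x)\<^sup>2" by (simp add: dist_real_def)
      then have "\<epsilon> \<le> \<Psi> (B * x) / (\<Psi> x)\<^sup>2" using \<epsilon>(3) by linarith
      then show "\<epsilon> * (\<Psi> x)\<^sup>2 \<le> \<Psi> (B * x)" using elim(1) by (subst (asm) pos_le_divide_eq) auto
    qed
  qed
  then have large: "\<exists>\<^sub>F x in at_top. \<epsilon> * (\<Psi> x)\<^sup>2 \<le> \<Psi> (B * x)"
    by (rule frequently_rev_mp[OF \<open>\<exists>\<^sub>F x in at_top. \<not> dist (\<Psi> (B * x) / (\<Psi> x)\<^sup>2) 0 < e\<close>])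
  show False
  proof (cases "\<exists>K. \<forall>x\<ge>x0. \<Psi> (A * x) / \<Psi> x \<le> K")
    case False
    have "filterlim (\<lambda>x. \<Psi> (A * x) / \<Psi> x) at_top at_top"
      unfolding filterlim_at_top
    proof
      fix K
      obtain x where x: "x0 \<le> x" "K \<le> \<Psi> (A * x) / \<Psi> x" using False by (meson less_imp_le not_le)
      show "\<forall>\<^sub>F y in at_top. K \<le> \<Psi> (A * y) / \<Psi> y"
        using eventually_ge_at_top[of x]
      proof eventually_elim
        case (elim y)
        then have "\<Psi> (A * x) / \<Psi> x \<le> \<Psi> (A * y) / \<Psi> y"
          using ratio x unfolding mono_on_def by auto
        then show ?case using x(2) by linarith
      qed
    qed
    then show False using not_weakly_compact[OF A _ _ \<epsilon>(1,2) large] B weak by auto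
  next
    case True
    then obtain K0 where K0: "\<And>x. x0 \<le> x \<Longrightarrow> \<Psi> (A * x) / \<Psi> x \<le> K0" by blast
    define K where "K = max K0 1"
    obtain x1 where x1: "x0 < x1" "1 \<le> \<Psi> x1" using ex_ge by blast
    have K: "\<Psi> (A * x) \<le> K * \<Psi> x" if "x1 \<le> x" for x
    proof -
      have pos: "0 < \<Psi> x" using mono[of x1 x] x1 x0 that by linarith
      have "\<Psi> (A * x) / \<Psi> x \<le> K" using K0[of x] x1 that by (simp add: K_def le_max_iff_disj)
      then show ?thesis using pos by (simp only: pos_divide_le_eq)
    qed
    have iter: "\<Psi> (A ^ j * x) \<le> K ^ j * \<Psi> x" if "x1 \<le> x" for x j
    proof (induction j)
      case (Suc j)
      have "1 * x \<le> A ^ j * x" using A x1 x0 that by (intro mult_right_mono one_le_power) auto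
      then have "\<Psi> (A * (A ^ j * x)) \<le> K * \<Psi> (A ^ j * x)" using that by (intro K) simp
      also have "\<dots> \<le> K * (K ^ j * \<Psi> x)" using Suc by (intro mult_left_mono) (auto simp: K_def)
      finally show ?case by (simp add: mult.assoc)
    qed simp
    obtain j where j: "B < A ^ j" using real_arch_pow[OF A] by blast
    have "\<forall>\<^sub>F x in at_top. \<not> \<epsilon> * (\<Psi> x)\<^sup>2 \<le> \<Psi> (B * x)"
      using eventually_ge[of "K ^ j / \<epsilon> + 1"] eventually_ge_at_top[of x1]
    proof eventually_elim
      case (elim x)
      have Kj: "0 \<le> K ^ j / \<epsilon>" using \<epsilon> by (simp add: K_def)
      then have pos: "0 < \<Psi> x" using elim by linarith
      have "\<Psi> (B * x) \<le> \<Psi> (A ^ j * x)"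
        using j B elim x1 x0 by (intro mono mult_right_mono) auto
      also have "\<dots> \<le> K ^ j * \<Psi> x" by (rule iter[OF elim(2)])
      also have "\<dots> < (\<epsilon> * \<Psi> x) * \<Psi> x"
      proof (rule mult_strict_right_mono[OF _ pos])
        have "K ^ j / \<epsilon> < \<Psi> x" using elim by linarith
        then show "K ^ j < \<epsilon> * \<Psi> x" using \<epsilon> by (simp add: pos_divide_less_eq mult.commute)
      qed
      finally show ?case by (simp add: power2_eq_square mult.assoc)
    qed
    then show False using large by (simp add: frequently_def)
  qed
qed

end

theorem proposition2p3:
  fixes \<Psi> :: "real \<Rightarrow> real"
  assumes "Orlicz_function \<Psi>"
    and "\<exists>A>1. \<exists>x0>0. mono_on {x0..} (\<lambda>x. \<Psi> (A * x) / \<Psi> x)"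
  shows "weakly_compact_operator
           (Hardy_Orlicz \<Psi>) (Hardy_Orlicz_norm \<Psi>)
           (Bergman_Orlicz \<Psi>) (Bergman_Orlicz_norm \<Psi>) (canonical_injection \<Psi>)
     \<longleftrightarrow> compact_operator
           (Hardy_Orlicz \<Psi>) (Hardy_Orlicz_norm \<Psi>)
           (Bergman_Orlicz \<Psi>) (Bergman_Orlicz_norm \<Psi>) (canonical_injection \<Psi>)"
proof -
  interpret orlicz \<Psi> by unfold_locales (rule assms(1))
  let ?S = "closed_unit_ball (Hardy_Orlicz \<Psi>) (Hardy_Orlicz_norm \<Psi>)"
  obtain A x0 where A: "1 < A" and x0: "0 < x0" and ratio: "mono_on {x0..} (\<lambda>x. \<Psi> (A * x) / \<Psi> x)"
    using assms(2) by blast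
  have image: "canonical_injection \<Psi> ` ?S = ?S"
    by (force simp: canonical_injection_def closed_unit_ball_def)
  have "relatively_compact_in (norm_topology (Bergman_Orlicz \<Psi>) (Bergman_Orlicz_norm \<Psi>)) ?S"
    if weak: "relatively_compact_in (weak_topology (Bergman_Orlicz \<Psi>) (Bergman_Orlicz_norm \<Psi>)) ?S"
  proof (rule relatively_compact_normI)
    show SV: "?S \<subseteq> Bergman_Orlicz \<Psi>"
      using weak unfolding relatively_compact_in_def topspace_weak_topology by blast
    fix f :: "nat \<Rightarrow> complex \<Rightarrow> complex" assume f: "range f \<subseteq> ?S"
    have fS: "f n \<in> ?S" "f n \<in> Bergman_Orlicz \<Psi>" for n using f SV by auto
    show "\<exists>l r. l \<in> Bergman_Orlicz \<Psi> \<and> strict_mono (r :: nat \<Rightarrow> nat)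
        \<and> (\<lambda>n. Bergman_Orlicz_norm \<Psi> (\<lambda>z. f (r n) z - l z)) \<longlonglongrightarrow> 0"
      by (rule unit_ball_subsequence[where f = f, OF A x0 ratio growth_condition[OF A x0 ratio weak] fS])
        (assumption, intro exI conjI)
  qed
  then show ?thesis
    unfolding weakly_compact_operator_def compact_operator_def image
    using relatively_compact_norm_imp_weak by blast
qed

end
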